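(* Let $p\in\mathbb{N}$, $s\in\mathbb{N}_0$, $Y_s=\{y_i\}_{i=1}^s$ with $-1<y_s<\dots<y_1<1$ (empty if $s=0$), $A_p=\{\alpha_i\}_{i=1}^p$ with $-1\le\alpha_p<\dots<\alpha_1\le1$, $Y_s\cap A_p=\emptyset$, and let $(r,k,m_1,m_2,m_3)$ belong to $$\{(0,2,0,0,0),(1,3,0,0,0),(1,2,0,1,0),(2,3,1,1,1)\}\cup\{(2j,k,2j-1,2j-2,2j-1): j,k\in\mathbb{N}\}\cup\{(2j+1,k,2j-1,2j,2j): j\in\mathbb{N}_0,k\in\mathbb{N}\}.$$ Let $f\in C^r[-1,1]\cap\Delta^{(0)}(Y_s)$ and let $Z_n=\{z_j\}_{j=0}^n$, $-1=z_n<\dots<z_0=1$, be a knot sequence such that each nonempty open interval $(\beta_j,\beta_{j-1})$, $1\le j\le s+p+1$, contains at least $4(k+r-1)^2$ knots, where $Y_s\cup A_p=\{\beta_j\}_{j=1}^{s+p}$ with $\beta_{s+p}<\dots<\beta_1$, $\beta_0=1$, $\beta_{s+p+1}=-1$. Then there exists $S\in\Sigma_{k+r}(Z_n)\cap C^{k+r-2}[-1,1]\cap\Delta^{(0)}(Y_s)$ with $S^{(i)}(\alpha)=f^{(i)}(\alpha)$ for $\alpha\in A_p$, $0\le i\le m_1$ (vacuous if $m_1=-1$), $S^{(i)}(y)=f^{(i)}(y)$ for $y\in Y_s$, $0\le i\le m_2$, $S^{(i)}(\pm1)=f^{(i)}(\pm1)$ for $0\le i\le m_3$, and, for $0\le i\le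 n-1$, $$\|f-S\|_{C(J_i)}\le c\,|J_i|^r\,\omega_k(f^{(r)},|\widehat J_i|;\widehat J_i),\qquad c=c(k,r,\rho),$$ where $\widehat J_i$ is an interval with $J_i\subset\widehat J_i\subseteq[z_{i+6(k+r-1)^2},z_{i-6(k+r-1)^2}]$.
   Context: Set $z_i:=-1$ for $i>n$, $z_i:=1$ for $i<0$, $J_i:=[z_i,z_{i-1}]$, and $\rho:=\max\{|J_{i\pm1}|/|J_i|: 1\le i\le n\}$. $\Sigma_m(Z_n)$ denotes the set of continuous piecewise polynomials on $[-1,1]$ of degree $\le m-1$ on each $[z_j,z_{j-1}]$. $\omega_k(g,t;J)$ is the $k$-th modulus of smoothness on $J$. With $y_0:=1$, $y_{s+1}:=-1$, $h\in\Delta^{(0)}(Y_s)$ iff $(-1)^ih\ge0$ on $[y_{i+1},y_i]$ for $0\le i\le s$. *)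

theory Defs
  imports "HOL-Analysis.Analysis" "HOL-Computational_Algebra.Polynomial"
begin

text \<open>Admissible parameter tuples (r,k,m1,m2,m3); m1 may equal -1, hence int.\<close>
definition admissible :: "(nat \<times> nat \<times> int \<times> int \<times> int) set" where
  "admissible =
     {(0,2,0,0,0), (1,3,0,0,0), (1,2,0,1,0), (2,3,1,1,1)}
   \<union> {(2*j, k, 2*int j - 1, 2*int j - 2, 2*int j - 1) | j k. j \<ge> 1 \<and> k \<ge> 1}
   \<union> {(2*j+1, k, 2*int j - 1, 2*int j, 2*int j) | j k. k \<ge> 1}"

definition Cr_on :: "nat \<Rightarrow> real set \<Rightarrow> (real \<Rightarrow> real) \<Rightarrow> (nat \<Rightarrow> real \<Rightarrow> real) \<Rightarrow> bool" where
  "Cr_on r I g D \<longleftrightarrow>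
     (\<forall>x\<in>I. D 0 x = g x) \<and>
     (\<forall>i<r. \<forall>x\<in>I. (D i has_real_derivative D (Suc i) x) (at x within I)) \<and>
     continuous_on I (D r)"

definition knot_seq :: "nat \<Rightarrow> (nat \<Rightarrow> real) \<Rightarrow> bool" where
  "knot_seq n z \<longleftrightarrow> z 0 = 1 \<and> z n = -1 \<and> (\<forall>j<n. z (Suc j) < z j)"

definition zext :: "nat \<Rightarrow> (nat \<Rightarrow> real) \<Rightarrow> int \<Rightarrow> real" where
  "zext n z i = (if i < 0 then 1 else if i > int n then -1 else z (nat i))"

definition Jint :: "nat \<Rightarrow> (nat \<Rightarrow> real) \<Rightarrow> int \<Rightarrow> real set" where
  "Jint n z i = {zext n z i .. zext n z (i - 1)}"

definition Jlen :: "nat \<Rightarrow> (nat \<Rightarrow> real) \<Rightarrow> int \<Rightarrow> real" where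
  "Jlen n z i = zext n z (i - 1) - zext n z i"

definition rho :: "nat \<Rightarrow> (nat \<Rightarrow> real) \<Rightarrow> real" where
  "rho n z = Max ({Jlen n z (i - 1) / Jlen n z i | i. 1 \<le> i \<and> i \<le> int n}
                 \<union> {Jlen n z (i + 1) / Jlen n z i | i. 1 \<le> i \<and> i \<le> int n})"

definition Sigma :: "nat \<Rightarrow> nat \<Rightarrow> (nat \<Rightarrow> real) \<Rightarrow> (real \<Rightarrow> real) \<Rightarrow> bool" where
  "Sigma m n z S \<longleftrightarrow> continuous_on {-1..1} S \<and>
     (\<forall>j\<in>{1..n}. \<exists>P :: real poly. degree P \<le> m - 1 \<and>
        (\<forall>x\<in>{z j..z (j - 1)}. S x = poly P x))"

definition yext :: "nat \<Rightarrow> (nat \<Rightarrow> real) \<Rightarrow> nat \<Rightarrow> real" where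
  "yext s y i = (if i = 0 then 1 else if i = s + 1 then -1 else y i)"

definition Delta0 :: "nat \<Rightarrow> (nat \<Rightarrow> real) \<Rightarrow> (real \<Rightarrow> real) \<Rightarrow> bool" where
  "Delta0 s y h \<longleftrightarrow>
     (\<forall>i\<le>s. \<forall>x\<in>{yext s y (Suc i) .. yext s y i}. (-1) ^ i * h x \<ge> 0)"

definition beta :: "real set \<Rightarrow> nat \<Rightarrow> real" where
  "beta B j = (if j = 0 then 1 else if j > card B then -1
               else rev (sorted_list_of_set B) ! (j - 1))"

definition modsm :: "nat \<Rightarrow> (real \<Rightarrow> real) \<Rightarrow> real \<Rightarrow> real set \<Rightarrow> real" where
  "modsm k g t J = Sup {\<bar>\<Sum>i\<le>k. (-1) ^ (k - i) * real (k choose i) * g (x + real i * h)\<bar>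
                        | x h. 0 \<le> h \<and> h \<le> t \<and> x \<in> J \<and> x + real k * h \<in> J}"

end

theory Submission
  imports Defs "HOL-Computational_Algebra.Fundamental_Theorem_Algebra"
begin

text \<open>
Put \<open>m = k + r - 1\<close> and cut the knots into blocks of \<open>2 m\<^sup>2\<close> knot intervals. Two neighbouring blocks
contain at most one point of \<open>Y\<^sub>s \<union> A\<^sub>p \<union> {-1, 1}\<close>. On such a pair of blocks \<open>f\<close> is replaced by a
polynomial of degree \<open>m\<close> with the sign of \<open>f\<close> and the required contact at that point \<open>c\<close>: integrate a
Whitney approximant of \<open>f\<^sup>(\<^sup>r\<^sup>)\<close>, of error \<open>w\<close>, from \<open>c\<close>, which gives an error \<open>w |x - c|\<^sup>r\<close>, and add \<open>w\<close> times a
power of \<open>x - c\<close> of the parity dictated by the sign of \<open>f\<close>. This costs at most one order of contact, exactly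
what the two infinite parameter families allow; in the four sporadic cases the linear and quadratic Taylor
coefficients are adjusted instead.

Neighbouring polynomials \<open>p, q\<close> are joined over their common block by a spline whose graph stays between
theirs, as in a lemma of Beatson. This preserves the sign, the contact and the error bound. Some \<open>m\<close>
consecutive knot intervals of the block avoid the real parts of all complex roots of \<open>q - p\<close>; there
\<open>q - p\<close> or \<open>p - q\<close> has a nonnegative polar form, and truncating its B-spline expansion gives the transition.
\<close>

section \<open>Splines between two polynomials\<close>

text \<open>Pointwise nonnegativity is too weak for blending: a polynomial that is nonnegative on an
  interval can have negative B-spline coefficients, and truncating its expansion may then leave the
  strip between 0 and the polynomial. Asking for a nonnegative polar form instead excludes this. The
  size of a block comes from a count: a difference of degree at most m has at most m real parts of
  roots, so among 2 m runs of m knot intervals one is free of them.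

  The constant may depend on the mesh only through rho. Hence every local approximation lives on a
  bounded number of knot intervals, and in the sporadic cases, where corrections are divided by the
  distance from c to the end of the interval, this distance must be comparable with the length. The
  difference between 6 m^2 and the 4 m^2 knot intervals of a pair of blocks leaves the room for it.

  Squeezing a spline between two polynomials controls values and not derivatives. Interpolation is
  therefore carried through the joins as a relation of type o(|x - c|^M), and becomes equality of
  derivatives only for the finished spline, whose smoothness is known from its truncated
  powers.\<close>

definition tpow :: "real \<Rightarrow> nat \<Rightarrow> real \<Rightarrow> real" where
  "tpow t m x = (if t \<le> x then (x - t) ^ m else 0)"

text \<open>One polarization step. In degree m the terms of g and X g'/m cancel, so the degree bound
  drops by one; the power (X - a)^m becomes (u - a) (X - a)^(m - 1).\<close>

definition polar :: "nat \<Rightarrow> real \<Rightarrow> real poly \<Rightarrow> real poly" where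
  "polar m u g = g + smult (1 / real m) ([:u, -1:] * pderiv g)"

text \<open>The polar form of \<open>g\<close> at the elements of \<open>U\<close>, whose elementary symmetric functions are the
coefficients of \<open>\<Prod>u\<in>U. X + u\<close>. By \<open>blossom_insert\<close> below, inserting one argument is the operator \<open>polar\<close>.\<close>

definition blossom :: "nat \<Rightarrow> real poly \<Rightarrow> real set \<Rightarrow> real" where
  "blossom m g U = (\<Sum>k\<le>m. coeff g k / real (m choose k) * coeff (\<Prod>u\<in>U. [:u, 1:]) (m - k))"

lemma coeff_polar:
  "coeff (polar (Suc m) u g) k =
     (1 - real k / real (Suc m)) * coeff g k + u * real (Suc k) / real (Suc m) * coeff g (Suc k)"
  by (cases k) (simp_all add: polar_def coeff_pderiv coeff_pCons field_simps del: of_nat_Suc)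

lemma degree_polar:
  assumes "degree g \<le> Suc m"
  shows "degree (polar (Suc m) u g) \<le> m"
proof (rule degree_le, intro allI impI)
  fix i assume i: "m < i"
  have "coeff g (Suc i) = 0" using assms i by (intro coeff_eq_0) auto
  moreover have "(1 - real i / real (Suc m)) * coeff g i = 0"
    using assms i by (cases "i = Suc m") (auto intro: coeff_eq_0)
  ultimately show "coeff (polar (Suc m) u g) i = 0" by (simp add: coeff_polar del: of_nat_Suc)
qed

lemma blossom_insert:
  assumes "finite U" "u \<notin> U" "card U = m"
  shows "blossom (Suc m) g (insert u U) = blossom m (polar (Suc m) u g) U"
proof -
  define Q where "Q = (\<Prod>u\<in>U. [:u, 1:])"
  have degQ: "degree Q \<le> m"
    unfolding Q_def using degree_prod_sum_le[OF assms(1), of "\<lambda>u. [:u,1:]"] assms(3) by simp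
  \<comment> \<open>Two absorption identities turn the weights 1 / C(m + 1, .) into 1 / C(m, .), one
    for each of the two terms into which an elementary symmetric function of
    \<open>insert u U\<close> splits.\<close>
  have c1: "real (Suc m choose k) * (1 - real k / real (Suc m)) = real (m choose k)" if "k \<le> m" for k
  proof -
    have "(Suc m - k) * (Suc m choose k) = Suc m * (m choose k)"
      using binomial_absorb_comp[of "Suc m" k] by simp
    then have "real (Suc m - k) * real (Suc m choose k) = real (Suc m) * real (m choose k)"
      by (metis of_nat_mult)
    then show ?thesis using that by (simp add: of_nat_diff field_simps)
  qed
  have c2: "real (Suc m choose Suc k) * (real (Suc k) / real (Suc m)) = real (m choose k)" for k
  proof -
    have "Suc k * (Suc m choose Suc k) = Suc m * (m choose k)" by (rule Suc_times_binomial)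
    then have "real (Suc k) * real (Suc m choose Suc k) = real (Suc m) * real (m choose k)"
      by (metis of_nat_mult)
    then show ?thesis by (simp add: field_simps del: of_nat_Suc binomial_Suc_Suc)
  qed
  have coeffs: "coeff ([:u, 1:] * Q) (Suc i) = u * coeff Q (Suc i) + coeff Q i" for i
    by simp
  have "blossom (Suc m) g (insert u U)
      = (\<Sum>k\<le>Suc m. coeff g k / real (Suc m choose k) * (u * coeff Q (Suc m - k)))
        + (\<Sum>k\<le>Suc m. coeff g k / real (Suc m choose k) * (if k = Suc m then 0 else coeff Q (m - k)))"
    unfolding blossom_def sum.distrib[symmetric]
    using assms(1,2)
    by (intro sum.cong refl) (auto simp: Q_def[symmetric] Suc_diff_le algebra_simps simp del: binomial_Suc_Suc)
  also have "(\<Sum>k\<le>Suc m. coeff g k / real (Suc m choose k) * (u * coeff Q (Suc m - k)))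
      = (\<Sum>k\<le>m. coeff g (Suc k) / real (Suc m choose Suc k) * (u * coeff Q (m - k)))"
    using degQ by (subst sum.atMost_Suc_shift) (simp add: coeff_eq_0 del: binomial_Suc_Suc)
  also have "(\<Sum>k\<le>Suc m. coeff g k / real (Suc m choose k) * (if k = Suc m then 0 else coeff Q (m - k)))
      = (\<Sum>k\<le>m. coeff g k / real (Suc m choose k) * coeff Q (m - k))"
    by simp
  also have "(\<Sum>k\<le>m. coeff g (Suc k) / real (Suc m choose Suc k) * (u * coeff Q (m - k))) + \<dots>
      = blossom m (polar (Suc m) u g) U"
    unfolding blossom_def sum.distrib[symmetric] Q_def[symmetric]
  proof (intro sum.cong refl)
    fix k assume "k \<in> {..m}"
    then have k: "k \<le> m" by simp
    have p: "real (Suc m choose k) > 0" "real (Suc m choose Suc k) > 0" "real (m choose k) > 0"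
      using k by (simp_all del: binomial_Suc_Suc)
    have e1: "1 / real (Suc m choose k) = (1 - real k / real (Suc m)) / real (m choose k)"
      using c1[OF k] p by (simp add: field_simps del: of_nat_Suc binomial_Suc_Suc)
    have e2: "1 / real (Suc m choose Suc k) = (real (Suc k) / real (Suc m)) / real (m choose k)"
      using c2[of k] p by (simp add: field_simps del: of_nat_Suc binomial_Suc_Suc)
    have "coeff g (Suc k) / real (Suc m choose Suc k) * (u * coeff Q (m - k)) +
        coeff g k / real (Suc m choose k) * coeff Q (m - k)
      = (coeff g (Suc k) * u * (1 / real (Suc m choose Suc k)) + coeff g k * (1 / real (Suc m choose k))) * coeff Q (m - k)"
      by (simp add: algebra_simps del: binomial_Suc_Suc)
    also have "\<dots> = coeff (polar (Suc m) u g) k / real (m choose k) * coeff Q (m - k)"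
      unfolding e1 e2 coeff_polar by (simp add: algebra_simps add_divide_distrib diff_divide_distrib del: of_nat_Suc)
    finally show "coeff g (Suc k) / real (Suc m choose Suc k) * (u * coeff Q (m - k)) +
        coeff g k / real (Suc m choose k) * coeff Q (m - k)
      = coeff (polar (Suc m) u g) k / real (m choose k) * coeff Q (m - k)" .
  qed
  finally show ?thesis .
qed

section \<open>Truncated-power expansion of the transition\<close>

definition transition_coef :: "nat \<Rightarrow> (nat \<Rightarrow> real) \<Rightarrow> real poly \<Rightarrow> nat \<Rightarrow> real" where
  "transition_coef m t g q = (-1) ^ m * blossom m g (t ` ({..m} - {q})) / (\<Prod>j\<in>{..m} - {q}. t q - t j)"

text \<open>For \<open>g = (X - a)\<^sup>m\<close> the coefficients are the Lagrange basis polynomials for the nodes \<open>t 0, \<dots>, t m\<close>,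
evaluated at \<open>a\<close>; the polar form extends them linearly to all \<open>g\<close> of degree \<open>m\<close>.\<close>

definition transition_spline :: "nat \<Rightarrow> (nat \<Rightarrow> real) \<Rightarrow> real poly \<Rightarrow> real \<Rightarrow> real" where
  "transition_spline m t g x = (\<Sum>q\<le>m. transition_coef m t g q * tpow (t q) m x)"

lemma alternating_quotient_extend: "a \<noteq> b \<Longrightarrow> (-1) ^ m * B / P = (b - a) * ((-1) ^ Suc m * B / ((a - b) * P))"
  for a b B P :: real
  by (cases "P = 0") (simp_all add: divide_simps, simp add: algebra_simps)

text \<open>Deleting the last node: its factor leaves the denominator, and by
  \<open>blossom_insert\<close> it turns from an argument of the blossom into the point of a
  polarization. With the mirror statement for the first node this yields the recurrence for the
  spline.\<close>

lemma transition_coef_right: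
  assumes t: "strict_mono t" and q: "q \<le> m"
  shows "transition_coef m t (polar (Suc m) (t (Suc m)) g) q = (t (Suc m) - t q) * transition_coef (Suc m) t g q"
proof -
  have inj: "inj t" using t by (rule strict_mono_imp_inj_on)
  have S: "{..Suc m} - {q} = insert (Suc m) ({..m} - {q})" using q by auto
  have ne: "t q \<noteq> t (Suc m)" using inj q by (auto dest: injD)
  have b: "blossom (Suc m) g (insert (t (Suc m)) (t ` ({..m} - {q})))
     = blossom m (polar (Suc m) (t (Suc m)) g) (t ` ({..m} - {q}))"
    using q by (intro blossom_insert) (auto simp: inj_eq[OF inj] card_image[OF inj_on_subset[OF inj]])
  have pr: "(\<Prod>j\<in>insert (Suc m) ({..m} - {q}). t q - t j) = (t q - t (Suc m)) * (\<Prod>j\<in>{..m} - {q}. t q - t j)"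
    by simp
  show ?thesis
    unfolding transition_coef_def S pr image_insert b by (rule alternating_quotient_extend) (use ne in simp)
qed

lemma transition_coef_left:
  assumes t: "strict_mono t" and q: "q \<le> m"
  shows "transition_coef m (\<lambda>i. t (Suc i)) (polar (Suc m) (t 0) g) q = (t 0 - t (Suc q)) * transition_coef (Suc m) t g (Suc q)"
proof -
  have inj: "inj t" using t by (rule strict_mono_imp_inj_on)
  have inj': "inj (\<lambda>i. t (Suc i))" using inj by (auto intro!: injI dest: injD)
  have S: "{..Suc m} - {Suc q} = insert 0 (Suc ` ({..m} - {q}))"
    by (force simp: image_iff atMost_Suc_eq_insert_0)
  have ne: "t (Suc q) \<noteq> t 0" using inj by (auto dest: injD)
  have b: "blossom (Suc m) g (insert (t 0) ((\<lambda>i. t (Suc i)) ` ({..m} - {q})))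
     = blossom m (polar (Suc m) (t 0) g) ((\<lambda>i. t (Suc i)) ` ({..m} - {q}))"
    using q by (intro blossom_insert)
      (auto simp: inj_eq[OF inj] card_image[OF inj_on_subset[OF inj']])
  have pr: "(\<Prod>j\<in>Suc ` ({..m} - {q}). t (Suc q) - t j) = (\<Prod>j\<in>{..m} - {q}. t (Suc q) - t (Suc j))"
    by (subst prod.reindex) auto
  have pr': "(\<Prod>j\<in>insert 0 (Suc ` ({..m} - {q})). t (Suc q) - t j)
      = (t (Suc q) - t 0) * (\<Prod>j\<in>{..m} - {q}. t (Suc q) - t (Suc j))"
    by (simp add: pr)
  show ?thesis
    unfolding transition_coef_def S pr' image_insert image_image b by (rule alternating_quotient_extend) (use ne in simp)
qed

lemma tpow_Suc: "tpow t (Suc m) x = (x - t) * tpow t m x"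
  by (simp add: tpow_def)

text \<open>Counterpart of the Cox-de Boor recurrence. Termwise, with a and b the outer nodes, it is
  (x - a) (b - t) + (b - x) (a - t) = (b - a) (x - t), and the factor x - t raises the degree of the
  truncated power.\<close>

lemma transition_spline_rec:
  assumes t: "strict_mono t"
  shows "(t (Suc m) - t 0) * transition_spline (Suc m) t g x
    = (x - t 0) * transition_spline m t (polar (Suc m) (t (Suc m)) g) x
      + (t (Suc m) - x) * transition_spline m (\<lambda>i. t (Suc i)) (polar (Suc m) (t 0) g) x"
proof -
  let ?c = "transition_coef (Suc m) t g" and ?b = "t (Suc m)" and ?a = "t 0"
  \<comment> \<open>Both lower splines are written over the index range of the higher one; the added
    term, at the last respectively the first node, has the factor zero.\<close>
  have 1: "transition_spline m t (polar (Suc m) ?b g) x = (\<Sum>q\<le>Suc m. (?b - t q) * ?c q * tpow (t q) m x)"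
    unfolding transition_spline_def by (auto simp: transition_coef_right[OF t] intro!: sum.cong)
  have 2: "transition_spline m (\<lambda>i. t (Suc i)) (polar (Suc m) ?a g) x = (\<Sum>q\<le>Suc m. (?a - t q) * ?c q * tpow (t q) m x)"
    unfolding transition_spline_def by (subst sum.atMost_Suc_shift) (simp add: transition_coef_left[OF t])
  show ?thesis
    unfolding 1 2 unfolding transition_spline_def tpow_Suc sum_distrib_left sum.distrib[symmetric]
    by (intro sum.cong refl) (simp add: algebra_simps)
qed

text \<open>The polarization is affine in its point u and gives back g(x) at u = x, so interpolating
  linearly between u = a and u = b recovers g. These are the weights of
  \<open>transition_spline_rec\<close>, so the spline and g can be compared by induction on
  m.\<close>

lemma poly_polar_euler:
  "(x - a) * poly (polar m b g) x + (b - x) * poly (polar m a g) x = (b - a) * poly g x"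
proof -
  define w where "w = poly (pderiv g) x / real m"
  have "poly (polar m c g) x = poly g x + (c - x) * w" for c
    by (simp add: polar_def w_def algebra_simps diff_divide_distrib)
  then show ?thesis by (simp only:) (simp add: algebra_simps)
qed

lemma transition_spline_left:
  assumes "x < t 0" "strict_mono t"
  shows "transition_spline m t g x = 0"
proof -
  have "x < t q" for q using assms strict_mono_leD[of t 0 q] by simp
  then show ?thesis unfolding transition_spline_def tpow_def by (intro sum.neutral) (auto simp: not_le[symmetric])
qed

lemma transition_spline_right:
  assumes "strict_mono t" "degree g \<le> m" "t m \<le> x"
  shows "transition_spline m t g x = poly g x"
  using assms
proof (induction m arbitrary: t g)
  \<comment> \<open>\<open>tpow\<close> of degree 0 is the indicator of the closed half-line, so the
    claim holds at x = t 0 already.\<close>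
  case 0
  then obtain c where "g = [:c:]" by (metis degree_eq_zeroE le_zero_eq)
  with 0 show ?case by (simp add: transition_spline_def transition_coef_def blossom_def tpow_def)
next
  case (Suc m)
  have lt: "t m < t (Suc m)" "t 0 < t (Suc m)" using Suc.prems(1) by (auto simp: strict_mono_def)
  have sm: "strict_mono (\<lambda>i. t (Suc i))" using Suc.prems(1) by (auto simp: strict_mono_def)
  have "(t (Suc m) - t 0) * transition_spline (Suc m) t g x = (t (Suc m) - t 0) * poly g x"
    unfolding transition_spline_rec[OF Suc.prems(1)]
    using Suc.prems lt sm
    by (subst (1 2) Suc.IH) (auto intro: degree_polar simp: poly_polar_euler)
  then show ?case using lt by simp
qed

text \<open>Nonnegativity of the fully polarized form for all arguments in [a, b], unfolded one
  argument at a time. It is stronger than nonnegativity of g: the form of (X - c)^2 is (u - c) (v -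
  c), which is negative for arguments on different sides of c.\<close>

fun polar_nonneg :: "real \<Rightarrow> real \<Rightarrow> nat \<Rightarrow> real poly \<Rightarrow> bool" where
  "polar_nonneg a b 0 g \<longleftrightarrow> degree g = 0 \<and> 0 \<le> coeff g 0"
| "polar_nonneg a b (Suc m) g \<longleftrightarrow> degree g \<le> Suc m \<and> (\<forall>u\<in>{a..b}. polar_nonneg a b m (polar (Suc m) u g))"

lemma polar_nonneg_degree: "polar_nonneg a b m g \<Longrightarrow> degree g \<le> m"
  by (cases m) auto

lemma polar_nonneg_nonneg: "polar_nonneg a b m g \<Longrightarrow> x \<in> {a..b} \<Longrightarrow> 0 \<le> poly g x"
proof (induction m arbitrary: g)
  case 0
  then show ?case by (auto elim!: degree_eq_zeroE)
next
  case (Suc m)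
  then have "0 \<le> poly (polar (Suc m) x g) x" by auto
  then show ?case by (simp add: polar_def)
qed

text \<open>Between the outer nodes the recurrence has nonnegative weights, so both bounds pass from
  degree m to degree m + 1; the upper one uses that g obeys the same recurrence by
  \<open>poly_polar_euler\<close>.\<close>

lemma transition_spline_between:
  assumes "strict_mono t" "polar_nonneg a b m g" "x \<in> {a..b}" "a \<le> t 0" "t m \<le> b"
  shows "0 \<le> transition_spline m t g x \<and> transition_spline m t g x \<le> poly g x"
  using assms
proof (induction m arbitrary: t g)
  case 0
  then show ?case
    using polar_nonneg_nonneg[OF 0(2,3)] transition_spline_left[of x t 0 g] transition_spline_right[of t g 0 x] by (cases "x < t 0") auto
next
  case (Suc m)
  let ?l = "t (Suc m) - t 0"
  have lt: "t m < t (Suc m)" "t 0 < t (Suc m)" "t 0 < t (Suc 0)" using Suc.prems(1) by (auto simp: strict_mono_def)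
  have g0: "0 \<le> poly g x" using polar_nonneg_nonneg Suc.prems by blast
  have sm: "strict_mono (\<lambda>i. t (Suc i))" using Suc.prems(1) by (auto simp: strict_mono_def)
  consider "x < t 0" | "t (Suc m) \<le> x" | "t 0 \<le> x" "x \<le> t (Suc m)" by linarith
  then show ?case
  proof cases
    case 1 then show ?thesis using transition_spline_left Suc.prems(1) g0 by simp
  next
    case 2 then show ?thesis using transition_spline_right Suc.prems(1) g0 polar_nonneg_degree[OF Suc.prems(2)] by simp
  next
    case 3
    let ?p = "polar (Suc m) (t (Suc m)) g" and ?q = "polar (Suc m) (t 0) g"
    have P: "polar_nonneg a b m ?p" "polar_nonneg a b m ?q"
      using Suc.prems lt by auto
    have 1: "0 \<le> transition_spline m t ?p x \<and> transition_spline m t ?p x \<le> poly ?p x"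
      using Suc.prems P lt by (intro Suc.IH) auto
    have 2: "0 \<le> transition_spline m (\<lambda>i. t (Suc i)) ?q x \<and> transition_spline m (\<lambda>i. t (Suc i)) ?q x \<le> poly ?q x"
      using Suc.prems P lt sm by (intro Suc.IH) auto
    have "0 \<le> ?l * transition_spline (Suc m) t g x"
      unfolding transition_spline_rec[OF Suc.prems(1)] using 1 2 3 by simp
    moreover have "?l * transition_spline (Suc m) t g x \<le> ?l * poly g x"
      unfolding transition_spline_rec[OF Suc.prems(1)]
        poly_polar_euler[of x "t 0" "Suc m" "t (Suc m)" g, symmetric]
      using 1 2 3 by (intro add_mono mult_left_mono) auto
    ultimately show ?thesis using lt by (simp add: zero_le_mult_iff)
  qed
qed

section \<open>Products that keep the polar form nonnegative\<close>

lemma poly_polar: "poly (polar m u g) x = poly g x + (u - x) * (poly (pderiv g) x / real m)"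
  by (simp add: polar_def algebra_simps diff_divide_distrib)

lemma linear_poly_eq:
  fixes l :: "'a::zero poly"
  assumes "degree l \<le> 1"
  shows "l = [:coeff l 0, coeff l 1:]"
  using assms by (intro poly_eqI) (auto simp: coeff_pCons coeff_eq_0 split: nat.split)

lemma polar_add: "polar m u (g + h) = polar m u g + polar m u h"
  by (rule poly_eq_poly_eq_iff[THEN iffD1, OF ext])
     (simp add: poly_polar pderiv_add ring_distribs add_divide_distrib)

lemma polar_smult: "polar m u (smult c g) = smult c (polar m u g)"
  by (rule poly_eq_poly_eq_iff[THEN iffD1, OF ext])
     (simp add: poly_polar pderiv_smult algebra_simps)

lemma polar_nonneg_add: "polar_nonneg a b m g \<Longrightarrow> polar_nonneg a b m h \<Longrightarrow> polar_nonneg a b m (g + h)"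
  by (induction m arbitrary: g h) (auto simp: polar_add intro: degree_add_le elim!: degree_eq_zeroE)

lemma polar_nonneg_smult: "0 \<le> c \<Longrightarrow> polar_nonneg a b m g \<Longrightarrow> polar_nonneg a b m (smult c g)"
  by (induction m arbitrary: g) (auto simp: polar_smult)

text \<open>Leibniz rule: polarizing l g at u gives a nonnegative combination of l times the
  polarization of g and of l(u) g. The first term is covered by induction, the second by the
  hypothesis on g.\<close>

lemma polar_nonneg_mult_affine:
  assumes l: "degree l \<le> 1" "\<And>u. u \<in> {a..b} \<Longrightarrow> 0 \<le> poly l u"
  shows "polar_nonneg a b m g \<Longrightarrow> polar_nonneg a b (Suc m) (l * g)"
proof (induction m arbitrary: g)
  case 0
  obtain l0 l1 where l': "l = [:l0, l1:]"
    using linear_poly_eq[OF l(1)] by blast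
  obtain c where c: "g = [:c:]" "0 \<le> c" using 0 by (auto elim!: degree_eq_zeroE)
  have "polar 1 u (l * g) = [:poly l u * c:]" for u
    by (rule poly_eq_poly_eq_iff[THEN iffD1, OF ext])
       (simp add: poly_polar l' c pderiv_pCons algebra_simps)
  then show ?case using c l by (auto simp: degree_mult_le)
next
  case (Suc m)
  have "polar_nonneg a b (Suc m) (polar (Suc (Suc m)) u (l * g))" if u: "u \<in> {a..b}" for u
  proof -
    have eq: "polar (Suc (Suc m)) u (l * g)
      = smult (real (Suc m) / real (Suc (Suc m))) (l * polar (Suc m) u g)
        + smult (poly l u / real (Suc (Suc m))) g"
    proof (rule poly_eq_poly_eq_iff[THEN iffD1, OF ext])
      fix x
      obtain l0 l1 where l': "l = [:l0, l1:]" using linear_poly_eq[OF l(1)] by blast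
      define M where "M = real (Suc m)"
      have M: "M > 0" "real (Suc (Suc m)) = M + 1" by (simp_all add: M_def)
      have "poly l x * poly g x + (u - x) * (l1 * poly g x + poly l x * poly (pderiv g) x) / (M + 1)
         = M / (M + 1) * (poly l x * (poly g x + (u - x) * (poly (pderiv g) x / M))) + poly l u / (M + 1) * poly g x"
        using M(1) by (simp add: divide_simps l') (simp add: algebra_simps)
      then show "poly (polar (Suc (Suc m)) u (l * g)) x
        = poly (smult (real (Suc m) / real (Suc (Suc m))) (l * polar (Suc m) u g)
        + smult (poly l u / real (Suc (Suc m))) g) x"
        by (simp add: poly_polar M(2) M_def[symmetric] pderiv_mult l' pderiv_pCons algebra_simps
            del: of_nat_Suc mult_pCons_left mult_pCons_right)
    qed
    show ?thesis unfolding eq using Suc l u by (intro polar_nonneg_add polar_nonneg_smult Suc.IH) auto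
  qed
  moreover have "degree (l * g) \<le> Suc (Suc m)"
    using degree_mult_le[of l g] l(1) Suc.prems by simp
  ultimately show ?case by simp
qed

text \<open>Degree elevation is multiplication by the affine function 1.\<close>

lemma polar_nonneg_elevate: "m \<le> m' \<Longrightarrow> polar_nonneg a b m g \<Longrightarrow> polar_nonneg a b m' g"
proof (induction m' rule: dec_induct)
  case (step n)
  then show ?case using polar_nonneg_mult_affine[of 1 a b n g] by simp
qed

section \<open>Real polynomials and their complex roots\<close>

lemma poly_map_of_real_add:
  "poly (map_poly complex_of_real (p + q)) w = poly (map_poly complex_of_real p) w + poly (map_poly complex_of_real q) w"
proof -
  have "map_poly complex_of_real (p + q) = map_poly complex_of_real p + map_poly complex_of_real q"
    by (rule poly_eqI) (simp add: coeff_map_poly)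
  then show ?thesis by simp
qed

lemma poly_map_of_real_mult:
  "poly (map_poly complex_of_real (p * q)) w = poly (map_poly complex_of_real p) w * poly (map_poly complex_of_real q) w"
proof (induction p)
  case (pCons a p)
  have "map_poly complex_of_real (smult a q) = smult (of_real a) (map_poly complex_of_real q)"
    by (rule poly_eqI) (simp add: coeff_map_poly)
  then show ?case using pCons by (simp add: poly_map_of_real_add map_poly_pCons algebra_simps)
qed simp

lemma poly_map_of_real: "poly (map_poly complex_of_real p) (of_real x) = of_real (poly p x)"
  by (induction p) (simp_all add: map_poly_pCons)

text \<open>A nonreal root w is a root of the remainder modulo (X - Re w)^2 + (Im w)^2 as well; the
  remainder has real coefficients and degree at most 1, so it is zero. Completing the square keeps
  the real part visible as r.\<close>

lemma real_poly_root_cases: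
  fixes g :: "real poly"
  assumes "0 < degree g"
  obtains r h where "g = [:-r, 1:] * h"
  | r s h where "g = ([:-r, 1:]\<^sup>2 + [:s\<^sup>2:]) * h"
proof -
  let ?G = "map_poly complex_of_real g"
  have dG: "degree ?G = degree g" by (simp add: degree_map_poly)
  have "\<not> constant (poly ?G)" using assms by (simp add: constant_degree dG)
  then obtain w where w: "poly ?G w = 0" using fundamental_theorem_of_algebra by blast
  define q where "q = [:-Re w, 1:]\<^sup>2 + [:(Im w)\<^sup>2:]"
  have q': "q = [:(Re w)\<^sup>2 + (Im w)\<^sup>2, - 2 * Re w, 1:]"
    by (simp add: q_def power2_eq_square)
  have dq: "degree q = 2" by (simp add: q')
  have qw: "poly (map_poly complex_of_real q) w = 0"
    by (simp add: q' map_poly_pCons complex_eq_iff power2_eq_square algebra_simps)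
  define R where "R = g mod q"
  have gq: "g = q * (g div q) + R" by (simp add: R_def)
  have dR: "degree R < 2" unfolding R_def using degree_mod_less'[of q g] dq by (metis degree_0 degree_mod_less' zero_less_numeral zero_neq_numeral)
  then obtain c0 c1 where R: "R = [:c0, c1:]"
    using linear_poly_eq[of R] by fastforce
  have "poly (map_poly complex_of_real R) w = 0"
    using w qw by (subst (asm) gq) (simp add: poly_map_of_real_add poly_map_of_real_mult)
  then have Rw: "c1 * Im w = 0" "c0 + c1 * Re w = 0"
    by (simp_all add: R map_poly_pCons complex_eq_iff algebra_simps)
  show ?thesis
  proof (cases "Im w = 0")
    case True
    have "poly g (Re w) = 0"
    proof -
      have "w = complex_of_real (Re w)" using True by (simp add: complex_eq_iff)
      then have "poly ?G (complex_of_real (Re w)) = 0" using w by simp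
      then show ?thesis by (simp add: poly_map_of_real)
    qed
    then obtain h where "g = [:-Re w, 1:] * h" by (auto simp: poly_eq_0_iff_dvd elim: dvdE)
    then show ?thesis using that(1) by blast
  next
    case False
    then have "R = 0" using Rw R by simp
    then have "g = ([:-Re w, 1:]\<^sup>2 + [:(Im w)\<^sup>2:]) * (g div q)" using gq by (simp add: q_def)
    then show ?thesis using that(2) by blast
  qed
qed

text \<open>If r is not inside the interval, (X - r)^2 is the square of an affine function that is
  nonnegative on [a, b], and s^2 is a nonnegative constant, so the two closure rules apply. Hence
  only real parts of roots matter.\<close>

lemma polar_nonneg_mult_quadratic:
  assumes "polar_nonneg a b m h" "r \<le> a \<or> b \<le> r"
  shows "polar_nonneg a b (Suc (Suc m)) (([:-r, 1:]\<^sup>2 + [:s\<^sup>2:]) * h)"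
proof -
  define l where "l = (if r \<le> a then [:-r, 1:] else [:r, -1:])"
  have l: "degree l \<le> 1" "\<And>u. u \<in> {a..b} \<Longrightarrow> 0 \<le> poly l u"
    using assms(2) by (auto simp: l_def)
  have "([:-r, 1:]\<^sup>2 + [:s\<^sup>2:]) * h = l * (l * h) + smult (s\<^sup>2) h"
    by (rule poly_eq_poly_eq_iff[THEN iffD1, OF ext]) (auto simp: l_def power2_eq_square algebra_simps)
  moreover have "polar_nonneg a b (Suc (Suc m)) (l * (l * h))"
    using l assms(1) by (intro polar_nonneg_mult_affine)
  moreover have "polar_nonneg a b (Suc (Suc m)) (smult (s\<^sup>2) h)"
    by (rule polar_nonneg_smult, simp, rule polar_nonneg_elevate[OF _ assms(1)], simp)
  ultimately show ?thesis by (simp only: polar_nonneg_add)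
qed

text \<open>\<open>R\<close> consists of the real parts of the complex roots of \<open>g\<close>.\<close>

lemma polar_nonneg_off_finite_set:
  fixes g :: "real poly"
  assumes "g \<noteq> 0"
  shows "\<exists>R. finite R \<and> card R \<le> degree g \<and>
    (\<forall>a b. R \<inter> {a<..<b} = {} \<longrightarrow> a < b \<longrightarrow> polar_nonneg a b (degree g) g \<or> polar_nonneg a b (degree g) (- g))"
  using assms
proof (induction "degree g" arbitrary: g rule: less_induct)
  case less
  show ?case
  proof (cases "degree g = 0")
    case True
    then show ?thesis by (intro exI[of _ "{}"]) auto
  next
    case False
    then have "0 < degree g" by simp
    then show ?thesis
    proof (cases rule: real_poly_root_cases)
      case (1 r h)
      have h: "h \<noteq> 0" using 1 less.prems by auto
      have d: "degree g = Suc (degree h)" unfolding 1 using h by (subst degree_mult_eq) auto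
      obtain R where R: "finite R" "card R \<le> degree h"
        "\<And>a b. R \<inter> {a<..<b} = {} \<Longrightarrow> a < b \<Longrightarrow> polar_nonneg a b (degree h) h \<or> polar_nonneg a b (degree h) (- h)"
        using less.hyps[OF _ h] d by auto
      have "polar_nonneg a b (degree g) g \<or> polar_nonneg a b (degree g) (- g)" if ab: "insert r R \<inter> {a<..<b} = {}" "a < b" for a b
      proof -
        \<comment> \<open>The linear factor is oriented to be nonnegative on [a, b]. This may flip
          the sign of g, which the disjunction absorbs.\<close>
        define l where "l = (if r \<le> a then [:-r, 1:] else [:r, -1:])"
        have l: "degree l \<le> 1" "\<And>u. u \<in> {a..b} \<Longrightarrow> 0 \<le> poly l u"
          using ab by (auto simp: l_def)
        have "g = l * h \<and> - g = l * (- h) \<or> g = l * (- h) \<and> - g = l * h"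
          by (auto simp: l_def 1)
        then show ?thesis using polar_nonneg_mult_affine[OF l, where m = "degree h" and g = h] polar_nonneg_mult_affine[OF l, where m = "degree h" and g = "- h"] R(3)[of a b] ab
          unfolding d by auto
      qed
      then show ?thesis using R d by (intro exI[of _ "insert r R"]) (auto simp: card_insert_if)
    next
      case (2 r s h)
      have h: "h \<noteq> 0" using 2 less.prems by auto
      have "degree ([:-r, 1:]\<^sup>2 + [:s\<^sup>2:]) = 2" by (simp add: power2_eq_square)
      then have d: "degree g = Suc (Suc (degree h))"
        unfolding 2 using h by (subst degree_mult_eq) auto
      obtain R where R: "finite R" "card R \<le> degree h"
        "\<And>a b. R \<inter> {a<..<b} = {} \<Longrightarrow> a < b \<Longrightarrow> polar_nonneg a b (degree h) h \<or> polar_nonneg a b (degree h) (- h)"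
        using less.hyps[OF _ h] d by auto
      have "polar_nonneg a b (degree g) g \<or> polar_nonneg a b (degree g) (- g)" if ab: "insert r R \<inter> {a<..<b} = {}" "a < b" for a b
      proof -
        have "r \<le> a \<or> b \<le> r" using ab by auto
        then show ?thesis using polar_nonneg_mult_quadratic[of a b "degree h" h r s] polar_nonneg_mult_quadratic[of a b "degree h" "- h" r s]
            R(3)[of a b] ab unfolding d unfolding 2 by auto
      qed
      then show ?thesis using R d by (intro exI[of _ "insert r R"]) (auto simp: card_insert_if)
    qed
  qed
qed

text \<open>For g = q - p, adding T to p gives p on the left, q on the right and a value between
  them everywhere. The sign of g is controlled on one run of m knot intervals only; elsewhere T is 0
  or g, so bounds by min and max are the natural form.\<close>

lemma blending_spline:
  fixes z :: "nat \<Rightarrow> real"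
  assumes m: "1 \<le> m" and g: "degree g \<le> m"
    and z: "\<And>j. j < e + 2 * m\<^sup>2 \<Longrightarrow> z (Suc j) < z j"
  shows "\<exists>c. \<forall>x. let T = (\<Sum>i\<in>{e..e + 2 * m\<^sup>2}. c i * tpow (z i) m x) in
    (x \<le> z (e + 2 * m\<^sup>2) \<longrightarrow> T = 0) \<and> (z e \<le> x \<longrightarrow> T = poly g x) \<and>
    min 0 (poly g x) \<le> T \<and> T \<le> max 0 (poly g x)"
proof (cases "g = 0")
  case True
  then show ?thesis by (intro exI[of _ "\<lambda>_. 0"]) auto
next
  case False
  define d where "d = 2 * m\<^sup>2"
  have zmono: "z j < z i" if "i < j" "j \<le> e + d" for i j
    using that
  proof (induction j)
    case (Suc j)
    then show ?case using z[of j] by (cases "i = j") (auto simp: d_def)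
  qed simp
  have zmono': "z j \<le> z i" if "i \<le> j" "j \<le> e + d" for i j
    using zmono[of i j] that by (cases "i = j") auto
  obtain R where R: "finite R" "card R \<le> degree g"
    "\<And>a b. R \<inter> {a<..<b} = {} \<Longrightarrow> a < b \<Longrightarrow> polar_nonneg a b (degree g) g \<or> polar_nonneg a b (degree g) (- g)"
    using polar_nonneg_off_finite_set[OF False] by blast
  \<comment> \<open>2 m disjoint open runs of m knot intervals each; at most degree g <= m < 2 m of
    them can meet \<open>R\<close>.\<close>
  define ch where "ch i = {z (e + Suc i * m) <..< z (e + i * m)}" for i
  have ie: "e + Suc i * m \<le> e + d" if "i < 2 * m" for i
    using that mult_le_mono1[of "Suc i" "2 * m" m] by (simp add: d_def power2_eq_square)
  have "\<exists>i<2 * m. R \<inter> ch i = {}"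
  proof (rule ccontr)
    assume "\<not> ?thesis"
    then have "\<forall>i\<in>{..<2 * m}. \<exists>y. y \<in> R \<inter> ch i" by auto
    then obtain w where w: "\<And>i. i < 2 * m \<Longrightarrow> w i \<in> R \<inter> ch i"
      unfolding bchoice_iff by auto
    have lt: "w j < w i" if "i < j" "j < 2 * m" for i j
    proof -
      have "Suc i * m \<le> j * m" using that by (intro mult_le_mono1) simp
      moreover have "j * m \<le> Suc j * m" by simp
      ultimately have "z (e + j * m) \<le> z (e + Suc i * m)"
        using ie[OF that(2)] by (intro zmono') linarith+
      then show ?thesis using w[of i] w[of j] that by (auto simp: ch_def)
    qed
    have "inj_on w {..<2 * m}"
      by (rule linorder_inj_onI) (auto dest: lt)
    moreover have "w ` {..<2 * m} \<subseteq> R" using w by auto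
    ultimately have "2 * m \<le> card R" using card_inj_on_le[OF _ _ R(1)] by fastforce
    then show False using R(2) g m by simp
  qed
  then obtain i where i: "i < 2 * m" "R \<inter> ch i = {}" by blast
  define E where "E = e + Suc i * m"
  have E: "E \<le> e + d" "E - m = e + i * m" "m \<le> E" "e \<le> E - m" using ie[OF i(1)] by (simp_all add: E_def)
  \<comment> \<open>\<open>z\<close> decreases, so the run is read backwards. Beyond index m the
    values are arbitrary and serve only to make \<open>t\<close> strictly increasing on all natural
    numbers.\<close>
  define t where "t q = (if q \<le> m then z (E - q) else z (E - m) + real (q - m))" for q
  have t: "strict_mono t"
  proof (rule strict_monoI_Suc)
    fix q
    consider "Suc q \<le> m" | "q = m" | "m < q" by linarith
    then show "t q < t (Suc q)"
      using E zmono[of "E - Suc q" "E - q"] by cases (auto simp: t_def)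
  qed
  have P: "polar_nonneg (t 0) (t m) m g \<or> polar_nonneg (t 0) (t m) m (- g)"
  proof -
    have "t 0 < t m" using t m by (simp add: strict_mono_less)
    moreover have "R \<inter> {t 0<..<t m} = {}" using i(2) E by (simp add: t_def ch_def E_def)
    ultimately show ?thesis using R(3)[of "t 0" "t m"] polar_nonneg_elevate[OF g] by blast
  qed
  have main: "\<exists>c. \<forall>x. let T = (\<Sum>i\<in>{e..e + d}. c i * tpow (z i) m x) in
      (x \<le> z (e + d) \<longrightarrow> T = 0) \<and> (z e \<le> x \<longrightarrow> T = poly h x) \<and>
      min 0 (poly h x) \<le> T \<and> T \<le> max 0 (poly h x)"
    if P: "polar_nonneg (t 0) (t m) m h" for h
  proof -
    define c where "c j = (if j \<in> {E - m..E} then transition_coef m t h (E - j) else 0)" for j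
    have T: "(\<Sum>i\<in>{e..e + d}. c i * tpow (z i) m x) = transition_spline m t h x" for x
    proof -
      have "(\<Sum>i\<in>{e..e + d}. c i * tpow (z i) m x) = (\<Sum>i\<in>{E - m..E}. transition_coef m t h (E - i) * tpow (z i) m x)"
        using E by (intro sum.mono_neutral_cong_right) (auto simp: c_def)
      also have "\<dots> = (\<Sum>q\<le>m. transition_coef m t h q * tpow (t q) m x)"
        by (rule sum.reindex_bij_witness[of _ "\<lambda>q. E - q" "\<lambda>i. E - i"]) (use E in \<open>auto simp: t_def\<close>)
      finally show ?thesis by (simp add: transition_spline_def)
    qed
    have left: "transition_spline m t h x = 0" if "x \<le> t 0" for x
    proof (cases "x = t 0")
      case True
      have "x \<le> t q" for q using t True by (simp add: strict_mono_less_eq)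
      then show ?thesis using m unfolding transition_spline_def tpow_def by (intro sum.neutral) (auto simp: order_antisym_conv)
    qed (use transition_spline_left[OF _ t] that in simp)
    have right: "transition_spline m t h x = poly h x" if "t m \<le> x" for x
      using transition_spline_right[OF t polar_nonneg_degree[OF P] that] .
    have "min 0 (poly h x) \<le> transition_spline m t h x \<and> transition_spline m t h x \<le> max 0 (poly h x)" for x
      using left[of x] right[of x] transition_spline_between[OF t P, of x] by (cases "x \<in> {t 0..t m}") auto
    moreover have "z (e + d) \<le> t 0" "t m \<le> z e"
      using E zmono' by (auto simp: t_def)
    ultimately show ?thesis
      by (intro exI[of _ c]) (auto simp: T Let_def left right)
  qed
  show ?thesis
    using P
  proof
    assume "polar_nonneg (t 0) (t m) m (- g)"
    from main[OF this] obtain c where c: "\<And>x. let T = (\<Sum>i\<in>{e..e + d}. c i * tpow (z i) m x) in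
      (x \<le> z (e + d) \<longrightarrow> T = 0) \<and> (z e \<le> x \<longrightarrow> T = poly (- g) x) \<and>
      min 0 (poly (- g) x) \<le> T \<and> T \<le> max 0 (poly (- g) x)" by blast
    show ?thesis unfolding d_def[symmetric]
    proof (intro exI[of _ "\<lambda>i. - c i"] allI)
      fix x
      show "let T = (\<Sum>i\<in>{e..e + d}. - c i * tpow (z i) m x) in
      (x \<le> z (e + d) \<longrightarrow> T = 0) \<and> (z e \<le> x \<longrightarrow> T = poly g x) \<and>
      min 0 (poly g x) \<le> T \<and> T \<le> max 0 (poly g x)"
        using c[of x] unfolding Let_def mult_minus_left sum_negf poly_minus by linarith
    qed
  next
    assume "polar_nonneg (t 0) (t m) m g"
    then show ?thesis unfolding d_def[symmetric] by (rule main)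
  qed
qed

section \<open>Whitney's inequality\<close>

definition fdiff :: "nat \<Rightarrow> (real \<Rightarrow> real) \<Rightarrow> real \<Rightarrow> real \<Rightarrow> real" where
  "fdiff k g h x = (\<Sum>i\<le>k. (-1) ^ (k - i) * real (k choose i) * g (x + real i * h))"

lemma fdiff_0 [simp]: "fdiff 0 g h x = g x"
  by (simp add: fdiff_def)

lemma fdiff_Suc: "fdiff (Suc k) g h x = fdiff k g h (x + h) - fdiff k g h x"
proof -
  have "fdiff (Suc k) g h x = (-1) ^ Suc k * g x +
      (\<Sum>i\<le>k. (-1) ^ (k - i) * real (Suc k choose Suc i) * g (x + real (Suc i) * h))"
    unfolding fdiff_def by (subst sum.atMost_Suc_shift) simp
  also have "(\<Sum>i\<le>k. (-1) ^ (k - i) * real (Suc k choose Suc i) * g (x + real (Suc i) * h))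
     = (\<Sum>i\<le>k. (-1) ^ (k - i) * real (k choose i) * g (x + real (Suc i) * h))
       + (\<Sum>i\<le>k. (-1) ^ (k - i) * real (k choose Suc i) * g (x + real (Suc i) * h))"
    unfolding sum.distrib[symmetric] by (intro sum.cong refl) (simp add: algebra_simps)
  also have "(\<Sum>i\<le>k. (-1) ^ (k - i) * real (k choose i) * g (x + real (Suc i) * h)) = fdiff k g h (x + h)"
    unfolding fdiff_def by (intro sum.cong refl) (simp add: algebra_simps)
  also have "(-1) ^ Suc k * g x + (fdiff k g h (x + h)
      + (\<Sum>i\<le>k. (-1) ^ (k - i) * real (k choose Suc i) * g (x + real (Suc i) * h)))
    = fdiff k g h (x + h) - fdiff k g h x"
  proof -
    have "- fdiff k g h x = (\<Sum>i\<le>Suc k. (-1) ^ (Suc k - i) * real (k choose i) * g (x + real i * h))"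
      unfolding fdiff_def sum_negf[symmetric]
      by (simp add: Suc_diff_le)
    also have "\<dots> = (-1) ^ Suc k * g x + (\<Sum>i\<le>k. (-1) ^ (k - i) * real (k choose Suc i) * g (x + real (Suc i) * h))"
      by (subst sum.atMost_Suc_shift) simp
    finally show ?thesis by simp
  qed
  finally show ?thesis .
qed

lemma fdiff_diff: "fdiff k (\<lambda>x. f x - g x) h x = fdiff k f h x - fdiff k g h x"
  by (simp add: fdiff_def algebra_simps sum_subtractf)

lemma fdiff_shift: "fdiff k (\<lambda>x. g (x + c)) h x = fdiff k g h (x + c)"
  by (simp add: fdiff_def algebra_simps)

text \<open>One difference cancels the leading coefficient, so the degree drops with every
  step.\<close>

lemma fdiff_poly: "degree q < k \<Longrightarrow> fdiff k (poly q) h x = 0"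
proof (induction k arbitrary: q x)
  case (Suc k)
  define q' where "q' = pcompose q [:h, 1:] - q"
  have q': "poly q' y = poly q (y + h) - poly q y" for y
    by (simp add: q'_def poly_pcompose add.commute)
  have "fdiff (Suc k) (poly q) h x = fdiff k (poly q') h x"
    unfolding fdiff_Suc q'[abs_def] fdiff_diff by (simp add: fdiff_shift[of k "poly q"])
  also have "\<dots> = 0"
  proof (cases "q' = 0")
    case True
    then show ?thesis by (simp add: fdiff_def)
  next
    case False
    have "degree q \<noteq> 0"
    proof
      assume "degree q = 0"
      then obtain c where "q = [:c:]" by (rule degree_eq_zeroE)
      then show False using False by (simp add: q'_def)
    qed
    have d: "degree (pcompose q [:h, 1:]) = degree q" by (simp add: degree_pcompose)
    have "degree q' \<le> degree q" unfolding q'_def using d by (intro degree_diff_le) auto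
    moreover have "coeff q' (degree q) = 0"
      using lead_coeff_comp[of "[:h, 1:]" q] unfolding d by (simp add: q'_def)
    ultimately have "degree q' < degree q" using False
      by (metis leading_coeff_0_iff order_le_less)
    then show ?thesis using Suc by (intro Suc.IH) auto
  qed
  finally show ?case .
qed simp

lemma abs_sum_binomial_le:
  assumes "\<And>i. i \<le> k \<Longrightarrow> \<bar>c i\<bar> \<le> B"
  shows "\<bar>\<Sum>i\<le>k. (-1) ^ (k - i) * real (k choose i) * c i\<bar> \<le> 2 ^ k * B"
proof -
  have "\<bar>\<Sum>i\<le>k. (-1) ^ (k - i) * real (k choose i) * c i\<bar>
      \<le> (\<Sum>i\<le>k. \<bar>(-1) ^ (k - i) * real (k choose i) * c i\<bar>)" by (rule sum_abs)
  also have "\<dots> \<le> (\<Sum>i\<le>k. real (k choose i) * B)"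
    using assms by (intro sum_mono) (simp add: abs_mult mult_left_mono)
  also have "\<dots> = 2 ^ k * B"
    by (simp add: sum_distrib_right[symmetric] choose_row_sum of_nat_sum[symmetric] del: of_nat_sum)
  finally show ?thesis .
qed

definition modset :: "nat \<Rightarrow> (real \<Rightarrow> real) \<Rightarrow> real \<Rightarrow> real set \<Rightarrow> real set" where
  "modset k g t J = {\<bar>fdiff k g h x\<bar> | x h. 0 \<le> h \<and> h \<le> t \<and> x \<in> J \<and> x + real k * h \<in> J}"

lemma modsm_modset: "modsm k g t J = Sup (modset k g t J)"
  by (simp add: modsm_def modset_def fdiff_def)

lemma bdd_above_modset:
  assumes "continuous_on {a..b} g"
  shows "bdd_above (modset k g t {a..b})"
proof -
  have "bounded (g ` {a..b})"
    using assms by (intro compact_imp_bounded compact_continuous_image) auto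
  then obtain B where "\<forall>y\<in>g ` {a..b}. norm y \<le> B"
    unfolding bounded_iff by blast
  then have B: "\<bar>g x\<bar> \<le> B" if "x \<in> {a..b}" for x using that by simp
  show ?thesis
  proof (rule bdd_aboveI)
    fix v assume "v \<in> modset k g t {a..b}"
    then obtain x h where v: "v = \<bar>fdiff k g h x\<bar>" "0 \<le> h" "x \<in> {a..b}" "x + real k * h \<in> {a..b}"
      by (auto simp: modset_def)
    have "x + real i * h \<in> {a..b}" if "i \<le> k" for i
    proof -
      have "0 \<le> real i * h" "real i * h \<le> real k * h" using v that by (auto intro: mult_right_mono)
      then have "a \<le> x + real i * h" "x + real i * h \<le> b" using v(3,4) unfolding atLeastAtMost_iff by linarith+
      then show ?thesis by simp
    qed
    then show "v \<le> 2 ^ k * B" unfolding v fdiff_def by (intro abs_sum_binomial_le B) auto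
  qed
qed

lemma fdiff_le_modsm:
  assumes "continuous_on {a..b} g" "0 \<le> h" "h \<le> t" "x \<in> {a..b}" "x + real k * h \<in> {a..b}"
  shows "\<bar>fdiff k g h x\<bar> \<le> modsm k g t {a..b}"
  unfolding modsm_modset
  using assms by (intro cSup_upper bdd_above_modset) (auto simp: modset_def)

lemma fdiff_le_modsm_length:
  assumes "continuous_on {a..b} g" "1 \<le> k" "0 \<le> h" "a \<le> x" "x + real k * h \<le> b"
  shows "\<bar>fdiff k g h x\<bar> \<le> modsm k g (b - a) {a..b}"
proof -
  have "1 * h \<le> real k * h" using assms by (intro mult_right_mono) auto
  then show ?thesis using assms by (intro fdiff_le_modsm) auto
qed

lemma modsm_nonneg:
  assumes "continuous_on {a..b} g" "a \<le> b" "0 \<le> t"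
  shows "0 \<le> modsm k g t {a..b}"
  using fdiff_le_modsm[OF assms(1), of 0 t a k] assms by auto

lemma modsm_mono:
  assumes "continuous_on {a..b} g" "a \<le> c" "c \<le> d" "d \<le> b" "0 \<le> s" "s \<le> t"
  shows "modsm k g s {c..d} \<le> modsm k g t {a..b}"
  unfolding modsm_modset
proof (rule cSup_subset_mono)
  have "\<bar>fdiff k g 0 c\<bar> \<in> modset k g s {c..d}" 
    using assms unfolding modset_def by (intro CollectI exI[of _ c] exI[of _ 0]) simp
  then show "modset k g s {c..d} \<noteq> {}" by blast
  show "bdd_above (modset k g t {a..b})" by (rule bdd_above_modset[OF assms(1)])
  show "modset k g s {c..d} \<subseteq> modset k g t {a..b}"
    using assms unfolding modset_def by force
qed

lemma modsm_uminus: "modsm k (\<lambda>x. - g x) t J = modsm k g t J"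
proof -
  have "fdiff k (\<lambda>x. - g x) h x = - fdiff k g h x" for h x
    by (simp add: fdiff_def sum_negf)
  then show ?thesis by (simp add: modsm_modset modset_def)
qed

section \<open>Iterated Steklov means\<close>

fun steklov :: "(real \<Rightarrow> real) \<Rightarrow> real \<Rightarrow> nat \<Rightarrow> real \<Rightarrow> real" where
  "steklov G h 0 x = G x"
| "steklov G h (Suc i) x = integral {0..1} (\<lambda>t. steklov G h i (x + h * t))"

text \<open>Reduces a mean to a difference quotient of an antiderivative, so that continuity and
  differentiability in x need no theory of integrals with a parameter.\<close>

lemma steklov_antiderivative:
  assumes "continuous_on UNIV A"
  obtains P :: "real \<Rightarrow> real" where "\<And>x. (P has_real_derivative A x) (at x)"
    "\<And>h x. h \<noteq> 0 \<Longrightarrow> integral {0..1} (\<lambda>t. A (x + h * t)) = (P (x + h) - P x) / h"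
proof -
  have "\<exists>P. \<forall>x. -\<infinity> < ereal x \<longrightarrow> ereal x < \<infinity> \<longrightarrow> (P has_vector_derivative A x) (at x)"
    using assms by (intro einterval_antiderivative) (auto simp: continuous_on_eq_continuous_at)
  then obtain P where P: "\<And>x. (P has_real_derivative A x) (at x)"
    by (auto simp: has_real_derivative_iff_has_vector_derivative)
  have "integral {0..1} (\<lambda>t. A (x + h * t)) = (P (x + h) - P x) / h" if "h \<noteq> 0" for h x
  proof -
    have "((\<lambda>t. A (x + h * t)) has_integral (P (x + h * 1) / h - P (x + h * 0) / h)) {0..1}"
    proof (rule fundamental_theorem_of_calculus)
      fix t assume "t \<in> {0..1::real}"
      have "((\<lambda>t. P (x + h * t)) has_real_derivative A (x + h * t) * h) (at t)"
        by (rule DERIV_chain2[OF P]) (auto intro!: derivative_eq_intros)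
      from DERIV_cdivide[OF this, of h]
      have "((\<lambda>t. P (x + h * t) / h) has_real_derivative A (x + h * t)) (at t)"
        using that by simp
      then show "((\<lambda>t. P (x + h * t) / h) has_vector_derivative A (x + h * t)) (at t within {0..1})"
        by (simp add: has_real_derivative_iff_has_vector_derivative has_vector_derivative_at_within)
    qed simp
    then show ?thesis by (simp add: integral_unique diff_divide_distrib)
  qed
  then show ?thesis using P that by blast
qed

lemma steklov_zero_step: "steklov G 0 i x = G x"
  by (induction i arbitrary: x) simp_all

lemma continuous_steklov:
  assumes "continuous_on UNIV G"
  shows "continuous_on UNIV (steklov G h i)"
proof (cases "h = 0")
  case True
  then have "steklov G h i = G" by (auto simp: steklov_zero_step)
  then show ?thesis using assms by simp
next
  case False
  show ?thesis
  proof (induction i)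
    case (Suc i)
    obtain P where P: "\<And>x. (P has_real_derivative steklov G h i x) (at x)"
      "\<And>x. integral {0..1} (\<lambda>t. steklov G h i (x + h * t)) = (P (x + h) - P x) / h"
      by (rule steklov_antiderivative[OF Suc]) (use False that in blast)
    have cP: "continuous_on UNIV P"
      by (rule continuous_at_imp_continuous_on) (use P(1) DERIV_isCont in blast)
    have "continuous_on UNIV (\<lambda>x. P (x + h))"
      by (rule continuous_on_compose2[OF cP]) (auto intro: continuous_intros)
    then have "continuous_on UNIV (\<lambda>x. (P (x + h) - P x) / h)"
      using cP False by (intro continuous_intros) auto
    then show ?case using P(2) by simp
  qed (use assms in simp)
qed

lemma has_derivative_steklov:
  assumes "continuous_on UNIV G" "h \<noteq> 0"
  shows "(steklov G h (Suc i) has_real_derivative (steklov G h i (x + h) - steklov G h i x) / h) (at x)"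
proof -
  obtain P where P: "\<And>x. (P has_real_derivative steklov G h i x) (at x)"
    "\<And>x. integral {0..1} (\<lambda>t. steklov G h i (x + h * t)) = (P (x + h) - P x) / h"
    by (rule steklov_antiderivative[OF continuous_steklov[OF assms(1)]]) (use assms(2) that in blast)
  have eq: "steklov G h (Suc i) = (\<lambda>x. (P (x + h) - P x) / h)"
    using P(2) by auto
  have "((\<lambda>x. P (x + h)) has_real_derivative steklov G h i (x + h)) (at x)"
    using P(1)[of "x + h"] by (simp add: DERIV_shift)
  then show ?thesis
    unfolding eq using P(1)[of x] by (intro DERIV_cdivide DERIV_diff)
qed

lemma has_derivative_fdiff:
  assumes "\<And>x. (g has_real_derivative g' x) (at x)"
  shows "((\<lambda>x. fdiff k g h x) has_real_derivative fdiff k g' h x) (at x)"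
proof -
  have "((\<lambda>x. g (x + c)) has_real_derivative g' (x + c)) (at x)" for c
    using assms[of "x + c"] by (simp add: DERIV_shift)
  then show ?thesis unfolding fdiff_def by (intro DERIV_sum DERIV_cmult)
qed

text \<open>Differentiation trades one mean for one difference of the same step. After k derivatives
  of a k-fold mean the k-th difference of G itself, divided by h^k, is left.\<close>

lemma has_derivative_fdiff_steklov:
  assumes "continuous_on UNIV G" "h \<noteq> 0"
  shows "((\<lambda>x. fdiff j (steklov G h (Suc i)) h x) has_real_derivative
           fdiff (Suc j) (steklov G h i) h x / h) (at x)"
proof -
  have "fdiff j (\<lambda>x. (steklov G h i (x + h) - steklov G h i x) / h) h x
     = fdiff j (\<lambda>x. steklov G h i (x + h) - steklov G h i x) h x / h"
    by (simp add: fdiff_def sum_divide_distrib)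
  also have "\<dots> = fdiff (Suc j) (steklov G h i) h x / h"
    by (simp add: fdiff_diff fdiff_Suc fdiff_shift)
  finally have eq: "fdiff j (\<lambda>x. (steklov G h i (x + h) - steklov G h i x) / h) h x
     = fdiff (Suc j) (steklov G h i) h x / h" .
  show ?thesis
    unfolding eq[symmetric] by (rule has_derivative_fdiff[OF has_derivative_steklov[OF assms]])
qed

text \<open>Smooth \<open>g\<close> by a combination \<open>D 0\<close> of iterated Steklov means such that \<open>g - D 0\<close> is a mean of \<open>k\<close>-th differences
of \<open>g\<close>, while the \<open>k\<close>-th derivative of \<open>D 0\<close> is a combination of \<open>k\<close>-th differences; then expand \<open>D 0\<close> at \<open>a\<close>. Only the
left half of the interval leaves room for forward differences.\<close>

lemma whitney_left_half:
  assumes g: "continuous_on {a..b} g" and ab: "a < b" and k: "1 \<le> k"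
  shows "\<exists>q. degree q < k \<and> (\<forall>x\<in>{a..(a + b) / 2}.
     \<bar>g x - poly q x\<bar> \<le> (1 + 2 ^ k * (real k)\<^sup>2 ^ k) * modsm k g (b - a) {a..b})"
proof -
  define w where "w = modsm k g (b - a) {a..b}"
  define mid where "mid = (a + b) / 2"
  \<comment> \<open>Constant extension, so that means can be formed on the whole line; the
    differences estimated below evaluate it inside [a, b] only.\<close>
  define G where "G x = g (max a (min b x))" for x
  have G: "continuous_on UNIV G"
    unfolding G_def by (rule continuous_on_compose2[OF g]) (use ab in \<open>auto intro!: continuous_intros\<close>)
  have Gg: "G x = g x" if "x \<in> {a..b}" for x using that by (simp add: G_def)
  \<comment> \<open>A node of a k-th difference is shifted by at most k times the step, and k
    averaged shifts make the step as large as k \<delta>; the total k^2 \<delta> is half of the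
    interval.\<close>
  define \<delta> where "\<delta> = (b - a) / (2 * (real k)\<^sup>2)"
  have \<delta>: "\<delta> > 0" "real k * (real k * \<delta>) = (b - a) / 2"
    using ab k by (auto simp: \<delta>_def power2_eq_square field_simps)
  have w0: "0 \<le> w" unfolding w_def using ab by (intro modsm_nonneg g) auto
  have fd: "\<bar>fdiff k G h x\<bar> \<le> w" if "0 \<le> h" "h \<le> real k * \<delta>" "x \<in> {a..mid}" for h x
  proof -
    have h: "real k * h \<le> (b - a) / 2" using mult_left_mono[OF that(2), of "real k"] \<delta>(2) by simp
    have "fdiff k G h x = fdiff k g h x"
      unfolding fdiff_def
    proof (intro sum.cong refl)
      fix i assume "i \<in> {..k}"
      then have "0 \<le> real i * h" "real i * h \<le> real k * h" using that by (auto intro: mult_right_mono)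
      moreover have "a \<le> x + ih \<and> x + ih \<le> b"
        if "0 \<le> ih" "ih \<le> kh" "kh \<le> (b - a) / 2" "x \<in> {a..mid}" for ih kh :: real
        using that by (simp add: mid_def)
      ultimately have "a \<le> x + real i * h \<and> x + real i * h \<le> b" using h that(3) by blast
      then have "x + real i * h \<in> {a..b}" by simp
      then show "(-1) ^ (k - i) * real (k choose i) * G (x + real i * h) = (-1) ^ (k - i) * real (k choose i) * g (x + real i * h)"
        by (simp add: Gg)
    qed
    also have "\<bar>\<dots>\<bar> \<le> w" unfolding w_def
      using that h by (intro fdiff_le_modsm_length g k) (auto simp: mid_def field_simps)
    finally show ?thesis by simp
  qed
  define c where "c j = (-1) ^ (k - j) * real (k choose j)" for j
  \<comment> \<open>The k-th difference of G at x with step \<delta> (s + t_1 + ... + t_i), averaged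
    over all t in [0, 1]. The condition s <= k - i below keeps this step at most k \<delta>.\<close>
  define H where "H i x s = (\<Sum>j\<le>k. c j * steklov G (real j * \<delta>) i (x + real j * \<delta> * s))" for i x s
  have contH: "continuous_on UNIV (H i x)" for i x
    unfolding H_def
    by (intro continuous_intros continuous_on_compose2[OF continuous_steklov[OF G]]) auto
  have H: "\<bar>H i x s\<bar> \<le> w" if "i \<le> k" "0 \<le> s" "s \<le> real (k - i)" "x \<in> {a..mid}" for i s x
    using that
  proof (induction i arbitrary: s)
    case 0
    have "H 0 x s = fdiff k G (\<delta> * s) x"
      by (simp add: H_def c_def fdiff_def mult.assoc)
    also have "\<bar>\<dots>\<bar> \<le> w"
      using 0 \<delta> mult_left_mono[of s "real k" \<delta>] by (intro fd) (auto simp: mult.commute)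
    finally show ?case .
  next
    case (Suc i)
    have "H (Suc i) x s = integral {0..1} (\<lambda>t. H i x (s + t))"
      unfolding H_def
    proof (subst integral_sum)
      fix j assume "j \<in> {..k}"
      show "(\<lambda>t. c j * steklov G (real j * \<delta>) i (x + real j * \<delta> * (s + t))) integrable_on {0..1}"
        by (intro integrable_continuous_real continuous_intros continuous_on_compose2[OF continuous_steklov[OF G]]) auto
    next
      show "(\<Sum>j\<le>k. c j * steklov G (real j * \<delta>) (Suc i) (x + real j * \<delta> * s)) =
        (\<Sum>j\<le>k. integral {0..1} (\<lambda>t. c j * steklov G (real j * \<delta>) i (x + real j * \<delta> * (s + t))))"
        by (intro sum.cong refl) (simp add: algebra_simps)
    qed simp
    also have "norm \<dots> \<le> w * (1 - 0)"
    proof (rule integral_bound)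
      show "continuous_on {0..1} (\<lambda>t. H i x (s + t))"
        by (rule continuous_on_compose2[OF contH]) (auto intro: continuous_intros)
      show "norm (H i x (s + t)) \<le> w" if "t \<in> {0..1}" for t
        using Suc.prems that by (auto intro!: Suc.IH simp: of_nat_diff)
    qed simp
    finally show ?case by simp
  qed
  \<comment> \<open>The term with index 0 in \<open>H k x 0\<close> is (-1)^k G(x), because a mean
    of step 0 is G itself. Solving for it, the remaining terms form \<open>D 0\<close>;
    \<open>D j\<close> is its j-th derivative.\<close>
  define D where "D j y = - ((-1) ^ k) * (\<Sum>i=1..k. c i / (real i * \<delta>) ^ j *
      fdiff j (steklov G (real i * \<delta>) (k - j)) (real i * \<delta>) y)" for j y
  have deriv: "(D j has_real_derivative D (Suc j) y) (at y)" if "j < k" for j y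
  proof -
    have "((\<lambda>y. c i / (real i * \<delta>) ^ j * fdiff j (steklov G (real i * \<delta>) (k - j)) (real i * \<delta>) y)
       has_real_derivative c i / (real i * \<delta>) ^ Suc j *
          fdiff (Suc j) (steklov G (real i * \<delta>) (k - Suc j)) (real i * \<delta>) y) (at y)" if "i \<in> {1..k}" for i
    proof -
      have h: "real i * \<delta> \<noteq> 0" using that \<delta>(1) by auto
      have kj: "k - j = Suc (k - Suc j)" using \<open>j < k\<close> by simp
      show ?thesis
        using DERIV_cmult[OF has_derivative_fdiff_steklov[OF G h, of j "k - Suc j" y], of "c i / (real i * \<delta>) ^ j"]
        unfolding kj by (simp add: mult.commute mult.left_commute)
    qed
    then show ?thesis unfolding D_def[abs_def] by (intro DERIV_cmult DERIV_sum)
  qed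
  have D0: "\<bar>g x - D 0 x\<bar> \<le> w" if "x \<in> {a..mid}" for x
  proof -
    have "H k x 0 = c 0 * G x + (\<Sum>i=1..k. c i * steklov G (real i * \<delta>) k x)"
      unfolding H_def atMost_atLeast0 by (subst sum.atLeast_Suc_atMost) (auto simp: steklov_zero_step)
    then have "g x - D 0 x = (-1) ^ k * H k x 0"
      using that by (simp add: D_def c_def Gg mid_def algebra_simps flip: power_add mult_2)
    then show ?thesis using H[of k 0 x] that by (simp add: abs_mult power_abs)
  qed
  have Dk: "\<bar>D k x\<bar> \<le> 2 ^ k * w / \<delta> ^ k" if "x \<in> {a..mid}" for x
  proof -
    have "\<bar>D k x\<bar> \<le> (\<Sum>i=1..k. \<bar>c i / (real i * \<delta>) ^ k * fdiff k G (real i * \<delta>) x\<bar>)"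
    proof -
      have "steklov G h 0 = G" for h by auto
      then have "D k x = - ((-1) ^ k) * (\<Sum>i=1..k. c i / (real i * \<delta>) ^ k * fdiff k G (real i * \<delta>) x)"
        unfolding D_def by simp
      then have "\<bar>D k x\<bar> = \<bar>\<Sum>i=1..k. c i / (real i * \<delta>) ^ k * fdiff k G (real i * \<delta>) x\<bar>"
        by (simp only: abs_mult abs_minus_cancel power_abs abs_one power_one mult_1)
      then show ?thesis by (simp only: sum_abs)
    qed
    also have "\<dots> \<le> (\<Sum>i=1..k. real (k choose i) * (w / \<delta> ^ k))"
    proof (intro sum_mono)
      fix i assume i: "i \<in> {1..k}"
      have f: "\<bar>fdiff k G (real i * \<delta>) x\<bar> \<le> w" using i \<delta> that by (intro fd) auto
      have "\<delta> ^ k \<le> (real i * \<delta>) ^ k" using i \<delta>(1) by (intro power_mono) auto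
      then have "\<bar>fdiff k G (real i * \<delta>) x\<bar> / (real i * \<delta>) ^ k \<le> w / \<delta> ^ k"
        using f \<delta>(1) i by (intro frac_le) auto
      then have "real (k choose i) * (\<bar>fdiff k G (real i * \<delta>) x\<bar> / (real i * \<delta>) ^ k) \<le> real (k choose i) * (w / \<delta> ^ k)"
        by (rule mult_left_mono) simp
      then show "\<bar>c i / (real i * \<delta>) ^ k * fdiff k G (real i * \<delta>) x\<bar> \<le> real (k choose i) * (w / \<delta> ^ k)"
        using \<delta>(1) by (simp add: c_def abs_mult power_abs)
    qed
    also have "\<dots> \<le> (\<Sum>i\<le>k. real (k choose i) * (w / \<delta> ^ k))"
      using w0 \<delta>(1) by (intro sum_mono2) auto
    also have "\<dots> = real (\<Sum>i\<le>k. k choose i) * (w / \<delta> ^ k)"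
      unfolding sum_distrib_right of_nat_sum ..
    also have "\<dots> = 2 ^ k * w / \<delta> ^ k"
      by (simp only: choose_row_sum) simp
    finally show ?thesis .
  qed
  \<comment> \<open>Taylor polynomial of \<open>D 0\<close> at a; its remainder is controlled by the
    bound on \<open>D k\<close>.\<close>
  define q where "q = (\<Sum>j<k. smult (D j a / fact j) ([:-a, 1:] ^ j))"
  have dq: "degree q < k"
  proof -
    have "degree q \<le> k - 1"
      unfolding q_def
      by (intro degree_sum_le order_trans[OF degree_smult_le] order_trans[OF degree_power_le]) auto
    then show ?thesis using k by simp
  qed
  have qx: "poly q x = (\<Sum>j<k. D j a / fact j * (x - a) ^ j)" for x
    by (simp add: q_def poly_sum)
  have "\<bar>g x - poly q x\<bar> \<le> (1 + 2 ^ k * (real k)\<^sup>2 ^ k) * w" if x: "x \<in> {a..mid}" for x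
  proof -
    have "\<bar>D 0 x - poly q x\<bar> \<le> 2 ^ k * (real k)\<^sup>2 ^ k * w"
    proof (cases "x = a")
      case True
      have "(\<Sum>j<k. D j a / fact j * (x - a) ^ j) = (\<Sum>j\<in>{0}. D j a / fact j * (x - a) ^ j)"
        using k True by (intro sum.mono_neutral_right) auto
      then show ?thesis using True w0 by (simp add: qx)
    next
      case False
      then have "\<exists>t>a. t < x \<and> D 0 x = (\<Sum>m<k. D m a / fact m * (x - a) ^ m) + D k t / fact k * (x - a) ^ k"
        using Taylor_up[of k D "D 0" a x a] deriv k x by auto
      then obtain t where t: "a < t" "t < x" "D 0 x = poly q x + D k t / fact k * (x - a) ^ k"
        unfolding qx by blast
      have "\<bar>D 0 x - poly q x\<bar> = \<bar>D k t\<bar> / fact k * (x - a) ^ k"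
        using t x by (simp add: abs_mult power_abs)
      also have "\<dots> \<le> \<bar>D k t\<bar> / 1 * ((b - a) / 2) ^ k"
        using x by (intro mult_mono divide_left_mono power_mono) (auto simp: mid_def field_simps fact_ge_1)
      also have "\<dots> \<le> 2 ^ k * w / \<delta> ^ k * ((b - a) / 2) ^ k"
        using Dk[of t] t x ab by (intro mult_mono) auto
      also have "\<dots> = 2 ^ k * w * (((b - a) / 2) / \<delta>) ^ k"
        by (simp add: power_divide)
      also have "((b - a) / 2) / \<delta> = (real k)\<^sup>2"
        using \<delta> by (simp add: field_simps power2_eq_square)
      finally show ?thesis by (simp add: mult_ac)
    qed
    then show ?thesis using D0[OF x] by (simp add: algebra_simps)
  qed
  then show ?thesis using dq unfolding w_def mid_def by blast
qed

primrec whitney_const :: "nat \<Rightarrow> nat \<Rightarrow> real" where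
  "whitney_const k 0 = 1 + 2 ^ k * (real k)\<^sup>2 ^ k"
| "whitney_const k (Suc i) = 1 + 2 ^ k * whitney_const k i"

lemma whitney_const_nonneg: "0 \<le> whitney_const k i"
  by (induction i) auto

text \<open>A polynomial of degree less than \<open>k\<close> does not change \<open>k\<close>-th differences, so a bound for \<open>g - q\<close> propagates to the
right in steps of length \<open>h\<close>.\<close>

lemma whitney:
  assumes g: "continuous_on {a..b} g" and ab: "a < b" and k: "1 \<le> k"
  shows "\<exists>q. degree q < k \<and> (\<forall>x\<in>{a..b}. \<bar>g x - poly q x\<bar> \<le> whitney_const k k * modsm k g (b - a) {a..b})"
proof -
  define w where "w = modsm k g (b - a) {a..b}"
  define mid where "mid = (a + b) / 2"
  have w0: "0 \<le> w" unfolding w_def using ab by (intro modsm_nonneg g) auto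
  obtain q where q: "degree q < k" "\<And>x. x \<in> {a..mid} \<Longrightarrow> \<bar>g x - poly q x\<bar> \<le> whitney_const k 0 * w"
    using whitney_left_half[OF assms] by (auto simp: w_def mid_def)
  \<comment> \<open>k steps span half of the interval: a difference that ends at a point right of
    the middle begins inside [a, b], and k rounds lead from the middle to b.\<close>
  define h where "h = (b - a) / (2 * real k)"
  have h: "0 < h" "real k * h = (b - a) / 2" using ab k by (auto simp: h_def)
  define e where "e x = g x - poly q x" for x
  have "\<bar>e x\<bar> \<le> whitney_const k i * w" if "x \<in> {a..b}" "x \<le> mid + real i * h" for x i
    using that
  proof (induction i arbitrary: x)
    case 0
    then show ?case using q(2) by (simp add: e_def)
  next
    case (Suc i)
    let ?K = "whitney_const k i * w"
    have K: "0 \<le> ?K" using w0 whitney_const_nonneg by simp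
    show ?case
    proof (cases "x \<le> mid + real i * h")
      case True
      have "?K \<le> 2 ^ k * ?K" using K by (simp add: mult_le_cancel_right1)
      then show ?thesis using Suc.IH[of x] Suc.prems True w0 by (simp add: algebra_simps)
    next
      case False
      \<comment> \<open>x is the last node of the difference starting at y. The other nodes are at
        most x - h, where the bound of the previous round applies, and the coefficient of the value
        at x is 1.\<close>
      define y where "y = x - real k * h"
      have "0 \<le> real i * h" using h by simp
      moreover have "a \<le> x - kh" if "kh = (b - a) / 2" "0 \<le> ih" "\<not> x \<le> mid + ih" for kh ih :: real
        using that by (simp add: mid_def field_simps)
      ultimately have y: "a \<le> y" using False h unfolding y_def by blast
      have old: "\<bar>e (y + real j * h)\<bar> \<le> ?K" if "j < k" for j
      proof (rule Suc.IH)
        have "real j * h \<le> real (k - 1) * h" using that h by (intro mult_right_mono) auto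
        also have "\<dots> = real k * h - h" using k by (simp add: of_nat_diff algebra_simps)
        finally have 1: "y + real j * h \<le> x - h" by (simp add: y_def)
        then show "y + real j * h \<le> mid + real i * h" using Suc.prems by (simp add: algebra_simps)
        have "0 \<le> real j * h" using h by simp
        then show "y + real j * h \<in> {a..b}"
          using 1 y h(1) Suc.prems(1) unfolding atLeastAtMost_iff by linarith
      qed
      have "fdiff k e h y = fdiff k g h y"
        unfolding e_def fdiff_diff using fdiff_poly[OF q(1)] by simp
      moreover have "\<bar>fdiff k g h y\<bar> \<le> w"
        unfolding w_def using h y Suc.prems by (intro fdiff_le_modsm_length g k) (auto simp: y_def)
      moreover have "fdiff k e h y = e x + (\<Sum>j<k. (-1) ^ (k - j) * real (k choose j) * e (y + real j * h))"
        unfolding fdiff_def lessThan_Suc_atMost[symmetric] by (simp add: y_def)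
      moreover have "\<bar>\<Sum>j<k. (-1) ^ (k - j) * real (k choose j) * e (y + real j * h)\<bar> \<le> 2 ^ k * ?K"
      proof -
        have "\<bar>\<Sum>j\<le>k. (-1) ^ (k - j) * real (k choose j) * (if j < k then e (y + real j * h) else 0)\<bar> \<le> 2 ^ k * ?K"
          using old K by (intro abs_sum_binomial_le) auto
        then show ?thesis unfolding lessThan_Suc_atMost[symmetric] by simp
      qed
      ultimately show ?thesis by (simp add: algebra_simps)
    qed
  qed
  from this[of _ k] have "\<bar>e x\<bar> \<le> whitney_const k k * w" if "x \<in> {a..b}" for x
    using that h by (simp add: mid_def field_simps)
  then show ?thesis using q(1) unfolding e_def w_def by blast
qed

section \<open>Local copositive approximation\<close>

text \<open>For \<open>w > (B - w) + D\<close> and \<open>0 < t < 1\<close>: dividing the corrected cubic by \<open>t\<^sup>2\<close> leaves a decreasing function, which is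
nonnegative at \<open>1\<close>.\<close>

lemma cubic_correction_steep:
  fixes A B C D w u v :: real
  assumes u: "1 \<le> u" "1 \<le> v" and w: "0 \<le> w" and B: "2 * w < B"
    and g: "\<And>t. - u \<le> t \<Longrightarrow> t \<le> v \<Longrightarrow> - (w * \<bar>t\<bar>) \<le> A + B * t + C * t^2 + D * t^3"
    and t: "- u \<le> t" "t \<le> v"
  shows "0 \<le> A + (B - w) * t + (C + 2 * w) * t^2 + D * t^3"
proof -
  have A: "0 \<le> A" using g[of 0] u by simp
  have g': "- (w * \<bar>t\<bar>) \<le> A + B * t + C * t^2 + D * t^3" using g t by blast
  have eq: "A + (B - w) * t + (C + 2 * w) * t^2 + D * t^3
      = (A + B * t + C * t^2 + D * t^3) - w * t + 2 * w * t^2"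
    by (simp add: algebra_simps)
  have w2: "0 \<le> w * t^2" using w by simp
  consider "t \<le> 0" | "1 \<le> t" | "0 < t" "t < 1" by linarith
  then show ?thesis
  proof cases
    case 1
    then show ?thesis unfolding eq using g' w2 by (simp add: abs_if split: if_splits)
  next
    case 2
    have "w * t \<le> w * t^2" using 2 w by (intro mult_left_mono) (auto simp: power2_eq_square)
    then show ?thesis unfolding eq using g' 2 by (simp add: abs_if)
  next
    case 3
    have t2: "t^2 \<le> t" "0 \<le> t^2" "t^2 \<le> 1" "t^3 \<le> t^2"
      using 3 by (auto simp: power2_eq_square power3_eq_cube mult_left_le mult_le_one)
    show ?thesis
    proof (cases "w \<le> (B - w) + D")
      case True
      \<comment> \<open>Averaging the hypothesis at t and -t removes the odd terms.\<close>
      have "A + C * t^2 \<ge> - (w * t)"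
        using g[of t] g[of "- t"] 3 u by simp
      moreover have "w * t \<le> t * ((B - w) + D * t^2)"
      proof -
        have "w = (1 - t^2) * w + t^2 * w" by (simp add: algebra_simps)
        also have "\<dots> \<le> (1 - t^2) * (B - w) + t^2 * ((B - w) + D)"
          using True t2 B w by (intro add_mono mult_left_mono) auto
        also have "\<dots> = (B - w) + D * t^2" by (simp add: algebra_simps)
        finally show ?thesis using 3 by (simp add: mult.commute mult_left_mono)
      qed
      moreover have "A + (B - w) * t + (C + 2 * w) * t^2 + D * t^3
         = (A + C * t^2) + t * ((B - w) + D * t^2) + 2 * (w * t^2)"
        by (simp add: algebra_simps power2_eq_square power3_eq_cube)
      ultimately show ?thesis using w2 by linarith
    next
      case False
      then have D: "D \<le> 0" using B by linarith
      have P1: "0 \<le> A + (B - w) + (C + 2 * w) + D" using g[of 1] u by simp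
      have "A + (B - w) * t + (C + 2 * w) * t^2 + D * t^3
        = A * (1 - t^2) + (B - w) * (t - t^2) + (- D) * (t^2 - t^3) + t^2 * (A + (B - w) + (C + 2 * w) + D)"
        by (simp add: algebra_simps)
      moreover have "0 \<le> A * (1 - t^2)" using A t2 by (intro mult_nonneg_nonneg) auto
      moreover have "0 \<le> (B - w) * (t - t^2)" using B w t2 by (intro mult_nonneg_nonneg) auto
      moreover have "0 \<le> (- D) * (t^2 - t^3)" using D t2 by (intro mult_nonneg_nonneg) auto
      moreover have "0 \<le> t^2 * (A + (B - w) + (C + 2 * w) + D)"
        using t2(2) P1 by (rule mult_nonneg_nonneg)
      ultimately show ?thesis by linarith
    qed
  qed
qed

text \<open>A slope of size at most 2 w is removed entirely. A steeper one cannot be removed at a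
  cost proportional to w; it is moved by w towards 0 instead, which cancels the deficit w |t| on one
  side, while the quadratic term pays for the other. Negative steep slopes follow by
  reflection.\<close>

lemma cubic_correction_unit:
  fixes A B C D w u v :: real
  assumes u: "1 \<le> u" "1 \<le> v" and w: "0 \<le> w"
    and g: "\<And>t. - u \<le> t \<Longrightarrow> t \<le> v \<Longrightarrow> - (w * \<bar>t\<bar>) \<le> A + B * t + C * t^2 + D * t^3"
  shows "\<exists>\<beta> \<gamma>. \<bar>\<beta>\<bar> \<le> 2 * w \<and> \<bar>\<gamma>\<bar> \<le> 3 * w \<and>
    (\<forall>t. - u \<le> t \<longrightarrow> t \<le> v \<longrightarrow> 0 \<le> A + B * t + C * t^2 + D * t^3 + \<beta> * t + \<gamma> * t^2)"
proof -
  consider "2 * w < B" | "B < - (2 * w)" | "\<bar>B\<bar> \<le> 2 * w" by linarith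
  then show ?thesis
  proof cases
    case 1
    have "0 \<le> A + B * t + C * t^2 + D * t^3 + (- w) * t + (2 * w) * t^2" if "- u \<le> t" "t \<le> v" for t
      using cubic_correction_steep[OF u w 1 g that] by (simp add: algebra_simps)
    then show ?thesis using w by (intro exI[of _ "- w"] exI[of _ "2 * w"]) simp
  next
    case 2
    have g': "- (w * \<bar>t\<bar>) \<le> A + (- B) * t + C * t^2 + (- D) * t^3" if "- v \<le> t" "t \<le> u" for t
      using g[of "- t"] that by simp
    have "0 \<le> A + B * t + C * t^2 + D * t^3 + w * t + (2 * w) * t^2" if "- u \<le> t" "t \<le> v" for t
      using cubic_correction_steep[OF u(2,1) w _ g', of "- t"] 2 that by (simp add: algebra_simps)
    then show ?thesis using w by (intro exI[of _ w] exI[of _ "2 * w"]) simp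
  next
    case 3
    have A: "0 \<le> A" using g[of 0] u by simp
    have "0 \<le> A + B * t + C * t^2 + D * t^3 + (- B) * t + (3 * w) * t^2" if t: "- u \<le> t" "t \<le> v" for t
    proof (cases "\<bar>t\<bar> \<le> 1")
      case True
      have "0 \<le> A + C + D + 3 * w" "0 \<le> A + C - D + 3 * w"
        using g[of 1] g[of "- 1"] u 3 by (simp_all add: abs_le_iff)
      moreover have "D * t \<ge> - \<bar>D\<bar>"
      proof -
        have "\<bar>D * t\<bar> \<le> \<bar>D\<bar>" using True by (simp add: abs_mult mult_left_le)
        then show ?thesis by linarith
      qed
      ultimately have "0 \<le> A + C + D * t + 3 * w" by linarith
      moreover have "t^2 \<le> 1" using True by (simp add: abs_square_le_1)
      ultimately have "0 \<le> A * (1 - t^2)" "0 \<le> t^2 * (A + C + D * t + 3 * w)"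
        using A by (auto intro: mult_nonneg_nonneg)
      then have "0 \<le> A * (1 - t^2) + t^2 * (A + C + D * t + 3 * w)" by linarith
      then show ?thesis by (simp add: algebra_simps power2_eq_square power3_eq_cube)
    next
      case False
      have "w * \<bar>t\<bar> \<le> w * t^2"
      proof -
        have "\<bar>t\<bar> * 1 \<le> \<bar>t\<bar> * \<bar>t\<bar>" using False by (intro mult_left_mono) auto
        then show ?thesis using w by (intro mult_left_mono) (simp_all add: power2_eq_square)
      qed
      moreover have "B * t \<le> 2 * w * \<bar>t\<bar>"
      proof -
        have "B * t \<le> \<bar>B\<bar> * \<bar>t\<bar>" by (metis abs_ge_self abs_mult)
        also have "\<dots> \<le> 2 * w * \<bar>t\<bar>" using 3 by (intro mult_right_mono) auto
        finally show ?thesis .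
      qed
      ultimately show ?thesis using g[OF t] by linarith
    qed
    then show ?thesis using 3 w by (intro exI[of _ "- B"] exI[of _ "3 * w"]) simp
  qed
qed

text \<open>Scaling by \<eta>, a lower bound for the distances to both ends; only the quadratic
  coefficient picks up a factor 1 / \<eta>.\<close>

lemma cubic_correction:
  fixes A B C D w u v \<eta> :: real
  assumes \<eta>: "0 < \<eta>" "\<eta> \<le> u" "\<eta> \<le> v" and w: "0 \<le> w"
    and g: "\<And>t. - u \<le> t \<Longrightarrow> t \<le> v \<Longrightarrow> - (w * \<bar>t\<bar>) \<le> A + B * t + C * t^2 + D * t^3"
  shows "\<exists>\<beta> \<gamma>. \<bar>\<beta>\<bar> \<le> 2 * w \<and> \<bar>\<gamma>\<bar> \<le> 3 * w / \<eta> \<and>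
    (\<forall>t. - u \<le> t \<longrightarrow> t \<le> v \<longrightarrow> 0 \<le> A + B * t + C * t^2 + D * t^3 + \<beta> * t + \<gamma> * t^2)"
proof -
  have g': "- ((w * \<eta>) * \<bar>t\<bar>) \<le> A + (B * \<eta>) * t + (C * \<eta>^2) * t^2 + (D * \<eta>^3) * t^3"
    if "- (u / \<eta>) \<le> t" "t \<le> v / \<eta>" for t
    using g[of "\<eta> * t"] that \<eta> by (simp add: field_simps abs_mult power_mult_distrib)
  obtain \<beta> \<gamma> where bg: "\<bar>\<beta>\<bar> \<le> 2 * (w * \<eta>)" "\<bar>\<gamma>\<bar> \<le> 3 * (w * \<eta>)"
    "\<And>t. - (u / \<eta>) \<le> t \<Longrightarrow> t \<le> v / \<eta> \<Longrightarrow>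
       0 \<le> A + (B * \<eta>) * t + (C * \<eta>^2) * t^2 + (D * \<eta>^3) * t^3 + \<beta> * t + \<gamma> * t^2"
    using cubic_correction_unit[of "u / \<eta>" "v / \<eta>" "w * \<eta>", OF _ _ _ g'] \<eta> w by auto
  have "0 \<le> A + B * t + C * t^2 + D * t^3 + (\<beta> / \<eta>) * t + (\<gamma> / \<eta>^2) * t^2" if "- u \<le> t" "t \<le> v" for t
    using bg(3)[of "t / \<eta>"] that \<eta>(1) by (simp add: field_simps)
  moreover have "\<bar>\<beta> / \<eta>\<bar> \<le> 2 * w" using bg(1) \<eta>(1) by (simp add: field_simps)
  moreover have "\<bar>\<gamma> / \<eta>^2\<bar> \<le> 3 * w / \<eta>" using bg(2) \<eta>(1) by (simp add: field_simps power2_eq_square)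
  ultimately show ?thesis by blast
qed

text \<open>The line is rotated about its nonnegative value A at 0 until it vanishes at the
  offending end. It was at least -w there, so the slope changes by at most w divided by the distance
  to that end.\<close>

lemma slope_clamp:
  fixes A B w u v \<eta> :: real
  assumes \<eta>: "0 < \<eta>" "\<eta> \<le> u" "\<eta> \<le> v" and A: "0 \<le> A" and w: "0 \<le> w"
    and ends: "- w \<le> A - B * u" "- w \<le> A + B * v"
  shows "\<exists>\<beta>. \<bar>\<beta>\<bar> \<le> w / \<eta> \<and> (\<forall>t. - u \<le> t \<longrightarrow> t \<le> v \<longrightarrow> 0 \<le> A + (B + \<beta>) * t)"
proof -
  have pos: "0 < u" "0 < v" using \<eta> by auto
  have we: "w / u \<le> w / \<eta>" "w / v \<le> w / \<eta>" using \<eta> w by (auto intro!: divide_left_mono)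
  have *: "0 \<le> A + B' * t" if "0 \<le> A - B' * u" "0 \<le> A + B' * v" "- u \<le> t" "t \<le> v" for B' t
  proof (cases "0 \<le> B'")
    case True
    then show ?thesis using mult_left_mono[OF that(3), of B'] that(1) by simp
  next
    case False
    then have "B' * v \<le> B' * t" using that(4) by (intro mult_left_mono_neg) auto
    then show ?thesis using that(2) by linarith
  qed
  consider "A < B * u" | "A < - B * v" | "0 \<le> A - B * u" "0 \<le> A + B * v" by force
  then show ?thesis
  proof cases
    case 1
    have "A / u - B = - ((B * u - A) / u)" using pos by (simp add: field_simps)
    moreover have "0 \<le> (B * u - A) / u" using 1 pos by simp
    moreover have "(B * u - A) / u \<le> w / u" using ends pos by (intro divide_right_mono) auto
    ultimately have "\<bar>A / u - B\<bar> \<le> w / u" by linarith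
    moreover have "0 \<le> A + (B + (A / u - B)) * t" if "- u \<le> t" "t \<le> v" for t
      using *[of "A / u" t] pos A that by simp
    ultimately show ?thesis using we by (intro exI[of _ "A / u - B"]) auto
  next
    case 2
    have "- A / v - B = (- (B * v) - A) / v" using pos by (simp add: field_simps)
    moreover have "0 \<le> (- (B * v) - A) / v" using 2 pos by simp
    moreover have "(- (B * v) - A) / v \<le> w / v" using ends pos by (intro divide_right_mono) auto
    ultimately have "\<bar>- A / v - B\<bar> \<le> w / v" by linarith
    moreover have "0 \<le> A + (B + (- A / v - B)) * t" if "- u \<le> t" "t \<le> v" for t
      using *[of "- A / v" t] pos A that by simp
    ultimately show ?thesis using we by (intro exI[of _ "- A / v - B"]) auto
  next
    case 3
    then show ?thesis using *[of B] w \<eta> by (intro exI[of _ 0]) simp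
  qed
qed

section \<open>Integrating an approximant of the highest derivative\<close>

lemma Cr_on_subset:
  assumes "Cr_on r I g D" "J \<subseteq> I"
  shows "Cr_on r J (D 0) D"
  using assms unfolding Cr_on_def
  by (blast intro: continuous_on_subset DERIV_subset)

text \<open>Mean value inequality applied r times from c, giving away the factor 1 / r!.\<close>

lemma iterated_bound:
  fixes u :: "nat \<Rightarrow> real \<Rightarrow> real"
  assumes "\<And>i x. i < r \<Longrightarrow> x \<in> {a..b} \<Longrightarrow> (u i has_real_derivative u (Suc i) x) (at x within {a..b})"
    and "\<And>i. i < r \<Longrightarrow> u i c = 0" and c: "c \<in> {a..b}"
    and "\<And>x. x \<in> {a..b} \<Longrightarrow> \<bar>u r x\<bar> \<le> w" and x: "x \<in> {a..b}"
  shows "\<bar>u 0 x\<bar> \<le> w * \<bar>x - c\<bar> ^ r"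
  using assms(1,2,4) x
proof (induction r arbitrary: u x)
  case (Suc r)
  have w: "0 \<le> w" using Suc.prems(3)[OF c] by linarith
  have IH: "\<bar>u (Suc 0) y\<bar> \<le> w * \<bar>y - c\<bar> ^ r" if "y \<in> {a..b}" for y
    using Suc.IH[of "\<lambda>i. u (Suc i)" y] Suc.prems that by simp
  have sub: "closed_segment c x \<subseteq> {a..b}" using c Suc.prems(4) by (auto simp: closed_segment_eq_real_ivl)
  have "norm (u 0 x - u 0 c) \<le> (w * \<bar>x - c\<bar> ^ r) * norm (x - c)"
  proof (rule field_differentiable_bound)
    fix y assume y: "y \<in> closed_segment c x"
    then have yab: "y \<in> {a..b}" using sub by blast
    show "(u 0 has_field_derivative u (Suc 0) y) (at y within closed_segment c x)"
      using Suc.prems(1)[of 0 y] yab sub by (auto intro: has_field_derivative_subset)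
    have "\<bar>y - c\<bar> \<le> \<bar>x - c\<bar>" using y by (auto simp: closed_segment_eq_real_ivl split: if_splits)
    then show "norm (u (Suc 0) y) \<le> w * \<bar>x - c\<bar> ^ r"
      using IH[OF yab] w by (simp add: order_trans[OF _ mult_left_mono] power_mono)
  qed auto
  then show ?case using Suc.prems(2)[of 0] by (simp add: mult_ac)
qed simp

lemma pderiv_antiderivative:
  fixes p :: "real poly"
  obtains P where "pderiv P = p" "degree P \<le> Suc (degree p)" "poly P c = v"
proof -
  define P0 where "P0 = (\<Sum>i\<le>degree p. monom (coeff p i / real (Suc i)) (Suc i))"
  define P where "P = P0 + [:v - poly P0 c:]"
  have "coeff P0 (Suc n) = coeff p n / real (Suc n)" for n
    by (cases "n \<le> degree p") (simp_all add: P0_def coeff_sum coeff_eq_0)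
  then have "pderiv P0 = p" by (intro poly_eqI) (simp add: coeff_pderiv del: of_nat_Suc)
  then have "pderiv P = p" by (simp add: P_def pderiv_add pderiv_pCons)
  moreover have "degree P \<le> Suc (degree p)"
    unfolding P_def P0_def
    by (intro degree_add_le degree_sum_le order_trans[OF degree_monom_le]) auto
  ultimately show ?thesis using that by (simp add: P_def)
qed

lemma poly_with_derivatives:
  fixes Q :: "real poly"
  shows "\<exists>p. degree p \<le> degree Q + r \<and> (pderiv ^^ r) p = Q \<and> (\<forall>i<r. poly ((pderiv ^^ i) p) c = v i)"
proof (induction r arbitrary: v)
  case (Suc r)
  obtain p1 where p1: "degree p1 \<le> degree Q + r" "(pderiv ^^ r) p1 = Q"
    "\<And>i. i < r \<Longrightarrow> poly ((pderiv ^^ i) p1) c = v (Suc i)"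
    using Suc[of "\<lambda>i. v (Suc i)"] by blast
  obtain p where p: "pderiv p = p1" "degree p \<le> Suc (degree p1)" "poly p c = v 0"
    by (rule pderiv_antiderivative)
  have s: "(pderiv ^^ Suc i) p = (pderiv ^^ i) p1" for i by (simp add: funpow_swap1 p(1))
  have "poly ((pderiv ^^ i) p) c = v i" if "i < Suc r" for i
    using that p(3) p1(3) s by (cases i) (auto simp del: funpow.simps(2))
  then show ?case using p p1 s by (intro exI[of _ p]) auto
qed (intro exI[of _ Q], simp)

lemma taylor_type_approximation:
  assumes C: "Cr_on r {a..b} (D 0) D" and c: "c \<in> {a..b}"
    and Q: "\<And>x. x \<in> {a..b} \<Longrightarrow> \<bar>D r x - poly Q x\<bar> \<le> w"
  shows "\<exists>p. degree p \<le> degree Q + r \<and> (pderiv ^^ r) p = Q \<and> (\<forall>i<r. poly ((pderiv ^^ i) p) c = D i c) \<and>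
    (\<forall>x\<in>{a..b}. \<bar>D 0 x - poly p x\<bar> \<le> w * \<bar>x - c\<bar> ^ r)"
proof -
  obtain p where p: "degree p \<le> degree Q + r" "(pderiv ^^ r) p = Q" "\<And>i. i < r \<Longrightarrow> poly ((pderiv ^^ i) p) c = D i c"
    using poly_with_derivatives[of Q r c "\<lambda>i. D i c"] by blast
  have "((\<lambda>x. D i x - poly ((pderiv ^^ i) p) x) has_real_derivative
      D (Suc i) x - poly ((pderiv ^^ Suc i) p) x) (at x within {a..b})" if "i < r" "x \<in> {a..b}" for i x
    using C that by (auto simp: Cr_on_def intro!: DERIV_diff has_field_derivative_at_within[OF poly_DERIV])
  from iterated_bound[of r a b "\<lambda>i x. D i x - poly ((pderiv ^^ i) p) x", OF this _ c]
  have "\<bar>D 0 x - poly p x\<bar> \<le> w * \<bar>x - c\<bar> ^ r" if "x \<in> {a..b}" for x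
    using Q p that by simp
  then show ?thesis using p by blast
qed

text \<open>Little-o rather than O(|x - c|^(M + 1)), since M = r occurs: for r = 0 and for (1, 2, 0,
  1, 0), where f has no derivative to spare, the stronger relation can fail. The form passes to
  functions squeezed between others and mentions no derivatives.\<close>

definition contact :: "(real \<Rightarrow> real) \<Rightarrow> (real \<Rightarrow> real) \<Rightarrow> real \<Rightarrow> nat \<Rightarrow> real set \<Rightarrow> bool" where
  "contact f g c M I \<longleftrightarrow> (\<forall>\<epsilon>>0. \<exists>\<eta>>0. \<forall>x\<in>I. \<bar>x - c\<bar> < \<eta> \<longrightarrow> \<bar>f x - g x\<bar> \<le> \<epsilon> * \<bar>x - c\<bar> ^ M)"

lemma contactI:
  assumes "\<And>x. x \<in> I \<Longrightarrow> \<bar>f x - g x\<bar> \<le> K * \<bar>x - c\<bar> ^ Suc M"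
  shows "contact f g c M I"
  unfolding contact_def
proof (intro allI impI)
  fix \<epsilon> :: real assume \<epsilon>: "0 < \<epsilon>"
  let ?\<eta> = "\<epsilon> / (\<bar>K\<bar> + 1)"
  have "\<bar>f x - g x\<bar> \<le> \<epsilon> * \<bar>x - c\<bar> ^ M" if "x \<in> I" "\<bar>x - c\<bar> < ?\<eta>" for x
  proof -
    have "\<bar>f x - g x\<bar> \<le> K * \<bar>x - c\<bar> ^ Suc M" using assms that by blast
    also have "\<dots> \<le> (\<bar>K\<bar> + 1) * \<bar>x - c\<bar> * \<bar>x - c\<bar> ^ M"
      by (simp add: mult.assoc mult_right_mono)
    also have "\<dots> \<le> (\<bar>K\<bar> + 1) * ?\<eta> * \<bar>x - c\<bar> ^ M"
      using that by (intro mult_right_mono mult_left_mono) auto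
    finally show ?thesis using abs_ge_zero[of K] by (simp add: add_pos_nonneg)
  qed
  moreover have "0 < ?\<eta>" using \<epsilon> by (simp add: add_nonneg_pos)
  ultimately show "\<exists>\<eta>>0. \<forall>x\<in>I. \<bar>x - c\<bar> < \<eta> \<longrightarrow> \<bar>f x - g x\<bar> \<le> \<epsilon> * \<bar>x - c\<bar> ^ M" by blast
qed

text \<open>One factor for all cases: relative to the Whitney bound the errors are 2, 2 + 2
  \<Lambda>, 3 + 3 \<Lambda> and 4 + 2 \<Lambda>, where \<Lambda> bounds the length of the interval
  divided by the distance from c to its ends.\<close>

definition local_const :: "nat \<Rightarrow> real \<Rightarrow> real" where
  "local_const k \<Lambda> = 4 * (1 + \<Lambda>) * whitney_const k k"

definition approximates :: "nat \<Rightarrow> nat \<Rightarrow> real \<Rightarrow> (nat \<Rightarrow> real \<Rightarrow> real) \<Rightarrow> real \<Rightarrow> real \<Rightarrow> real poly \<Rightarrow> bool" where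
  "approximates k r K D a b p \<longleftrightarrow> degree p \<le> k + r - 1 \<and>
     (\<forall>x\<in>{a..b}. \<bar>D 0 x - poly p x\<bar> \<le> K * ((b - a) ^ r * modsm k (D r) (b - a) {a..b}))"

lemma approximatesI:
  assumes "continuous_on {a..b} (D r)" "a < b" "0 \<le> \<Lambda>" "degree p \<le> k + r - 1"
    and "\<And>x. x \<in> {a..b} \<Longrightarrow> \<bar>D 0 x - poly p x\<bar> \<le> \<kappa> * (whitney_const k k * modsm k (D r) (b - a) {a..b} * (b - a) ^ r)"
    and "\<kappa> \<le> 4 * (1 + \<Lambda>)"
  shows "approximates k r (local_const k \<Lambda>) D a b p"
proof -
  let ?w = "whitney_const k k * modsm k (D r) (b - a) {a..b} * (b - a) ^ r"
  have "0 \<le> ?w" using assms(1,2) by (intro mult_nonneg_nonneg whitney_const_nonneg modsm_nonneg) auto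
  then have "\<kappa> * ?w \<le> 4 * (1 + \<Lambda>) * ?w" using assms(6) by (intro mult_right_mono)
  then have "\<bar>D 0 x - poly p x\<bar> \<le> local_const k \<Lambda> * ((b - a) ^ r * modsm k (D r) (b - a) {a..b})" if "x \<in> {a..b}" for x
    using assms(5)[OF that] by (simp add: local_const_def mult_ac)
  then show ?thesis using assms(4) by (simp add: approximates_def)
qed

lemma base_approximant:
  assumes C: "Cr_on r {a..b} (D 0) D" and ab: "a < b" and k: "1 \<le> k" and c: "c \<in> {a..b}"
  shows "\<exists>p w. degree p \<le> k + r - 1 \<and> w = whitney_const k k * modsm k (D r) (b - a) {a..b} \<and> 0 \<le> w \<and>
    (\<forall>x\<in>{a..b}. \<bar>D 0 x - poly p x\<bar> \<le> w * \<bar>x - c\<bar> ^ r)"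
proof -
  have cont: "continuous_on {a..b} (D r)" using C by (simp add: Cr_on_def)
  obtain Q where Q: "degree Q < k" "\<And>x. x \<in> {a..b} \<Longrightarrow> \<bar>D r x - poly Q x\<bar> \<le> whitney_const k k * modsm k (D r) (b - a) {a..b}"
    using whitney[OF cont ab k] by blast
  obtain p where "degree p \<le> degree Q + r"
    "\<forall>x\<in>{a..b}. \<bar>D 0 x - poly p x\<bar> \<le> whitney_const k k * modsm k (D r) (b - a) {a..b} * \<bar>x - c\<bar> ^ r"
    using taylor_type_approximation[OF C c Q(2)] by blast
  moreover have "0 \<le> whitney_const k k * modsm k (D r) (b - a) {a..b}"
    using ab by (intro mult_nonneg_nonneg whitney_const_nonneg modsm_nonneg cont) auto
  ultimately show ?thesis using Q(1) by (intro exI[of _ p]) auto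
qed

text \<open>The sign pattern \<open>\<sigma>\<close> is \<open>1\<close> where \<open>f\<close> is nonnegative and \<open>sgn (x - c)\<close> where it changes sign at \<open>c\<close>.\<close>

lemma local_corrected:
  assumes C: "Cr_on r {a..b} (D 0) D" and ab: "a < b" and k: "1 \<le> k" and c: "c \<in> {a..b}" and \<Lambda>: "0 \<le> \<Lambda>"
    and dq: "degree q \<le> r"
    and \<sigma>: "\<And>x. x \<in> {a..b} \<Longrightarrow> \<bar>\<sigma> x\<bar> \<le> 1 \<and> \<bar>x - c\<bar> ^ r \<le> \<sigma> x * poly q x \<and> \<bar>poly q x\<bar> \<le> (b - a) ^ r \<and> 0 \<le> \<sigma> x * D 0 x"
    and M: "\<And>M x. int M = m \<Longrightarrow> x \<in> {a..b} \<Longrightarrow> \<bar>poly q x\<bar> \<le> L * \<bar>x - c\<bar> ^ Suc M"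
  shows "\<exists>p. approximates k r (local_const k \<Lambda>) D a b p \<and> (\<forall>x\<in>{a..b}. 0 \<le> \<sigma> x * poly p x) \<and>
    (\<forall>M. int M = m \<longrightarrow> contact (D 0) (poly p) c M {a..b})"
proof -
  obtain p w where p: "degree p \<le> k + r - 1" "w = whitney_const k k * modsm k (D r) (b - a) {a..b}" "0 \<le> w"
    "\<And>x. x \<in> {a..b} \<Longrightarrow> \<bar>D 0 x - poly p x\<bar> \<le> w * \<bar>x - c\<bar> ^ r"
    using base_approximant[OF C ab k c] by blast
  define P where "P = p + smult w q"
  have cont: "continuous_on {a..b} (D r)" using C by (simp add: Cr_on_def)
  have err: "\<bar>D 0 x - poly P x\<bar> \<le> 2 * w * \<bar>poly q x\<bar>" if x: "x \<in> {a..b}" for x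
  proof -
    have "\<sigma> x * poly q x \<le> \<bar>\<sigma> x\<bar> * \<bar>poly q x\<bar>" by (metis abs_ge_self abs_mult)
    also have "\<dots> \<le> 1 * \<bar>poly q x\<bar>" using \<sigma>[OF x] by (intro mult_right_mono) auto
    finally have "\<bar>x - c\<bar> ^ r \<le> \<bar>poly q x\<bar>" using \<sigma>[OF x] by simp
    then have "w * \<bar>x - c\<bar> ^ r \<le> w * \<bar>poly q x\<bar>" using p(3) by (rule mult_left_mono)
    moreover have "\<bar>D 0 x - poly P x\<bar> \<le> \<bar>D 0 x - poly p x\<bar> + \<bar>w * poly q x\<bar>"
      by (simp add: P_def)
    ultimately show ?thesis using p(4)[OF x] p(3) by (simp add: abs_mult)
  qed
  have "approximates k r (local_const k \<Lambda>) D a b P"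
  proof (rule approximatesI[where D = D, OF cont ab \<Lambda>])
    show "degree P \<le> k + r - 1" using p(1) dq k unfolding P_def
      by (intro degree_add_le order_trans[OF degree_smult_le]) auto
    show "\<bar>D 0 x - poly P x\<bar> \<le> 2 * (whitney_const k k * modsm k (D r) (b - a) {a..b} * (b - a) ^ r)" if "x \<in> {a..b}" for x
    proof -
      have "2 * w * \<bar>poly q x\<bar> \<le> 2 * w * (b - a) ^ r" using \<sigma>[OF that] p(3) by (intro mult_left_mono) auto
      then show ?thesis using err[OF that] unfolding p(2) by simp
    qed
  qed (use \<Lambda> in simp)
  moreover have "0 \<le> \<sigma> x * poly P x" if x: "x \<in> {a..b}" for x
  proof -
    have "\<bar>\<sigma> x * (D 0 x - poly p x)\<bar> \<le> 1 * (w * \<bar>x - c\<bar> ^ r)"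
      unfolding abs_mult using \<sigma>[OF x] p(4)[OF x] by (intro mult_mono) auto
    then have "\<sigma> x * (D 0 x - poly p x) \<le> w * \<bar>x - c\<bar> ^ r" by linarith
    also have "\<dots> \<le> w * (\<sigma> x * poly q x)" using \<sigma>[OF x] p(3) by (intro mult_left_mono) auto
    finally show ?thesis using \<sigma>[OF x] by (simp add: P_def algebra_simps)
  qed
  moreover have "contact (D 0) (poly P) c M {a..b}" if "int M = m" for M
  proof (rule contactI)
    fix x assume x: "x \<in> {a..b}"
    have "2 * w * \<bar>poly q x\<bar> \<le> 2 * w * (L * \<bar>x - c\<bar> ^ Suc M)"
      using M[OF that x] p(3) by (intro mult_left_mono) auto
    then show "\<bar>D 0 x - poly P x\<bar> \<le> (2 * w * L) * \<bar>x - c\<bar> ^ Suc M"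
      using err[OF x] by (simp only: mult.assoc)
  qed
  ultimately show ?thesis by blast
qed

section \<open>Corrections by a power\<close>

lemma poly_power_linear: "poly ([:- c, 1:] ^ n) x = (x - c) ^ n" for c x :: real
proof -
  have "poly [:- c, 1:] x = x - c" by simp
  then show ?thesis by (simp only: poly_power)
qed

lemma sgn_mult_odd_power:
  fixes t :: real
  assumes "odd n"
  shows "sgn t * t ^ n = \<bar>t\<bar> ^ n"
proof -
  obtain j where j: "n = 2 * j + 1" using assms by (rule oddE)
  have "sgn t * t ^ n = (t * sgn t) * (t^2) ^ j" by (simp add: j power_mult)
  also have "\<dots> = \<bar>t\<bar> * (\<bar>t\<bar>^2) ^ j" by (simp add: abs_sgn[symmetric])
  also have "\<dots> = \<bar>t\<bar> ^ n" unfolding j power_add power_mult by simp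
  finally show ?thesis .
qed

text \<open>The correction is (b - a)^e (x - c)^(r - e) up to sign; the first factor makes it
  dominate |x - c|^r. e = 0 if the parity of r suits the sign of f, e = 1 if one order of contact is
  given up for the parity, and e = r, a constant, if no contact is wanted. Then m = -1 and the
  contact clause is empty.\<close>

lemma local_power_corrected:
  assumes C: "Cr_on r {a..b} (D 0) D" and ab: "a < b" and k: "1 \<le> k" and c: "c \<in> {a..b}" and \<Lambda>: "0 \<le> \<Lambda>"
    and er: "e \<le> r" and \<kappa>: "\<bar>\<kappa>\<bar> = 1"
    and \<sigma>: "\<And>x. x \<in> {a..b} \<Longrightarrow> \<bar>\<sigma> x\<bar> \<le> 1 \<and> \<sigma> x * \<kappa> * (x - c) ^ (r - e) = \<bar>x - c\<bar> ^ (r - e) \<and> 0 \<le> \<sigma> x * D 0 x"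
    and m: "m = int r - int e - 1"
  shows "\<exists>p. approximates k r (local_const k \<Lambda>) D a b p \<and> (\<forall>x\<in>{a..b}. 0 \<le> \<sigma> x * poly p x) \<and>
    (\<forall>M. int M = m \<longrightarrow> contact (D 0) (poly p) c M {a..b})"
proof (rule local_corrected[OF C ab k c \<Lambda>])
  let ?q = "smult ((b - a) ^ e * \<kappa>) ([:- c, 1:] ^ (r - e))"
  show "degree ?q \<le> r"
    by (intro order_trans[OF degree_smult_le] order_trans[OF degree_power_le]) auto
  have aq: "\<bar>poly ?q x\<bar> = (b - a) ^ e * \<bar>x - c\<bar> ^ (r - e)" for x
    using ab \<kappa> by (simp add: poly_power_linear abs_mult power_abs)
  show "\<bar>\<sigma> x\<bar> \<le> 1 \<and> \<bar>x - c\<bar> ^ r \<le> \<sigma> x * poly ?q x \<and> \<bar>poly ?q x\<bar> \<le> (b - a) ^ r \<and> 0 \<le> \<sigma> x * D 0 x"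
    if x: "x \<in> {a..b}" for x
  proof -
    have xc: "\<bar>x - c\<bar> \<le> b - a" using x c by auto
    have split: "t ^ r = t ^ e * t ^ (r - e)" for t :: real using er by (simp flip: power_add)
    have "\<sigma> x * poly ?q x = (b - a) ^ e * (\<sigma> x * \<kappa> * (x - c) ^ (r - e))"
      by (simp add: poly_power_linear mult_ac)
    also have "\<dots> = (b - a) ^ e * \<bar>x - c\<bar> ^ (r - e)" using \<sigma>[OF x] by simp
    finally have "\<bar>x - c\<bar> ^ r \<le> \<sigma> x * poly ?q x"
      using xc by (simp only: split[of "\<bar>x - c\<bar>"]) (intro mult_right_mono power_mono, auto)
    moreover have "\<bar>poly ?q x\<bar> \<le> (b - a) ^ r"
      unfolding aq split using xc ab by (intro mult_left_mono power_mono) auto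
    ultimately show ?thesis using \<sigma>[OF x] by blast
  qed
  show "\<bar>poly ?q x\<bar> \<le> (b - a) ^ e * \<bar>x - c\<bar> ^ Suc M" if "int M = m" for M x
  proof -
    have "Suc M = r - e" using that m er by linarith
    then show ?thesis by (simp only: aq)
  qed
qed

lemma local_free:
  assumes C: "Cr_on r {a..b} (D 0) D" and ab: "a < b" and k: "1 \<le> k" and \<Lambda>: "0 \<le> \<Lambda>"
    and f: "\<And>x. x \<in> {a..b} \<Longrightarrow> 0 \<le> D 0 x"
  shows "\<exists>p. approximates k r (local_const k \<Lambda>) D a b p \<and> (\<forall>x\<in>{a..b}. 0 \<le> poly p x)"
  using local_power_corrected[OF C ab k _ \<Lambda>, of a r 1 "\<lambda>_. 1" "-1"] ab f by auto

text \<open>x - c has one sign on the whole interval, so a power of either parity can be made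
  nonnegative and no order is lost.\<close>

lemma local_end_generic:
  assumes C: "Cr_on r {a..b} (D 0) D" and ab: "a < b" and k: "1 \<le> k" and \<Lambda>: "0 \<le> \<Lambda>"
    and f: "\<And>x. x \<in> {a..b} \<Longrightarrow> 0 \<le> D 0 x" and c: "c = a \<or> c = b" and m: "m = int r - 1"
  shows "\<exists>p. approximates k r (local_const k \<Lambda>) D a b p \<and> (\<forall>x\<in>{a..b}. 0 \<le> poly p x) \<and>
    (\<forall>M. int M = m \<longrightarrow> contact (D 0) (poly p) c M {a..b})"
proof -
  define \<tau> where "\<tau> = (if c = a then 1 else - 1 :: real)"
  have "\<tau> ^ r * (x - c) ^ r = \<bar>x - c\<bar> ^ r" if "x \<in> {a..b}" for x
  proof -
    have "\<tau> * (x - c) = \<bar>x - c\<bar>" using that c ab by (auto simp: \<tau>_def)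
    then show ?thesis by (simp flip: power_mult_distrib)
  qed
  moreover have "\<bar>\<tau> ^ r\<bar> = 1" by (simp add: \<tau>_def power_abs)
  moreover have "c \<in> {a..b}" using c ab by auto
  ultimately show ?thesis
    using local_power_corrected[OF C ab k _ \<Lambda>, of c 0 "\<tau> ^ r" "\<lambda>_. 1" m] f m by auto
qed

lemma local_alpha_generic:
  assumes C: "Cr_on r {a..b} (D 0) D" and ab: "a < b" and k: "1 \<le> k" and \<Lambda>: "0 \<le> \<Lambda>"
    and f: "\<And>x. x \<in> {a..b} \<Longrightarrow> 0 \<le> D 0 x" and c: "c \<in> {a..b}"
    and m: "m = (if even r then int r - 1 else int r - 2)"
  shows "\<exists>p. approximates k r (local_const k \<Lambda>) D a b p \<and> (\<forall>x\<in>{a..b}. 0 \<le> poly p x) \<and>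
    (\<forall>M. int M = m \<longrightarrow> contact (D 0) (poly p) c M {a..b})"
proof -
  define e where "e = (if even r then 0 else 1 :: nat)"
  have "e \<le> r" "even (r - e)" by (auto simp: e_def elim: oddE)
  then show ?thesis
    using local_power_corrected[OF C ab k c \<Lambda>, of e 1 "\<lambda>_. 1" m] f m
    by (auto simp: power_even_abs e_def)
qed

lemma local_sign_generic:
  assumes C: "Cr_on r {a..b} (D 0) D" and ab: "a < b" and k: "1 \<le> k" and \<Lambda>: "0 \<le> \<Lambda>"
    and f: "\<And>x. x \<in> {a..b} \<Longrightarrow> 0 \<le> (x - c) * D 0 x" and c: "c \<in> {a..b}" and r: "1 \<le> r"
    and m: "m = (if odd r then int r - 1 else int r - 2)"
  shows "\<exists>p. approximates k r (local_const k \<Lambda>) D a b p \<and> (\<forall>x\<in>{a..b}. 0 \<le> (x - c) * poly p x) \<and>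
    (\<forall>M. int M = m \<longrightarrow> contact (D 0) (poly p) c M {a..b})"
proof -
  define e where "e = (if odd r then 0 else 1 :: nat)"
  have er: "e \<le> r" "odd (r - e)" "m = int r - int e - 1" using r m by (auto simp: e_def)
  have s: "0 \<le> sgn (x - c) * y \<longleftrightarrow> 0 \<le> (x - c) * y" for x y :: real
    by (auto simp: sgn_if zero_le_mult_iff)
  have "\<bar>sgn (x - c)\<bar> \<le> 1" for x by (simp add: sgn_if)
  then show ?thesis
    using local_power_corrected[OF C ab k c \<Lambda> er(1), of 1 "\<lambda>x. sgn (x - c)" m] f er(3)
    by (simp add: s sgn_mult_odd_power[OF er(2)])
qed

section \<open>Corrections of the first Taylor coefficients\<close>

lemma poly_shift_expansion:
  fixes p :: "real poly"
  assumes "degree p \<le> n"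
  shows "\<exists>A. \<forall>t. poly p (c + t) = (\<Sum>i\<le>n. A i * t ^ i)"
proof -
  define q where "q = pcompose p [:c, 1:]"
  have d: "degree q \<le> n" using assms by (simp add: q_def degree_pcompose)
  have "poly p (c + t) = (\<Sum>i\<le>n. coeff q i * t ^ i)" for t
  proof -
    have "poly p (c + t) = poly q t" by (simp add: q_def poly_pcompose)
    also have "\<dots> = (\<Sum>i\<le>degree q. coeff q i * t ^ i)" by (rule poly_altdef)
    also have "\<dots> = (\<Sum>i\<le>n. coeff q i * t ^ i)"
      using d by (intro sum.mono_neutral_left) (auto simp: coeff_eq_0)
    finally show ?thesis .
  qed
  then show ?thesis by blast
qed

lemma sum_atMost_1: "(\<Sum>i\<le>(1::nat). F i) = F 0 + (F 1 :: real)"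
  and sum_atMost_2: "(\<Sum>i\<le>(2::nat). F i) = F 0 + F 1 + (F 2 :: real)"
  and sum_atMost_3: "(\<Sum>i\<le>(3::nat). F i) = F 0 + F 1 + F 2 + (F 3 :: real)"
  by (simp_all add: eval_nat_numeral)

lemma nonneg_limit_right:
  fixes h :: "real \<Rightarrow> real"
  assumes "continuous_on {c..b} h" "c < b" "\<And>x. c < x \<Longrightarrow> x \<le> b \<Longrightarrow> 0 \<le> h x"
  shows "0 \<le> h c"
proof -
  have "(h \<longlongrightarrow> h c) (at c within {c..b})"
    using assms(1,2) by (auto simp: continuous_on_def)
  moreover have "at c within {c..b} = at_right c"
    using assms(2) by (rule at_within_Icc_at_right)
  moreover have "eventually (\<lambda>x. 0 \<le> h x) (at_right c)"
    using assms(2,3) by (auto simp: eventually_at_right)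
  ultimately show ?thesis by (intro tendsto_lowerbound[of h "h c" "at_right c"]) auto
qed

lemma sign_change_zero:
  fixes f :: "real \<Rightarrow> real"
  assumes f: "continuous_on {a..b} f" and c: "a < c" "c < b"
    and s: "\<And>x. x \<in> {a..b} \<Longrightarrow> 0 \<le> (x - c) * f x"
  shows "f c = 0"
proof (rule antisym)
  show "0 \<le> f c"
  proof (rule nonneg_limit_right[OF _ c(2)])
    show "continuous_on {c..b} f" using f c by (auto intro: continuous_on_subset)
    show "0 \<le> f x" if "c < x" "x \<le> b" for x using s[of x] that c by (simp add: zero_le_mult_iff)
  qed
  have "0 \<le> (\<lambda>x. - f (- x)) (- c)"
  proof (rule nonneg_limit_right[where b = "- a" and h = "\<lambda>x. - f (- x)"])
    show "continuous_on {- c..- a} (\<lambda>x. - f (- x))"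
      using c by (intro continuous_intros continuous_on_compose2[OF f]) auto
    show "0 \<le> - f (- x)" if "- c < x" "x \<le> - a" for x
      using s[of "- x"] that c by (simp add: zero_le_mult_iff)
  qed (use c in simp)
  then show "f c \<le> 0" by simp
qed

lemma Cr_on_continuous:
  assumes "Cr_on r I g D" "i \<le> r"
  shows "continuous_on I (D i)"
proof (cases "i = r")
  case False
  then have "(D i has_real_derivative D (Suc i) x) (at x within I)" if "x \<in> I" for x
    using assms that by (simp add: Cr_on_def)
  then show ?thesis unfolding continuous_on_eq_continuous_within using DERIV_continuous by blast
qed (use assms in \<open>simp add: Cr_on_def\<close>)

lemma contact_0I:
  assumes f: "continuous_on I f" and g: "continuous_on I g" and eq: "f c = g c" and c: "c \<in> I"
  shows "contact f g c 0 I"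
  unfolding contact_def
proof (intro allI impI)
  fix \<epsilon> :: real assume \<epsilon>: "0 < \<epsilon>"
  have "continuous_on I (\<lambda>x. f x - g x)" using f g by (intro continuous_intros)
  then obtain \<eta> where "0 < \<eta>" "\<forall>x\<in>I. dist x c < \<eta> \<longrightarrow> dist (f x - g x) (f c - g c) < \<epsilon>"
    using c \<epsilon> unfolding continuous_on_iff by blast
  then show "\<exists>\<eta>>0. \<forall>x\<in>I. \<bar>x - c\<bar> < \<eta> \<longrightarrow> \<bar>f x - g x\<bar> \<le> \<epsilon> * \<bar>x - c\<bar> ^ 0"
    using eq by (auto simp: dist_real_def intro!: exI[of _ \<eta>] less_imp_le)
qed

lemma contact_1I:
  fixes f g :: "real \<Rightarrow> real"
  assumes f: "(f has_real_derivative d) (at c within I)" and g: "(g has_real_derivative d) (at c within I)"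
    and eq: "f c = g c"
  shows "contact f g c 1 I"
  unfolding contact_def
proof (intro allI impI)
  fix \<epsilon> :: real assume \<epsilon>: "0 < \<epsilon>"
  have "((\<lambda>x. f x - g x) has_real_derivative (d - d)) (at c within I)"
    using f g by (rule DERIV_diff)
  moreover have "(*) (0::real) = (\<lambda>h. 0)" by auto
  ultimately have "((\<lambda>x. f x - g x) has_derivative (\<lambda>h. 0)) (at c within I)"
    by (simp add: has_field_derivative_def)
  then obtain \<eta> where "0 < \<eta>" "\<forall>x\<in>I. norm (x - c) < \<eta> \<longrightarrow>
      norm ((f x - g x) - (f c - g c) - 0) \<le> \<epsilon> * norm (x - c)"
    using \<epsilon> unfolding has_derivative_within_alt by blast
  then show "\<exists>\<eta>>0. \<forall>x\<in>I. \<bar>x - c\<bar> < \<eta> \<longrightarrow> \<bar>f x - g x\<bar> \<le> \<epsilon> * \<bar>x - c\<bar> ^ 1"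
    using eq by (intro exI[of _ \<eta>]) auto
qed

lemma mult_ratio_le:
  fixes w \<eta> \<Lambda> t d :: real
  assumes "0 \<le> w" "0 < \<eta>" "d \<le> \<Lambda> * \<eta>" "\<bar>t\<bar> \<le> d"
  shows "w / \<eta> * \<bar>t\<bar> \<le> w * \<Lambda>"
proof -
  have "\<bar>t\<bar> / \<eta> \<le> \<Lambda>" using assms by (simp add: pos_divide_le_eq)
  then have "w * (\<bar>t\<bar> / \<eta>) \<le> w * \<Lambda>" using assms(1) by (rule mult_left_mono)
  then show ?thesis by simp
qed

text \<open>For r = 0 a power correction is a constant, so the value at c is fixed first: the
  Whitney line is moved to pass through (c, f(c)), which doubles the error w, and its slope is the
  only freedom left. \<open>Q\<close> stands for the sign condition, which depends on the type of
  the point.\<close>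

lemma local_linear:
  assumes C: "Cr_on 0 {a..b} (D 0) D" and \<Lambda>: "0 \<le> \<Lambda>" and ab: "a < b" and c: "c \<in> {a..b}"
    and slope: "\<And>B w. 0 \<le> w \<Longrightarrow> (\<And>x. x \<in> {a..b} \<Longrightarrow> \<bar>D 0 x - (D 0 c + B * (x - c))\<bar> \<le> 2 * w) \<Longrightarrow>
      \<exists>\<beta>. \<forall>x\<in>{a..b}. \<bar>\<beta> * (x - c)\<bar> \<le> 2 * w * (1 + \<Lambda>) \<and> Q x (D 0 c + (B + \<beta>) * (x - c))"
  shows "\<exists>p. approximates 2 0 (local_const 2 \<Lambda>) D a b p \<and> (\<forall>x\<in>{a..b}. Q x (poly p x)) \<and>
    contact (D 0) (poly p) c 0 {a..b}"
proof -
  have cont: "continuous_on {a..b} (D 0)" using C by (simp add: Cr_on_def)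
  obtain p w where p: "degree p \<le> 1" "w = whitney_const 2 2 * modsm 2 (D 0) (b - a) {a..b}" "0 \<le> w"
    "\<And>x. x \<in> {a..b} \<Longrightarrow> \<bar>D 0 x - poly p x\<bar> \<le> w"
    using base_approximant[OF C ab _ c, of 2] by auto
  obtain A where A: "\<And>t. poly p (c + t) = (\<Sum>i\<le>1. A i * t ^ i)"
    using poly_shift_expansion[OF p(1), of c] by blast
  have pA: "poly p x = A 0 + A 1 * (x - c)" for x using A[of "x - c"] by (simp add: sum_atMost_1)
  have near: "\<bar>D 0 x - (D 0 c + A 1 * (x - c))\<bar> \<le> 2 * w" if "x \<in> {a..b}" for x
    using p(4)[OF that] p(4)[OF c] unfolding pA by simp
  obtain \<beta> where \<beta>: "\<And>x. x \<in> {a..b} \<Longrightarrow> \<bar>\<beta> * (x - c)\<bar> \<le> 2 * w * (1 + \<Lambda>)"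
    "\<And>x. x \<in> {a..b} \<Longrightarrow> Q x (D 0 c + (A 1 + \<beta>) * (x - c))"
    using slope[OF p(3) near] by blast
  define P where "P = [:D 0 c - (A 1 + \<beta>) * c, A 1 + \<beta>:]"
  have P: "poly P x = D 0 c + (A 1 + \<beta>) * (x - c)" for x by (simp add: P_def algebra_simps)
  have "\<bar>D 0 x - poly P x\<bar> \<le> (4 + 2 * \<Lambda>) * (w * (b - a) ^ 0)" if x: "x \<in> {a..b}" for x
  proof -
    have "D 0 x - poly P x = (D 0 x - (D 0 c + A 1 * (x - c))) - \<beta> * (x - c)"
      by (simp add: P algebra_simps)
    then show ?thesis using near[OF x] \<beta>(1)[OF x] by (simp add: algebra_simps)
  qed
  then have "approximates 2 0 (local_const 2 \<Lambda>) D a b P"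
    using cont ab \<Lambda> unfolding p(2) by (intro approximatesI[where D = D and \<kappa> = "4 + 2 * \<Lambda>"]) (auto simp: P_def)
  moreover have "contact (D 0) (poly P) c 0 {a..b}"
    using cont c by (intro contact_0I) (auto simp: P intro!: continuous_intros)
  ultimately show ?thesis using \<beta>(2) unfolding P[symmetric] by blast
qed

lemma local_alpha_0_2:
  assumes C: "Cr_on 0 {a..b} (D 0) D" and \<Lambda>: "0 \<le> \<Lambda>"
    and f: "\<And>x. x \<in> {a..b} \<Longrightarrow> 0 \<le> D 0 x"
    and c: "a < c" "c < b" "b - a \<le> \<Lambda> * (c - a)" "b - a \<le> \<Lambda> * (b - c)"
  shows "\<exists>p. approximates 2 0 (local_const 2 \<Lambda>) D a b p \<and> (\<forall>x\<in>{a..b}. 0 \<le> poly p x) \<and>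
    contact (D 0) (poly p) c 0 {a..b}"
proof (rule local_linear[where D = D, OF C \<Lambda>])
  show ab: "a < b" and cab: "c \<in> {a..b}" using c by auto
  fix B w :: real
  assume w: "0 \<le> w" and near: "\<And>x. x \<in> {a..b} \<Longrightarrow> \<bar>D 0 x - (D 0 c + B * (x - c))\<bar> \<le> 2 * w"
  define \<eta> where "\<eta> = min (c - a) (b - c)"
  have \<eta>: "0 < \<eta>" "\<eta> \<le> c - a" "\<eta> \<le> b - c" "b - a \<le> \<Lambda> * \<eta>" using c by (auto simp: \<eta>_def min_def)
  have "B * (a - c) = - (B * (c - a))" by (simp add: algebra_simps)
  then have "- (2 * w) \<le> D 0 c - B * (c - a)" using near[of a] f[of a] ab by simp
  moreover have "- (2 * w) \<le> D 0 c + B * (b - c)" using near[of b] f[of b] ab by simp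
  ultimately obtain \<beta> where \<beta>: "\<bar>\<beta>\<bar> \<le> 2 * w / \<eta>"
    "\<And>t. - (c - a) \<le> t \<Longrightarrow> t \<le> b - c \<Longrightarrow> 0 \<le> D 0 c + (B + \<beta>) * t"
    using slope_clamp[OF \<eta>(1-3) f[OF cab], of "2 * w" B] w by auto
  have "\<bar>\<beta> * (x - c)\<bar> \<le> 2 * w * (1 + \<Lambda>)" if x: "x \<in> {a..b}" for x
  proof -
    have "\<bar>\<beta> * (x - c)\<bar> \<le> (2 * w) / \<eta> * \<bar>x - c\<bar>" unfolding abs_mult using \<beta>(1) by (intro mult_right_mono) auto
    also have "\<dots> \<le> 2 * w * \<Lambda>" using w \<eta> cab x by (intro mult_ratio_le[where d = "b - a"]) auto
    finally show ?thesis using w by (simp add: algebra_simps)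
  qed
  then show "\<exists>\<beta>. \<forall>x\<in>{a..b}. \<bar>\<beta> * (x - c)\<bar> \<le> 2 * w * (1 + \<Lambda>) \<and> 0 \<le> D 0 c + (B + \<beta>) * (x - c)"
    using \<beta>(2) by (intro exI[of _ \<beta>]) auto
qed

lemma local_sign_0_2:
  assumes C: "Cr_on 0 {a..b} (D 0) D" and \<Lambda>: "0 \<le> \<Lambda>"
    and f: "\<And>x. x \<in> {a..b} \<Longrightarrow> 0 \<le> (x - c) * D 0 x"
    and c: "a < c" "c < b" "b - a \<le> \<Lambda> * (b - c)"
  shows "\<exists>p. approximates 2 0 (local_const 2 \<Lambda>) D a b p \<and> (\<forall>x\<in>{a..b}. 0 \<le> (x - c) * poly p x) \<and>
    contact (D 0) (poly p) c 0 {a..b}"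
proof (rule local_linear[where D = D, OF C \<Lambda>])
  show ab: "a < b" and cab: "c \<in> {a..b}" using c by auto
  have fc: "D 0 c = 0" using sign_change_zero[OF _ c(1,2) f] C by (simp add: Cr_on_def)
  fix B w :: real
  assume w: "0 \<le> w" and near: "\<And>x. x \<in> {a..b} \<Longrightarrow> \<bar>D 0 x - (D 0 c + B * (x - c))\<bar> \<le> 2 * w"
  \<comment> \<open>The line vanishes at c, so a nonnegative slope is all that is needed; how
    negative B can be is read off at the end b.\<close>
  define \<beta> where "\<beta> = max 0 (- B)"
  have "0 \<le> D 0 b" using f[of b] c by (simp add: zero_le_mult_iff)
  then have "- (2 * w) \<le> B * (b - c)" using near[of b] ab fc by simp
  then have "- (2 * w) / (b - c) \<le> B" using c by (subst pos_divide_le_eq) auto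
  then have \<beta>: "\<bar>\<beta>\<bar> \<le> (2 * w) / (b - c)" "0 \<le> B + \<beta>" using w c by (auto simp: \<beta>_def max_def)
  have "\<bar>\<beta> * (x - c)\<bar> \<le> 2 * w * (1 + \<Lambda>)" if x: "x \<in> {a..b}" for x
  proof -
    have "\<bar>\<beta> * (x - c)\<bar> \<le> (2 * w) / (b - c) * \<bar>x - c\<bar>" unfolding abs_mult using \<beta>(1) by (intro mult_right_mono) auto
    also have "\<dots> \<le> 2 * w * \<Lambda>" using w c cab x by (intro mult_ratio_le[where d = "b - a"]) auto
    finally show ?thesis using w by (simp add: algebra_simps)
  qed
  moreover have "0 \<le> (x - c) * (D 0 c + (B + \<beta>) * (x - c))" for x
    using mult_nonneg_nonneg[OF \<beta>(2), of "(x - c)^2"] by (simp add: fc power2_eq_square mult_ac)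
  ultimately show "\<exists>\<beta>. \<forall>x\<in>{a..b}. \<bar>\<beta> * (x - c)\<bar> \<le> 2 * w * (1 + \<Lambda>) \<and> 0 \<le> (x - c) * (D 0 c + (B + \<beta>) * (x - c))"
    by blast
qed

lemma local_end_0_2:
  assumes C: "Cr_on 0 {a..b} (D 0) D" and \<Lambda>: "0 \<le> \<Lambda>" and ab: "a < b"
    and f: "\<And>x. x \<in> {a..b} \<Longrightarrow> 0 \<le> D 0 x" and c: "c = a \<or> c = b"
  shows "\<exists>p. approximates 2 0 (local_const 2 \<Lambda>) D a b p \<and> (\<forall>x\<in>{a..b}. 0 \<le> poly p x) \<and>
    contact (D 0) (poly p) c 0 {a..b}"
proof (rule local_linear[where D = D, OF C \<Lambda> ab])
  show cab: "c \<in> {a..b}" using c ab by auto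
  fix B w :: real
  assume w: "0 \<le> w" and near: "\<And>x. x \<in> {a..b} \<Longrightarrow> \<bar>D 0 x - (D 0 c + B * (x - c))\<bar> \<le> 2 * w"
  define e where "e = (if c = a then b else a)"
  have e: "e \<in> {a..b}" "e - c \<noteq> 0" using c ab by (auto simp: e_def)
  \<comment> \<open>Lifts the far end by 2 w, which makes the line nonnegative at both ends. As c is
    an end itself, |x - c| <= |e - c| and no ratio \<Lambda> enters.\<close>
  define \<beta> where "\<beta> = 2 * w / (e - c)"
  have "\<bar>\<beta> * (x - c)\<bar> \<le> 2 * w * (1 + \<Lambda>) \<and> 0 \<le> D 0 c + (B + \<beta>) * (x - c)" if x: "x \<in> {a..b}" for x
  proof -
    define t where "t = (x - c) / (e - c)"
    have t: "x - c = t * (e - c)" "0 \<le> t" "t \<le> 1" using x c ab e(2) by (auto simp: t_def e_def divide_simps)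
    have \<beta>t: "\<beta> * (x - c) = 2 * w * t" using e(2) by (simp add: \<beta>_def t(1))
    have "2 * w * t \<le> 2 * w * (1 + \<Lambda>)" using t \<Lambda> w by (intro mult_left_mono) auto
    moreover have "0 \<le> 2 * w * t" using t w by simp
    moreover have "0 \<le> D 0 c + B * (e - c) + 2 * w" using near[OF e(1)] f[OF e(1)] by linarith
    then have "0 \<le> (1 - t) * D 0 c + t * (D 0 c + B * (e - c) + 2 * w)"
      using t f[OF cab] by (meson add_nonneg_nonneg diff_ge_0_iff_ge mult_nonneg_nonneg)
    moreover have "(1 - t) * D 0 c + t * (D 0 c + B * (e - c) + 2 * w) = D 0 c + (B + \<beta>) * (x - c)"
      unfolding distrib_right \<beta>t unfolding t(1) by (simp add: algebra_simps)
    ultimately show ?thesis unfolding \<beta>t by simp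
  qed
  then show "\<exists>\<beta>. \<forall>x\<in>{a..b}. \<bar>\<beta> * (x - c)\<bar> \<le> 2 * w * (1 + \<Lambda>) \<and> 0 \<le> D 0 c + (B + \<beta>) * (x - c)"
    by blast
qed

text \<open>A correction divisible by x - c keeps the value at c. It is applied to the approximant
  itself when r = 1 and to its quotient by x - c when r = 2.\<close>

lemma base_approximant_cubic:
  fixes p :: "real poly" and a b c w \<Lambda> :: real
  assumes p: "degree p \<le> 3"
    and err: "\<And>x. x \<in> {a..b} \<Longrightarrow> - (w * \<bar>x - c\<bar>) \<le> poly p x" and w: "0 \<le> w" and \<Lambda>: "0 \<le> \<Lambda>"
    and c: "a < c" "c < b" "b - a \<le> \<Lambda> * (c - a)" "b - a \<le> \<Lambda> * (b - c)"
  shows "\<exists>h. degree h \<le> 1 \<and> (\<forall>x\<in>{a..b}. 0 \<le> poly (p + [:- c, 1:] * h) x) \<and>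
    (\<forall>x\<in>{a..b}. \<bar>poly h x\<bar> \<le> w * (2 + 3 * \<Lambda>))"
proof -
  obtain A where A: "\<And>t. poly p (c + t) = (\<Sum>i\<le>3. A i * t ^ i)"
    using poly_shift_expansion[OF p, of c] by blast
  have pA: "poly p x = A 0 + A 1 * (x - c) + A 2 * (x - c)^2 + A 3 * (x - c)^3" for x
    using A[of "x - c"] by (simp add: sum_atMost_3)
  define \<eta> where "\<eta> = min (c - a) (b - c)"
  have \<eta>: "0 < \<eta>" "\<eta> \<le> c - a" "\<eta> \<le> b - c" "b - a \<le> \<Lambda> * \<eta>" using c by (auto simp: \<eta>_def min_def)
  have g: "- (w * \<bar>t\<bar>) \<le> A 0 + A 1 * t + A 2 * t^2 + A 3 * t^3" if "- (c - a) \<le> t" "t \<le> b - c" for t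
    using err[of "c + t"] pA[of "c + t"] that by simp
  obtain \<beta> \<gamma> where bg: "\<bar>\<beta>\<bar> \<le> 2 * w" "\<bar>\<gamma>\<bar> \<le> 3 * w / \<eta>"
    "\<And>t. - (c - a) \<le> t \<Longrightarrow> t \<le> b - c \<Longrightarrow> 0 \<le> A 0 + A 1 * t + A 2 * t^2 + A 3 * t^3 + \<beta> * t + \<gamma> * t^2"
    using cubic_correction[OF \<eta>(1-3) w g] by blast
  define h where "h = [:\<beta> - \<gamma> * c, \<gamma>:]"
  have h: "poly h x = \<beta> + \<gamma> * (x - c)" for x by (simp add: h_def algebra_simps)
  have "0 \<le> poly (p + [:- c, 1:] * h) x" if "x \<in> {a..b}" for x
  proof -
    have "poly (p + [:- c, 1:] * h) x = poly p x + (x - c) * poly h x" by (simp add: algebra_simps)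
    also have "\<dots> = A 0 + A 1 * (x - c) + A 2 * (x - c)^2 + A 3 * (x - c)^3 + \<beta> * (x - c) + \<gamma> * (x - c)^2"
      unfolding pA h by (simp add: algebra_simps power2_eq_square)
    also have "0 \<le> \<dots>" using that by (intro bg(3)) auto
    finally show ?thesis .
  qed
  moreover have "\<bar>poly h x\<bar> \<le> w * (2 + 3 * \<Lambda>)" if "x \<in> {a..b}" for x
  proof -
    have "\<bar>\<gamma> * (x - c)\<bar> \<le> 3 * w / \<eta> * \<bar>x - c\<bar>" unfolding abs_mult using bg(2) by (intro mult_right_mono) auto
    also have "\<dots> \<le> 3 * w * \<Lambda>"
      using w \<eta> c that by (intro mult_ratio_le[where d = "b - a"]) auto
    finally have "\<bar>\<gamma> * (x - c)\<bar> \<le> 3 * w * \<Lambda>" .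
    then show ?thesis using bg(1) unfolding h by (simp add: algebra_simps)
  qed
  moreover have "degree h \<le> 1" by (simp add: h_def)
  ultimately show ?thesis by blast
qed

text \<open>The only even power of degree at most r = 1 is a constant, which would spoil the value
  at c. The error w |x - c| does vanish at c, and the cubic correction is a polynomial replacement
  for adding w |x - c|.\<close>

lemma local_alpha_1:
  assumes C: "Cr_on 1 {a..b} (D 0) D" and \<Lambda>: "0 \<le> \<Lambda>" and k: "k = 2 \<or> k = 3"
    and f: "\<And>x. x \<in> {a..b} \<Longrightarrow> 0 \<le> D 0 x"
    and c: "a < c" "c < b" "b - a \<le> \<Lambda> * (c - a)" "b - a \<le> \<Lambda> * (b - c)"
  shows "\<exists>p. approximates k 1 (local_const k \<Lambda>) D a b p \<and> (\<forall>x\<in>{a..b}. 0 \<le> poly p x) \<and>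
    contact (D 0) (poly p) c 0 {a..b}"
proof -
  have cont: "continuous_on {a..b} (D 1)" using C by (simp add: Cr_on_def)
  have ab: "a < b" and cab: "c \<in> {a..b}" and k1: "1 \<le> k" using c k by auto
  obtain p w where p: "degree p \<le> k" "w = whitney_const k k * modsm k (D 1) (b - a) {a..b}" "0 \<le> w"
    "\<And>x. x \<in> {a..b} \<Longrightarrow> \<bar>D 0 x - poly p x\<bar> \<le> w * \<bar>x - c\<bar>"
    using base_approximant[OF C ab k1 cab] by auto
  have "- (w * \<bar>x - c\<bar>) \<le> poly p x" if "x \<in> {a..b}" for x using p(4)[OF that] f[OF that] by linarith
  then obtain h where h: "degree h \<le> 1" "\<And>x. x \<in> {a..b} \<Longrightarrow> 0 \<le> poly (p + [:- c, 1:] * h) x"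
    "\<And>x. x \<in> {a..b} \<Longrightarrow> \<bar>poly h x\<bar> \<le> w * (2 + 3 * \<Lambda>)"
    using base_approximant_cubic[of p a b w c \<Lambda>] p(1,3) k c \<Lambda> by auto
  let ?P = "p + [:- c, 1:] * h"
  have P: "poly ?P x = poly p x + (x - c) * poly h x" for x by (simp add: algebra_simps)
  have err: "\<bar>D 0 x - poly ?P x\<bar> \<le> (3 + 3 * \<Lambda>) * w * \<bar>x - c\<bar>" if x: "x \<in> {a..b}" for x
  proof -
    have "\<bar>(x - c) * poly h x\<bar> \<le> \<bar>x - c\<bar> * (w * (2 + 3 * \<Lambda>))"
      unfolding abs_mult using h(3)[OF x] by (intro mult_left_mono) auto
    then show ?thesis using p(4)[OF x] unfolding P by (simp add: algebra_simps)
  qed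
  have "approximates k 1 (local_const k \<Lambda>) D a b ?P"
  proof (rule approximatesI[where D = D, OF cont ab \<Lambda>])
    have "degree ([:- c, 1:] * h) \<le> 2" using degree_mult_le[of "[:- c, 1:]" h] h(1) by simp
    then show "degree ?P \<le> k + 1 - 1" using p(1) k by (intro degree_add_le) auto
    show "\<bar>D 0 x - poly ?P x\<bar> \<le> (3 + 3 * \<Lambda>) * (whitney_const k k * modsm k (D 1) (b - a) {a..b} * (b - a) ^ 1)"
      if x: "x \<in> {a..b}" for x
    proof -
      have "(3 + 3 * \<Lambda>) * w * \<bar>x - c\<bar> \<le> (3 + 3 * \<Lambda>) * w * (b - a)"
        using p(3) \<Lambda> x cab by (intro mult_left_mono) auto
      then show ?thesis using err[OF x] unfolding p(2) by simp
    qed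
  qed (use \<Lambda> in simp)
  moreover have "contact (D 0) (poly ?P) c 0 {a..b}"
    using err by (intro contactI[where K = "(3 + 3 * \<Lambda>) * w"]) simp
  ultimately show ?thesis using h(2) by blast
qed

text \<open>After division by \<open>x - c\<close> this is the correction of a cubic with prescribed value at \<open>c\<close>.\<close>

lemma local_sign_2_3:
  assumes C: "Cr_on 2 {a..b} (D 0) D" and \<Lambda>: "0 \<le> \<Lambda>"
    and f: "\<And>x. x \<in> {a..b} \<Longrightarrow> 0 \<le> (x - c) * D 0 x"
    and c: "a < c" "c < b" "b - a \<le> \<Lambda> * (c - a)" "b - a \<le> \<Lambda> * (b - c)"
  shows "\<exists>p. approximates 3 2 (local_const 3 \<Lambda>) D a b p \<and> (\<forall>x\<in>{a..b}. 0 \<le> (x - c) * poly p x) \<and>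
    contact (D 0) (poly p) c 1 {a..b}"
proof -
  have cont: "continuous_on {a..b} (D 2)" using C by (simp add: Cr_on_def)
  have cont0: "continuous_on {a..b} (D 0)"
    using Cr_on_continuous[OF C, of 0] by simp
  have ab: "a < b" and cab: "c \<in> {a..b}" using c by auto
  have fc: "D 0 c = 0" using sign_change_zero[OF cont0 c(1,2) f] .
  obtain p w where p: "degree p \<le> 4" "w = whitney_const 3 3 * modsm 3 (D 2) (b - a) {a..b}" "0 \<le> w"
    "\<And>x. x \<in> {a..b} \<Longrightarrow> \<bar>D 0 x - poly p x\<bar> \<le> w * \<bar>x - c\<bar>^2"
    using base_approximant[OF C ab _ cab, of 3] by auto
  have "poly p c = 0" using p(4)[OF cab] fc by simp
  then obtain g where g: "p = [:- c, 1:] * g" by (auto simp: poly_eq_0_iff_dvd elim: dvdE)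
  have dg: "degree g \<le> 3"
  proof (cases "g = 0")
    case False
    then have "degree p = Suc (degree g)" unfolding g by (subst degree_mult_eq) auto
    then show ?thesis using p(1) by simp
  qed simp
  have gx: "poly p x = (x - c) * poly g x" for x by (simp add: g algebra_simps)
  have g1: "0 \<le> poly g x + w * \<bar>x - c\<bar>" if x: "x \<in> {a..b}" "x \<noteq> c" for x
  proof -
    have 1: "(x - c) * (D 0 x - poly p x) \<le> w * \<bar>x - c\<bar>^3"
    proof -
      have "(x - c) * (D 0 x - poly p x) \<le> \<bar>x - c\<bar> * \<bar>D 0 x - poly p x\<bar>" by (metis abs_ge_self abs_mult)
      also have "\<dots> \<le> \<bar>x - c\<bar> * (w * \<bar>x - c\<bar>^2)" using p(4)[OF x(1)] by (intro mult_left_mono) auto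
      finally show ?thesis by (simp add: power2_eq_square power3_eq_cube mult_ac)
    qed
    have "(x - c) * poly p x = (x - c)^2 * poly g x" by (simp add: gx power2_eq_square)
    moreover have "\<bar>x - c\<bar>^3 = (x - c)^2 * \<bar>x - c\<bar>" by (simp add: power3_eq_cube power2_eq_square)
    ultimately have "0 \<le> (x - c)^2 * (poly g x + w * \<bar>x - c\<bar>)"
      using 1 f[OF x(1)] by (simp add: algebra_simps)
    moreover have "0 < (x - c)^2" using x(2) by simp
    ultimately show ?thesis by (simp add: zero_le_mult_iff)
  qed
  \<comment> \<open>The sign of the quotient at c itself follows by continuity.\<close>
  have "0 \<le> (\<lambda>x. poly g x + w * \<bar>x - c\<bar>) c"
  proof (rule nonneg_limit_right[where b = b and h = "\<lambda>x. poly g x + w * \<bar>x - c\<bar>"])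
    show "continuous_on {c..b} (\<lambda>x. poly g x + w * \<bar>x - c\<bar>)" by (intro continuous_intros)
    show "0 \<le> poly g x + w * \<bar>x - c\<bar>" if "c < x" "x \<le> b" for x
      using g1[of x] that c by simp
  qed (use c in simp)
  then have gc: "0 \<le> poly g c" by simp
  have "- (w * \<bar>x - c\<bar>) \<le> poly g x" if "x \<in> {a..b}" for x
    using g1[OF that] gc by (cases "x = c") auto
  then obtain h where h: "degree h \<le> 1" "\<And>x. x \<in> {a..b} \<Longrightarrow> 0 \<le> poly (g + [:- c, 1:] * h) x"
    "\<And>x. x \<in> {a..b} \<Longrightarrow> \<bar>poly h x\<bar> \<le> w * (2 + 3 * \<Lambda>)"
    using base_approximant_cubic[of g a b w c \<Lambda>] dg p(3) c \<Lambda> by auto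
  define P where "P = [:- c, 1:] * (g + [:- c, 1:] * h)"
  have P: "poly P x = poly p x + (x - c)^2 * poly h x" for x
    by (simp add: P_def gx algebra_simps power2_eq_square)
  have P': "(x - c) * poly P x = (x - c)^2 * poly (g + [:- c, 1:] * h) x" for x
    by (simp add: P_def algebra_simps power2_eq_square)
  have err: "\<bar>D 0 x - poly P x\<bar> \<le> (3 + 3 * \<Lambda>) * w * \<bar>x - c\<bar>^2" if x: "x \<in> {a..b}" for x
  proof -
    have "\<bar>(x - c)^2 * poly h x\<bar> \<le> \<bar>(x - c)^2\<bar> * (w * (2 + 3 * \<Lambda>))"
      unfolding abs_mult using h(3)[OF x] by (intro mult_left_mono) auto
    then show ?thesis using p(4)[OF x] unfolding P by (simp add: algebra_simps)
  qed
  have "approximates 3 2 (local_const 3 \<Lambda>) D a b P"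
  proof (rule approximatesI[where D = D, OF cont ab \<Lambda>])
    have "degree ([:- c, 1:] * h) \<le> 3" using degree_mult_le[of "[:- c, 1:]" h] h(1) by simp
    then have "degree (g + [:- c, 1:] * h) \<le> 3" using dg by (intro degree_add_le) auto
    then show "degree P \<le> 3 + 2 - 1" unfolding P_def using degree_mult_le[of "[:- c, 1:]" "g + [:- c, 1:] * h"] by simp
    show "\<bar>D 0 x - poly P x\<bar> \<le> (3 + 3 * \<Lambda>) * (whitney_const 3 3 * modsm 3 (D 2) (b - a) {a..b} * (b - a) ^ 2)"
      if x: "x \<in> {a..b}" for x
    proof -
      have "(3 + 3 * \<Lambda>) * w * \<bar>x - c\<bar>^2 \<le> (3 + 3 * \<Lambda>) * w * (b - a)^2"
        using p(3) \<Lambda> x cab by (intro mult_left_mono power_mono) auto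
      then show ?thesis using err[OF x] unfolding p(2) by (simp add: mult_ac)
    qed
  qed (use \<Lambda> in simp)
  moreover have "contact (D 0) (poly P) c 1 {a..b}"
    using err by (intro contactI[where K = "(3 + 3 * \<Lambda>) * w"]) (simp add: numeral_2_eq_2)
  moreover have "0 \<le> (x - c) * poly P x" if "x \<in> {a..b}" for x
    unfolding P' using h(2)[OF that] by (intro mult_nonneg_nonneg) auto
  ultimately show ?thesis by blast
qed

text \<open>Contact of order 1 with f merely in C^1 forces value and slope at c to agree exactly.
  The quotient of the approximant by x - c is then a line with value f'(c) >= 0 at c, and only its
  slope has to be clamped.\<close>

lemma local_sign_1_2:
  assumes C: "Cr_on 1 {a..b} (D 0) D" and \<Lambda>: "0 \<le> \<Lambda>"
    and f: "\<And>x. x \<in> {a..b} \<Longrightarrow> 0 \<le> (x - c) * D 0 x"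
    and c: "a < c" "c < b" "b - a \<le> \<Lambda> * (c - a)" "b - a \<le> \<Lambda> * (b - c)"
  shows "\<exists>p. approximates 2 1 (local_const 2 \<Lambda>) D a b p \<and> (\<forall>x\<in>{a..b}. 0 \<le> (x - c) * poly p x) \<and>
    contact (D 0) (poly p) c 1 {a..b}"
proof -
  have cont: "continuous_on {a..b} (D 1)" using C by (simp add: Cr_on_def)
  have der: "(D 0 has_real_derivative D 1 x) (at x within {a..b})" if "x \<in> {a..b}" for x
    using C that by (simp add: Cr_on_def)
  have cont0: "continuous_on {a..b} (D 0)"
    using Cr_on_continuous[OF C, of 0] by simp
  have ab: "a < b" and cab: "c \<in> {a..b}" using c by auto
  have fc: "D 0 c = 0" using sign_change_zero[OF cont0 c(1,2) f] .
  have B: "0 \<le> D 1 c"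
  proof (rule ccontr)
    assume "\<not> 0 \<le> D 1 c"
    then obtain d where d: "0 < d" "\<forall>h>0. c + h \<in> {a..b} \<longrightarrow> h < d \<longrightarrow> D 0 (c + h) < D 0 c"
      using has_real_derivative_neg_dec_right[OF der[OF cab]] by auto
    define h where "h = min (d / 2) (b - c)"
    have h: "0 < h" "h < d" "c + h \<in> {a..b}" using d(1) c by (auto simp: h_def)
    then have "D 0 (c + h) < 0" using d(2) fc by auto
    then show False using f[OF h(3)] h(1) by (simp add: zero_le_mult_iff)
  qed
  define w where "w = whitney_const 2 2 * modsm 2 (D 1) (b - a) {a..b}"
  have w: "0 \<le> w" unfolding w_def using ab by (intro mult_nonneg_nonneg whitney_const_nonneg modsm_nonneg cont) auto
  obtain Q where Q: "degree Q < 2" "\<And>x. x \<in> {a..b} \<Longrightarrow> \<bar>D 1 x - poly Q x\<bar> \<le> w"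
    using whitney[OF cont ab, of 2] unfolding w_def by auto
  \<comment> \<open>Shifting the approximant of f' to be exact at c doubles its error.\<close>
  define Q' where "Q' = Q + [:D 1 c - poly Q c:]"
  have dQ': "degree Q' \<le> 1" unfolding Q'_def using Q(1) by (intro degree_add_le) auto
  have Q': "\<bar>D 1 x - poly Q' x\<bar> \<le> 2 * w" if "x \<in> {a..b}" for x
    using Q(2)[OF that] Q(2)[OF cab] by (simp add: Q'_def)
  obtain p where p: "degree p \<le> 2" "pderiv p = Q'" "poly p c = D 0 c"
    "\<And>x. x \<in> {a..b} \<Longrightarrow> \<bar>D 0 x - poly p x\<bar> \<le> 2 * w * \<bar>x - c\<bar>"
  proof -
    obtain p where "degree p \<le> degree Q' + 1" "(pderiv ^^ 1) p = Q'" "\<forall>i<1. poly ((pderiv ^^ i) p) c = D i c"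
      "\<forall>x\<in>{a..b}. \<bar>D 0 x - poly p x\<bar> \<le> 2 * w * \<bar>x - c\<bar> ^ 1"
      using taylor_type_approximation[OF C cab Q'] by blast
    then show ?thesis using dQ' by (intro that[of p]) auto
  qed
  obtain A where A: "\<And>t. poly p (c + t) = (\<Sum>i\<le>2. A i * t ^ i)"
    using poly_shift_expansion[OF p(1), of c] by blast
  have pA': "poly p x = A 0 + A 1 * (x - c) + A 2 * (x - c)^2" for x
    using A[of "x - c"] by (simp add: sum_atMost_2)
  have A0: "A 0 = 0" using pA'[of c] p(3) fc by simp
  have "(poly p has_real_derivative A 1) (at c)"
    unfolding pA'[abs_def] by (auto intro!: derivative_eq_intros)
  moreover have "(poly p has_real_derivative D 1 c) (at c)"
    using poly_DERIV[of p c] unfolding p(2) by (simp add: Q'_def)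
  ultimately have A1: "A 1 = D 1 c" by (rule DERIV_unique)
  have pA: "poly p x = (x - c) * (D 1 c + A 2 * (x - c))" for x
    unfolding pA' A0 A1 by (simp add: algebra_simps power2_eq_square)
  define \<eta> where "\<eta> = min (c - a) (b - c)"
  have \<eta>: "0 < \<eta>" "\<eta> \<le> c - a" "\<eta> \<le> b - c" "b - a \<le> \<Lambda> * \<eta>" using c by (auto simp: \<eta>_def min_def)
  have end_b: "- (2 * w) \<le> D 1 c + A 2 * (b - c)"
  proof -
    have "0 \<le> D 0 b" using f[of b] c by (simp add: zero_le_mult_iff)
    then have "- (2 * w) * (b - c) \<le> poly p b" using p(4)[of b] c by (simp add: abs_le_iff)
    then have "(b - c) * (- (2 * w)) \<le> (b - c) * (D 1 c + A 2 * (b - c))"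
      unfolding pA by (simp only: mult.commute)
    then show ?thesis by (rule mult_left_le_imp_le) (use c in simp)
  qed
  have end_a: "- (2 * w) \<le> D 1 c - A 2 * (c - a)"
  proof -
    have "D 0 a \<le> 0" using f[of a] c by (simp add: zero_le_mult_iff)
    then have "- (2 * w) * (c - a) \<le> - poly p a" using p(4)[of a] c by (simp add: abs_le_iff)
    also have "- poly p a = (D 1 c - A 2 * (c - a)) * (c - a)" unfolding pA by (simp add: algebra_simps)
    finally show ?thesis by (rule mult_right_le_imp_le) (use c in simp)
  qed
  obtain \<beta> where \<beta>: "\<bar>\<beta>\<bar> \<le> 2 * w / \<eta>" "\<And>t. - (c - a) \<le> t \<Longrightarrow> t \<le> b - c \<Longrightarrow> 0 \<le> D 1 c + (A 2 + \<beta>) * t"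
    using slope_clamp[OF \<eta>(1-3) B, of "2 * w" "A 2"] end_a end_b w by auto
  define P where "P = p + smult \<beta> ([:- c, 1:]^2)"
  have P: "poly P x = poly p x + \<beta> * (x - c)^2" for x by (simp add: P_def poly_power_linear)
  have P': "poly P x = (x - c) * (D 1 c + (A 2 + \<beta>) * (x - c))" for x
    unfolding P pA by (simp add: algebra_simps power2_eq_square)
  have "approximates 2 1 (local_const 2 \<Lambda>) D a b P"
  proof (rule approximatesI[where D = D, OF cont ab \<Lambda>])
    show "degree P \<le> 2 + 1 - 1" unfolding P_def using p(1)
      by (intro degree_add_le order_trans[OF degree_smult_le]) (simp_all add: power2_eq_square)
    show "\<bar>D 0 x - poly P x\<bar> \<le> (2 + 2 * \<Lambda>) * (whitney_const 2 2 * modsm 2 (D 1) (b - a) {a..b} * (b - a) ^ 1)"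
      if x: "x \<in> {a..b}" for x
    proof -
      have "\<bar>\<beta>\<bar> * \<bar>x - c\<bar> \<le> 2 * w / \<eta> * \<bar>x - c\<bar>" using \<beta>(1) by (intro mult_right_mono) auto
      also have "\<dots> \<le> 2 * w * \<Lambda>" using w \<eta> x cab by (intro mult_ratio_le[where d = "b - a"]) auto
      finally have "(\<bar>\<beta>\<bar> * \<bar>x - c\<bar>) * \<bar>x - c\<bar> \<le> 2 * w * \<Lambda> * \<bar>x - c\<bar>" by (intro mult_right_mono) auto
      then have "\<bar>\<beta> * (x - c)^2\<bar> \<le> 2 * w * \<Lambda> * \<bar>x - c\<bar>"
        by (simp add: abs_mult power2_eq_square mult_ac)
      then have "\<bar>D 0 x - poly P x\<bar> \<le> (2 + 2 * \<Lambda>) * w * \<bar>x - c\<bar>"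
        using p(4)[OF x] unfolding P by (simp add: algebra_simps)
      also have "\<dots> \<le> (2 + 2 * \<Lambda>) * w * (b - a)"
        using w \<Lambda> x cab by (intro mult_left_mono) auto
      finally show ?thesis by (simp add: w_def)
    qed
  qed (use \<Lambda> in simp)
  moreover have "0 \<le> (x - c) * poly P x" if "x \<in> {a..b}" for x
  proof -
    have "(x - c) * poly P x = (x - c)^2 * (D 1 c + (A 2 + \<beta>) * (x - c))"
      unfolding P' by (simp add: power2_eq_square)
    moreover have "0 \<le> D 1 c + (A 2 + \<beta>) * (x - c)" using that by (intro \<beta>(2)) auto
    ultimately show ?thesis by simp
  qed
  moreover have "contact (D 0) (poly P) c 1 {a..b}"
  proof (rule contact_1I)
    have "((\<lambda>x. (x - c) * (D 1 c + (A 2 + \<beta>) * (x - c))) has_real_derivative D 1 c) (at c)"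
      by (auto intro!: derivative_eq_intros)
    then show "(poly P has_real_derivative D 1 c) (at c within {a..b})"
      unfolding P'[abs_def] by (rule has_field_derivative_at_within)
  qed (use der[OF cab] fc in \<open>simp_all add: P'\<close>)
  ultimately show ?thesis by blast
qed

section \<open>The parameter tuples by type of point\<close>

lemma admissible_pos: "(r, k, m1, m2, m3) \<in> admissible \<Longrightarrow> 1 \<le> k \<and> 2 \<le> k + r"
  by (auto simp: admissible_def)

lemma admissible_orders:
  "(r, k, m1, m2, m3) \<in> admissible \<Longrightarrow> m1 \<le> m3 \<and> 0 \<le> m2 \<and> 0 \<le> m3 \<and>
     m2 \<le> int (k + r - 2) \<and> m3 \<le> int (k + r - 2) \<and> m2 \<le> int r \<and> m3 \<le> int r"
  by (auto simp: admissible_def)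

text \<open>Which tuples escape the power corrections depends on the type of point. At points
  without sign change these are the ones with k = 2 or 3 and m1 = 0, where r is 0 or 1; (2, 3, 1, 1,
  1) is exceptional only at sign changes, (1, 3, 0, 0, 0) only at points of \<alpha>, and at the
  ends only r = 0 is.\<close>

lemma admissible_alpha:
  assumes "(r, k, m1, m2, m3) \<in> admissible"
  obtains "r = 0" "k = 2" "m1 = 0" | "r = 1" "k = 2 \<or> k = 3" "m1 = 0"
  | "m1 = (if even r then int r - 1 else int r - 2)"
  using assms by (auto simp: admissible_def)

lemma admissible_sign:
  assumes "(r, k, m1, m2, m3) \<in> admissible"
  obtains "r = 0" "k = 2" "m2 = 0" | "r = 1" "k = 2" "m2 = 1" | "r = 2" "k = 3" "m2 = 1"
  | "1 \<le> r" "m2 = (if odd r then int r - 1 else int r - 2)"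
  using assms by (auto simp: admissible_def)

lemma admissible_end:
  assumes "(r, k, m1, m2, m3) \<in> admissible"
  obtains "r = 0" "k = 2" "m3 = 0" | "m3 = int r - 1"
  using assms by (auto simp: admissible_def)

lemma local_alpha:
  assumes adm: "(r, k, m1, m2, m3) \<in> admissible"
    and C: "Cr_on r {a..b} (D 0) D" and \<Lambda>: "0 \<le> \<Lambda>"
    and f: "\<And>x. x \<in> {a..b} \<Longrightarrow> 0 \<le> D 0 x"
    and c: "a < c" "c < b" "b - a \<le> \<Lambda> * (c - a)" "b - a \<le> \<Lambda> * (b - c)"
  shows "\<exists>p. approximates k r (local_const k \<Lambda>) D a b p \<and> (\<forall>x\<in>{a..b}. 0 \<le> poly p x) \<and>
    (\<forall>M. int M = m1 \<longrightarrow> contact (D 0) (poly p) c M {a..b})"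
  using adm
proof (cases rule: admissible_alpha)
  case 1
  then show ?thesis using local_alpha_0_2[where D = D, OF _ \<Lambda> f c] C by auto
next
  case 2
  then show ?thesis using local_alpha_1[where D = D, OF _ \<Lambda> 2(2) f c] C by auto
next
  case 3
  show ?thesis
    by (rule local_alpha_generic[OF C _ _ \<Lambda> f _ 3]) (use c admissible_pos[OF adm] in auto)
qed

lemma local_sign:
  assumes adm: "(r, k, m1, m2, m3) \<in> admissible"
    and C: "Cr_on r {a..b} (D 0) D" and \<Lambda>: "0 \<le> \<Lambda>"
    and f: "\<And>x. x \<in> {a..b} \<Longrightarrow> 0 \<le> (x - c) * D 0 x"
    and c: "a < c" "c < b" "b - a \<le> \<Lambda> * (c - a)" "b - a \<le> \<Lambda> * (b - c)"
  shows "\<exists>p. approximates k r (local_const k \<Lambda>) D a b p \<and> (\<forall>x\<in>{a..b}. 0 \<le> (x - c) * poly p x) \<and>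
    (\<forall>M. int M = m2 \<longrightarrow> contact (D 0) (poly p) c M {a..b})"
  using adm
proof (cases rule: admissible_sign)
  case 1
  then show ?thesis using local_sign_0_2[where D = D, OF _ \<Lambda> f c(1,2,4)] C by auto
next
  case 2
  then show ?thesis using local_sign_1_2[where D = D, OF _ \<Lambda> f c] C by auto
next
  case 3
  then show ?thesis using local_sign_2_3[where D = D, OF _ \<Lambda> f c] C by auto
next
  case 4
  show ?thesis
    by (rule local_sign_generic[OF C _ _ \<Lambda> f _ 4]) (use c admissible_pos[OF adm] in auto)
qed

lemma local_end:
  assumes adm: "(r, k, m1, m2, m3) \<in> admissible"
    and C: "Cr_on r {a..b} (D 0) D" and \<Lambda>: "0 \<le> \<Lambda>" and ab: "a < b"
    and f: "\<And>x. x \<in> {a..b} \<Longrightarrow> 0 \<le> D 0 x" and c: "c = a \<or> c = b"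
  shows "\<exists>p. approximates k r (local_const k \<Lambda>) D a b p \<and> (\<forall>x\<in>{a..b}. 0 \<le> poly p x) \<and>
    (\<forall>M. int M = m3 \<longrightarrow> contact (D 0) (poly p) c M {a..b})"
  using adm
proof (cases rule: admissible_end)
  case 1
  then show ?thesis using local_end_0_2[where D = D, OF _ \<Lambda> ab f c] C by auto
next
  case 2
  show ?thesis
    by (rule local_end_generic[OF C ab _ \<Lambda> f c 2]) (use admissible_pos[OF adm] in auto)
qed

lemma Cr_on_cmult:
  assumes "Cr_on r I (D 0) D"
  shows "Cr_on r I (\<lambda>x. \<sigma> * D 0 x) (\<lambda>i x. \<sigma> * D i x)"
  using assms unfolding Cr_on_def by (auto intro!: DERIV_cmult continuous_intros)

lemma modsm_sign: "\<bar>\<sigma>\<bar> = 1 \<Longrightarrow> modsm k (\<lambda>x. \<sigma> * g x) t J = modsm k g t J"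
  by (cases "\<sigma> = 1") (auto simp: modsm_uminus abs_if split: if_splits)

lemma sign_cancel: "\<bar>\<sigma>\<bar> = 1 \<Longrightarrow> \<sigma> * (\<sigma> * x) = x" "\<bar>\<sigma>\<bar> = 1 \<Longrightarrow> \<bar>x - \<sigma> * y\<bar> = \<bar>\<sigma> * x - y\<bar>"
  for \<sigma> x y :: real
  by (auto simp: abs_if split: if_splits)

lemma approximates_sign:
  assumes "approximates k r K (\<lambda>i x. \<sigma> * D i x) a b p" "\<bar>\<sigma>\<bar> = 1"
  shows "approximates k r K D a b (smult \<sigma> p)"
  using assms by (auto simp: approximates_def modsm_sign sign_cancel)

lemma contact_sign:
  assumes "contact (\<lambda>x. \<sigma> * f x) (poly p) c M I" "\<bar>\<sigma>\<bar> = 1"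
  shows "contact f (poly (smult \<sigma> p)) c M I"
  using assms by (simp add: contact_def sign_cancel)

lemma taylor_remainder_derivative:
  "((\<lambda>x. v * (x - c) ^ Suc n / fact (Suc n)) has_real_derivative v * (x - c) ^ n / fact n) (at x within I)"
proof -
  have "((\<lambda>x. v * (x - c) ^ Suc n / fact (Suc n)) has_real_derivative
     v * (real (Suc n) * (x - c) ^ n) / fact (Suc n)) (at x within I)"
  proof -
    have "((\<lambda>x. x - c) has_real_derivative 1) (at x within I)" by (auto intro!: derivative_eq_intros)
    from DERIV_power_Suc[OF this, of n] show ?thesis
      by (intro DERIV_cdivide DERIV_cmult) simp
  qed
  also have "v * (real (Suc n) * (x - c) ^ n) / fact (Suc n) = v * (x - c) ^ n / fact n"
    by (simp add: field_simps del: of_nat_Suc)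
  finally show ?thesis .
qed

section \<open>Global construction\<close>

text \<open>If the derivatives below i vanish at c and v = e^(i)(c) does not, then near c the
  function differs from v (x - c)^i / i! by at most half of its size, while contact allows the
  function at most a quarter of that size; 1/2 + 1/4 < 1.\<close>

lemma contact_zero_derivatives:
  fixes e :: "nat \<Rightarrow> real \<Rightarrow> real"
  assumes C: "Cr_on M {-1..1} (e 0) e" and c: "c \<in> {-1..1}"
    and con: "contact (e 0) (\<lambda>_. 0) c M {-1..1}" and i: "i \<le> M"
  shows "e i c = 0"
  using i
proof (induction i rule: less_induct)
  case (less i)
  show ?case
  proof (rule ccontr)
    assume v0: "e i c \<noteq> 0"
    define v where "v = e i c"
    define F where "F = (fact i :: real)"
    have F: "0 < F" by (simp add: F_def)
    have pos: "0 < \<bar>v\<bar> / (2 * F)" "0 < \<bar>v\<bar> / (4 * F)" using v0 F by (auto simp: v_def)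
    have cont: "continuous_on {-1..1} (e i)" using Cr_on_continuous[OF C less.prems] .
    obtain \<delta>1 where \<delta>1: "0 < \<delta>1" "\<And>x. x \<in> {-1..1} \<Longrightarrow> \<bar>x - c\<bar> < \<delta>1 \<Longrightarrow> \<bar>e i x - v\<bar> < \<bar>v\<bar> / (2 * F)"
      using cont c pos(1) unfolding continuous_on_iff dist_real_def v_def by meson
    obtain \<delta>2 where \<delta>2: "0 < \<delta>2" "\<And>x. x \<in> {-1..1} \<Longrightarrow> \<bar>x - c\<bar> < \<delta>2 \<Longrightarrow> \<bar>e 0 x\<bar> \<le> \<bar>v\<bar> / (4 * F) * \<bar>x - c\<bar> ^ M"
      using con pos(2) unfolding contact_def by auto
    define \<eta> where "\<eta> = min 1 (min \<delta>1 \<delta>2) / 2"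
    have \<eta>: "0 < \<eta>" "\<eta> < 1" "\<eta> < \<delta>1" "\<eta> < \<delta>2" using \<delta>1(1) \<delta>2(1) by (auto simp: \<eta>_def min_def)
    define a where "a = max (-1) (c - \<eta>)"
    define b where "b = min 1 (c + \<eta>)"
    have sub: "{a..b} \<subseteq> {-1..1}" and cab: "c \<in> {a..b}" and near: "\<And>x. x \<in> {a..b} \<Longrightarrow> \<bar>x - c\<bar> \<le> \<eta>"
      using c \<eta>(1) by (auto simp: a_def b_def)
    \<comment> \<open>c may be an end of [-1, 1], so the test point is taken on a side where there
      is room.\<close>
    define x where "x = (if c < 1 then b else a)"
    have x: "x \<in> {a..b}" "x \<noteq> c" using c \<eta>(1) cab by (auto simp: x_def a_def b_def)
    \<comment> \<open>Only the Taylor term of order i is subtracted; the lower ones vanish by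
      induction.\<close>
    define u where "u j x = e j x - v * (x - c) ^ (i - j) / fact (i - j)" for j x
    have "\<bar>u 0 x\<bar> \<le> \<bar>v\<bar> / (2 * F) * \<bar>x - c\<bar> ^ i"
    proof (rule iterated_bound[OF _ _ cab _ x(1)])
      fix j x assume j: "j < i" and x: "x \<in> {a..b}"
      have ij: "i - j = Suc (i - Suc j)" using j by simp
      have "(e j has_real_derivative e (Suc j) x) (at x within {-1..1})"
        using C j less.prems x sub by (auto simp: Cr_on_def)
      then have "(e j has_real_derivative e (Suc j) x) (at x within {a..b})"
        by (rule DERIV_subset[OF _ sub])
      then show "(u j has_real_derivative u (Suc j) x) (at x within {a..b})"
        unfolding u_def[abs_def] ij by (intro DERIV_diff taylor_remainder_derivative)
    next
      fix j assume "j < i"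
      then show "u j c = 0" using less.IH less.prems by (simp add: u_def)
    next
      fix x assume x: "x \<in> {a..b}"
      then show "\<bar>u i x\<bar> \<le> \<bar>v\<bar> / (2 * F)"
        using \<delta>1(2)[of x] near[OF x] \<eta>(3) sub by (auto simp: u_def intro: less_imp_le)
    qed
    moreover have "\<bar>e 0 x\<bar> \<le> \<bar>v\<bar> / (4 * F) * \<bar>x - c\<bar> ^ i"
    proof -
      have "\<bar>e 0 x\<bar> \<le> \<bar>v\<bar> / (4 * F) * \<bar>x - c\<bar> ^ M" using \<delta>2(2)[of x] near[OF x(1)] \<eta>(4) x(1) sub by auto
      also have "\<dots> \<le> \<bar>v\<bar> / (4 * F) * \<bar>x - c\<bar> ^ i"
        using pos(2) near[OF x(1)] \<eta>(2) less.prems by (intro mult_left_mono power_decreasing) auto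
      finally show ?thesis .
    qed
    moreover have "e 0 x = u 0 x + v * (x - c) ^ i / F" by (simp add: u_def F_def)
    ultimately have "\<bar>v * (x - c) ^ i / F\<bar> \<le> \<bar>v\<bar> / (2 * F) * \<bar>x - c\<bar> ^ i + \<bar>v\<bar> / (4 * F) * \<bar>x - c\<bar> ^ i"
      by linarith
    moreover have "\<bar>v * (x - c) ^ i / F\<bar> = \<bar>v\<bar> / F * \<bar>x - c\<bar> ^ i" using F by (simp add: abs_mult power_abs)
    moreover have "\<bar>v\<bar> / (2 * F) * \<bar>x - c\<bar> ^ i + \<bar>v\<bar> / (4 * F) * \<bar>x - c\<bar> ^ i = 3 / 4 * (\<bar>v\<bar> / F * \<bar>x - c\<bar> ^ i)"
      using F by (simp add: field_simps)
    moreover have "0 < \<bar>v\<bar> / F * \<bar>x - c\<bar> ^ i" using v0 F x(2) by (simp add: v_def)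
    ultimately show False by linarith
  qed
qed

lemma Cr_on_le: "Cr_on r I f D \<Longrightarrow> M \<le> r \<Longrightarrow> Cr_on M I f D"
  using Cr_on_continuous[of r I f D M] by (auto simp: Cr_on_def)

lemma contact_derivatives:
  assumes f: "Cr_on r {-1..1} f D" "M \<le> r" and g: "Cr_on q {-1..1} g E" "M \<le> q"
    and c: "c \<in> {-1..1}" and con: "contact f g c M {-1..1}" and i: "i \<le> M"
  shows "E i c = D i c"
proof -
  have f': "Cr_on M {-1..1} f D" and g': "Cr_on M {-1..1} g E"
    using Cr_on_le f g by blast+
  have "Cr_on M {-1..1} (\<lambda>x. D 0 x - E 0 x) (\<lambda>i x. D i x - E i x)"
    using f' g' unfolding Cr_on_def by (auto intro!: DERIV_diff continuous_intros)
  moreover have "contact (\<lambda>x. D 0 x - E 0 x) (\<lambda>_. 0) c M {-1..1}"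
    using con f' g' unfolding contact_def Cr_on_def by simp
  ultimately have "D i c - E i c = 0"
    using contact_zero_derivatives[of M "\<lambda>i x. D i x - E i x" c i] c i by simp
  then show ?thesis by simp
qed

section \<open>Splines as combinations of truncated powers\<close>

lemma tpow_eq_max: "1 \<le> m \<Longrightarrow> tpow t m x = (max 0 (x - t)) ^ m"
  by (auto simp: tpow_def max_def)

lemma continuous_on_tpow: "1 \<le> m \<Longrightarrow> continuous_on I (tpow t m)"
proof -
  assume "1 \<le> m"
  then have "tpow t m = (\<lambda>x. (max 0 (x - t)) ^ m)" by (auto simp: tpow_eq_max)
  then show ?thesis by (auto intro!: continuous_intros)
qed

lemma has_derivative_tpow:
  assumes "1 \<le> n"
  shows "(tpow t (Suc n) has_real_derivative real (Suc n) * tpow t n x) (at x)"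
proof -
  consider "x < t" | "t < x" | "x = t" by linarith
  then show ?thesis
  proof cases
    case 1
    have "((\<lambda>x. 0) has_real_derivative 0) (at x)" by simp
    then have "(tpow t (Suc n) has_real_derivative 0) (at x)"
      by (rule has_field_derivative_transform_within_open[where S = "{..<t}"]) (use 1 in \<open>auto simp: tpow_def\<close>)
    then show ?thesis using 1 by (simp add: tpow_def)
  next
    case 2
    have "((\<lambda>x. (x - t) ^ Suc n) has_real_derivative (1 + real n) * (1 * (x - t) ^ n)) (at x)"
      by (rule DERIV_power_Suc) (auto intro!: derivative_eq_intros)
    then have "(tpow t (Suc n) has_real_derivative (1 + real n) * (1 * (x - t) ^ n)) (at x)"
      by (rule has_field_derivative_transform_within_open[where S = "{t<..}"]) (use 2 in \<open>auto simp: tpow_def\<close>)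
    then show ?thesis using 2 by (simp add: tpow_def)
  next
    case 3
    have "((\<lambda>h. tpow 0 n h) \<longlongrightarrow> 0) (at 0)"
    proof -
      have "isCont (tpow 0 n) 0"
        using continuous_on_tpow[OF assms, of UNIV 0] by (simp add: continuous_on_eq_continuous_at)
      moreover have "tpow 0 n 0 = 0" using assms by (simp add: tpow_def)
      ultimately show ?thesis by (simp only: isCont_def)
    qed
    moreover have "eventually (\<lambda>h. tpow 0 n h = (tpow t (Suc n) (t + h) - tpow t (Suc n) t) / h) (at 0)"
      unfolding eventually_at_filter by (auto simp: tpow_def)
    ultimately have "((\<lambda>h. (tpow t (Suc n) (t + h) - tpow t (Suc n) t) / h) \<longlongrightarrow> 0) (at 0)"
      by (rule Lim_transform_eventually)
    moreover have "real (Suc n) * tpow t n t = 0" using assms by (simp add: tpow_def)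
    ultimately show ?thesis unfolding 3 DERIV_def by (simp only:)
  qed
qed

definition knot_spline :: "nat \<Rightarrow> (nat \<Rightarrow> real) \<Rightarrow> nat \<Rightarrow> real poly \<Rightarrow> (nat \<Rightarrow> real) \<Rightarrow> real \<Rightarrow> real" where
  "knot_spline m z n P c x = poly P x + (\<Sum>i\<le>n. c i * tpow (z i) m x)"

lemma Cr_on_knot_spline:
  assumes m: "1 \<le> m"
  shows "\<exists>E. Cr_on (m - 1) I (knot_spline m z n P c) E"
proof -
  \<comment> \<open>Derivatives are taken up to order m - 1, where the truncated powers have degree
    1 and are still continuous.\<close>
  define E where "E j x = poly ((pderiv ^^ j) P) x +
      (\<Sum>i\<le>n. c i * (fact m / fact (m - j) * tpow (z i) (m - j) x))" for j x
  have "(E j has_real_derivative E (Suc j) x) (at x within I)" if "j < m - 1" for j x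
  proof -
    have mj: "m - j = Suc (m - Suc j)" "1 \<le> m - Suc j" using that by auto
    have "((\<lambda>x. fact m / fact (m - j) * tpow (z i) (m - j) x) has_real_derivative
        fact m / fact (m - Suc j) * tpow (z i) (m - Suc j) x) (at x)" for i
    proof -
      have "fact m / fact (Suc (m - Suc j)) * (real (Suc (m - Suc j)) * y) = fact m / fact (m - Suc j) * y" for y :: real
        by (simp add: field_simps del: of_nat_Suc)
      then show ?thesis
        using DERIV_cmult[OF has_derivative_tpow[OF mj(2), of "z i" x], of "fact m / fact (m - j)"]
        unfolding mj(1) by (simp only:)
    qed
    then have "(E j has_real_derivative E (Suc j) x) (at x)"
      unfolding E_def[abs_def]
      by (intro DERIV_add DERIV_sum DERIV_cmult) (auto intro: poly_DERIV)
    then show ?thesis by (rule has_field_derivative_at_within)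
  qed
  moreover have "continuous_on I (E (m - 1))"
  proof -
    have "m - (m - 1) = 1" using m by simp
    then show ?thesis unfolding E_def[abs_def]
      by (simp only:) (intro continuous_intros continuous_on_tpow, simp)
  qed
  moreover have "E 0 x = knot_spline m z n P c x" for x
    by (simp add: E_def knot_spline_def)
  ultimately show ?thesis unfolding Cr_on_def by blast
qed

lemma Sigma_knot_spline:
  assumes m: "1 \<le> m" and P: "degree P \<le> m" and z: "knot_seq n z"
  shows "Sigma (Suc m) n z (knot_spline m z n P c)"
  unfolding Sigma_def
proof (intro conjI ballI)
  show "continuous_on {-1..1} (knot_spline m z n P c)"
    unfolding knot_spline_def[abs_def] by (intro continuous_intros continuous_on_tpow m)
next
  fix j assume j: "j \<in> {1..n}"
  have zm: "z b \<le> z a" if "a \<le> b" "b \<le> n" for a b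
    using that
  proof (induction b rule: dec_induct)
    case (step b)
    then have "z (Suc b) < z b" using z by (simp add: knot_seq_def)
    then show ?case using step by simp
  qed simp
  \<comment> \<open>Knots decrease with their index, so on the piece to the right of
    \<open>z j\<close> the truncated powers with index at least j are the active ones.\<close>
  define Q where "Q = P + (\<Sum>i\<in>{j..n}. smult (c i) ([:- z i, 1:] ^ m))"
  have "degree Q \<le> Suc m - 1"
    unfolding Q_def using P
    by (intro degree_add_le degree_sum_le order_trans[OF degree_smult_le] order_trans[OF degree_power_le]) auto
  moreover have "knot_spline m z n P c x = poly Q x" if x: "x \<in> {z j..z (j - 1)}" for x
  proof -
    have "(\<Sum>i\<le>n. c i * tpow (z i) m x) = (\<Sum>i\<in>{j..n}. c i * tpow (z i) m x)"
    proof (rule sum.mono_neutral_right)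
      show "\<forall>i\<in>{..n} - {j..n}. c i * tpow (z i) m x = 0"
      proof
        fix i assume "i \<in> {..n} - {j..n}"
        then have "z (j - 1) \<le> z i" using j by (intro zm) auto
        then show "c i * tpow (z i) m x = 0" using x m by (auto simp: tpow_def)
      qed
    qed auto
    also have "\<dots> = (\<Sum>i\<in>{j..n}. c i * (x - z i) ^ m)"
    proof (intro sum.cong refl)
      fix i assume "i \<in> {j..n}"
      then have "z i \<le> z j" using j by (intro zm) auto
      then show "c i * tpow (z i) m x = c i * (x - z i) ^ m" using x by (simp add: tpow_def)
    qed
    finally show ?thesis by (simp add: knot_spline_def Q_def poly_sum poly_power_linear)
  qed
  ultimately show "\<exists>Q. degree Q \<le> Suc m - 1 \<and> (\<forall>x\<in>{z j..z (j - 1)}. knot_spline m z n P c x = poly Q x)"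
    by blast
qed

text \<open>The quantification over \<open>lo\<close> and \<open>hi\<close> says that the spline lies in the convex hull of the values of those
polynomials whose pair of blocks contains \<open>x\<close>.\<close>

lemma spline_chain:
  fixes z :: "nat \<Rightarrow> real" and p :: "nat \<Rightarrow> real poly"
  assumes m: "1 \<le> m" and d: "d = 2 * m\<^sup>2" and z: "\<And>j. j < n \<Longrightarrow> z (Suc j) < z j"
    and p: "\<And>j. j \<le> N \<Longrightarrow> degree (p j) \<le> m" and N: "(N + 1) * d \<le> n"
  shows "\<exists>P c. degree P \<le> m \<and> (\<forall>x \<le> z ((N + 1) * d). knot_spline m z n P c x = poly (p N) x) \<and>
    (\<forall>x lo hi. z ((N + 1) * d) \<le> x \<longrightarrow> x \<le> z 0 \<longrightarrow>
      (\<forall>j\<le>N. x \<le> z (j * d) \<longrightarrow> z (min ((j + 2) * d) n) \<le> x \<longrightarrow> lo \<le> poly (p j) x \<and> poly (p j) x \<le> hi) \<longrightarrow>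
      lo \<le> knot_spline m z n P c x \<and> knot_spline m z n P c x \<le> hi)"
proof -
  have zm: "z b \<le> z a" if "a \<le> b" "b \<le> n" for a b
    using that
  proof (induction b rule: dec_induct)
    case (step b)
    then show ?case using z[of b] by simp
  qed simp
  show ?thesis
    using p N
  proof (induction N)
    case 0
    have S: "knot_spline m z n (p 0) (\<lambda>_. 0) x = poly (p 0) x" for x by (simp add: knot_spline_def)
    have "z (min ((0 + 2) * d) n) \<le> x" if "z ((0 + 1) * d) \<le> x" for x
    proof -
      have "z (min ((0 + 2) * d) n) \<le> z ((0 + 1) * d)" using 0 by (intro zm) auto
      then show ?thesis using that by simp
    qed
    then show ?case using 0 by (intro exI[of _ "p 0"] exI[of _ "\<lambda>_. 0"]) (auto simp: S)
  next
    case (Suc N)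
    define e where "e = (N + 1) * d"
    have ed: "e + d = (Suc N + 1) * d" by (simp add: e_def)
    have en: "e + d \<le> n" using Suc.prems(2) ed by simp
    have dp: "degree (p j) \<le> m" if "j \<le> Suc N" for j using Suc.prems(1) that by blast
    obtain P c where Pc: "degree P \<le> m" "\<And>x. x \<le> z e \<Longrightarrow> knot_spline m z n P c x = poly (p N) x"
      "\<And>x lo hi. z e \<le> x \<Longrightarrow> x \<le> z 0 \<Longrightarrow>
        (\<forall>j\<le>N. x \<le> z (j * d) \<longrightarrow> z (min ((j + 2) * d) n) \<le> x \<longrightarrow> lo \<le> poly (p j) x \<and> poly (p j) x \<le> hi) \<Longrightarrow>
        lo \<le> knot_spline m z n P c x \<and> knot_spline m z n P c x \<le> hi"
      using Suc.IH[unfolded e_def[symmetric]] dp en unfolding e_def by fastforce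
    define g where "g = p (Suc N) - p N"
    have dg: "degree g \<le> m" unfolding g_def using dp by (intro degree_diff_le) auto
    obtain b where b: "\<And>x. let T = (\<Sum>i\<in>{e..e + d}. b i * tpow (z i) m x) in
        (x \<le> z (e + d) \<longrightarrow> T = 0) \<and> (z e \<le> x \<longrightarrow> T = poly g x) \<and>
        min 0 (poly g x) \<le> T \<and> T \<le> max 0 (poly g x)"
      using blending_spline[OF m dg, of e z] z en unfolding d by force
    define T where "T x = (\<Sum>i\<in>{e..e + d}. b i * tpow (z i) m x)" for x
    have T: "x \<le> z (e + d) \<Longrightarrow> T x = 0" "z e \<le> x \<Longrightarrow> T x = poly g x"
      "min 0 (poly g x) \<le> T x" "T x \<le> max 0 (poly g x)" for x
      using b[of x] by (auto simp: T_def Let_def)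
    \<comment> \<open>The polynomial part receives g and T takes it back right of
      \<open>z e\<close>, so the spline built so far is unchanged there; left of
      \<open>z (e + d)\<close> it becomes the next polynomial.\<close>
    define c' where "c' i = c i - (if i \<in> {e..e + d} then b i else 0)" for i
    have S: "knot_spline m z n (P + g) c' x = knot_spline m z n P c x + poly g x - T x" for x
    proof -
      have "(\<Sum>i\<le>n. (if i \<in> {e..e + d} then b i else 0) * tpow (z i) m x) = T x"
        unfolding T_def using en by (intro sum.mono_neutral_cong_right) auto
      then show ?thesis by (simp add: knot_spline_def c'_def left_diff_distrib sum_subtractf)
    qed
    have "knot_spline m z n (P + g) c' x = poly (p (Suc N)) x" if "x \<le> z (e + d)" for x
    proof -
      have "x \<le> z e" using that zm[of e "e + d"] en by simp
      moreover have "poly g x = poly (p (Suc N)) x - poly (p N) x" by (simp add: g_def)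
      ultimately show ?thesis using T(1)[OF that] Pc(2)[of x] by (simp add: S)
    qed
    moreover have "lo \<le> knot_spline m z n (P + g) c' x \<and> knot_spline m z n (P + g) c' x \<le> hi"
      if x: "z (e + d) \<le> x" "x \<le> z 0"
        and H: "\<forall>j\<le>Suc N. x \<le> z (j * d) \<longrightarrow> z (min ((j + 2) * d) n) \<le> x \<longrightarrow> lo \<le> poly (p j) x \<and> poly (p j) x \<le> hi"
      for x lo hi
    proof (cases "z e \<le> x")
      case True
      then have "knot_spline m z n (P + g) c' x = knot_spline m z n P c x" using T(2) by (simp add: S)
      then show ?thesis using Pc(3)[OF True x(2), of lo hi] H by simp
    next
      case False
      then have xe: "x \<le> z e" by simp
      have "x \<le> z (N * d)" using xe zm[of "N * d" e] en by (simp add: e_def)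
      moreover have "z (min ((N + 2) * d) n) \<le> x"
        using x(1) en ed by (simp add: min_def)
      ultimately have 1: "lo \<le> poly (p N) x" "poly (p N) x \<le> hi" using H[rule_format, of N] by auto
      have "z (min ((Suc N + 2) * d) n) \<le> z (e + d)"
        using en ed by (intro zm) (auto simp: min_def)
      then have "z (min ((Suc N + 2) * d) n) \<le> x" using x(1) by linarith
      then have 2: "lo \<le> poly (p (Suc N)) x" "poly (p (Suc N)) x \<le> hi"
        using H[rule_format, of "Suc N"] xe by (auto simp: e_def)
      have "knot_spline m z n (P + g) c' x = poly (p N) x + poly g x - T x"
        using Pc(2)[OF xe] by (simp add: S)
      moreover have "poly g x = poly (p (Suc N)) x - poly (p N) x" by (simp add: g_def)
      ultimately show ?thesis using 1 2 T(3,4)[of x] by (auto simp: min_def max_def split: if_splits)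
    qed
    moreover have "degree (P + g) \<le> m" using Pc(1) dg by (rule degree_add_le)
    ultimately show ?case unfolding ed[symmetric] by (intro exI[of _ "P + g"] exI[of _ c']) blast
  qed
qed

section \<open>Knots between the points \<open>beta\<close>\<close>

lemma beta_range:
  assumes B: "finite B" "b \<in> B"
  shows "\<exists>j\<in>{1..card B}. beta B j = b"
proof -
  let ?L = "rev (sorted_list_of_set B)"
  have "b \<in> set ?L" using B by simp
  then obtain i where i: "i < length ?L" "?L ! i = b" unfolding in_set_conv_nth by blast
  then have "i < card B" by simp
  then show ?thesis using i(2) by (intro bexI[of _ "Suc i"]) (auto simp: beta_def)
qed

lemma beta_mem:
  assumes B: "finite B" "1 \<le> j" "j \<le> card B"
  shows "beta B j \<in> B"
proof -
  have "rev (sorted_list_of_set B) ! (j - 1) \<in> set (rev (sorted_list_of_set B))"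
    using assms by (intro nth_mem) simp
  then show ?thesis using assms by (simp add: beta_def)
qed

lemma beta_antitone:
  assumes B: "finite B" "B \<subseteq> {-1..1}" and j: "1 \<le> j" "j \<le> card B + 1"
  shows "beta B j \<le> beta B (j - 1)"
proof -
  consider "j = card B + 1" "card B = 0" | "j = card B + 1" "1 \<le> card B" | "j = 1" "1 \<le> card B" | "2 \<le> j" "j \<le> card B"
    using j by linarith
  then show ?thesis
  proof cases
    case 1 then show ?thesis by (simp add: beta_def)
  next
    case 2
    then have "beta B (card B) \<in> {-1..1}" using beta_mem[of B "card B"] B by auto
    moreover have "beta B j = -1" "j - 1 = card B" using 2 by (simp_all add: beta_def)
    ultimately show ?thesis by simp
  next
    case 3
    then have "beta B 1 \<in> {-1..1}" using beta_mem[of B 1] B by auto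
    then show ?thesis using 3 by (simp add: beta_def[of B 0])
  next
    case 4
    let ?L = "rev (sorted_list_of_set B)"
    have "sorted (rev ?L)" by simp
    then have "?L ! (j - 1) \<le> ?L ! (j - 1 - 1)"
      using 4 by (intro sorted_rev_nth_mono) auto
    moreover have "\<not> card B < j - 1" "\<not> card B < j" "j - 1 \<noteq> 0" "j \<noteq> 0" using 4 by auto
    ultimately show ?thesis by (simp add: beta_def)
  qed
qed

text \<open>An end that lies in \<open>B\<close> occurs twice in the sequence, so some of its
  intervals can be empty. Two different points are still separated by a nonempty one, which already
  supplies K knots.\<close>

lemma beta_gap:
  fixes B :: "real set"
  assumes B: "finite B" "B \<subseteq> {-1..1}"
    and K: "\<And>j. j \<in> {1..card B + 1} \<Longrightarrow> beta B j < beta B (j - 1) \<Longrightarrow>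
      K \<le> card {i. i \<le> n \<and> beta B j < z i \<and> z i < beta B (j - 1)}"
    and c: "c \<in> insert (-1) (insert 1 B)" "c' \<in> insert (-1) (insert 1 B)" "c < c'"
  shows "K \<le> card {i::nat. i \<le> n \<and> c < (z i :: real) \<and> z i < c'}"
proof -
  have mono: "beta B b \<le> beta B a" if "a \<le> b" "b \<le> card B + 1" for a b
    using that
  proof (induction b rule: dec_induct)
    case (step b)
    then show ?case using beta_antitone[OF B, of "Suc b"] by simp
  qed simp
  have ex: "\<exists>j\<le>card B + 1. beta B j = x" if x: "x \<in> insert (-1) (insert 1 B)" for x
  proof -
    consider "x = -1" | "x = 1" | "x \<in> B" using x by blast
    then show ?thesis
    proof cases
      case 1 then show ?thesis by (intro exI[of _ "card B + 1"]) (simp add: beta_def)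
    next
      case 2 then show ?thesis by (intro exI[of _ 0]) (simp add: beta_def)
    next
      case 3
      then obtain j where "j \<in> {1..card B}" "beta B j = x" using beta_range[OF B(1)] by blast
      then show ?thesis by (intro exI[of _ j]) simp
    qed
  qed
  obtain j j' where j: "j \<le> card B + 1" "beta B j = c" and j': "j' \<le> card B + 1" "beta B j' = c'"
    using ex c by meson
  have jj: "j' < j" using mono[of j j'] j j' c(3) by force
  have "\<exists>i. j' < i \<and> i \<le> j \<and> beta B i < beta B (i - 1)"
  proof (rule ccontr)
    assume no: "\<not> ?thesis"
    have "beta B i = beta B j'" if "j' \<le> i" "i \<le> j" for i
      using that
    proof (induction i rule: dec_induct)
      case (step i)
      have "beta B (Suc i) \<le> beta B i" using mono[of i "Suc i"] step j by simp
      moreover have "\<not> beta B (Suc i) < beta B (Suc i - 1)" using no step by (metis less_Suc_eq_le)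
      ultimately show ?case using step by simp
    qed simp
    then have "c = c'" using jj j j' by (metis less_imp_le order_refl)
    then show False using c(3) by simp
  qed
  then obtain i where i: "j' < i" "i \<le> j" "beta B i < beta B (i - 1)" by blast
  have "K \<le> card {q. q \<le> n \<and> beta B i < z q \<and> z q < beta B (i - 1)}"
    using i j by (intro K) auto
  also have "\<dots> \<le> card {q. q \<le> n \<and> c < z q \<and> z q < c'}"
  proof (rule card_mono)
    have "c \<le> beta B i" "beta B (i - 1) \<le> c'" using mono[of i j] mono[of j' "i - 1"] i j j' by auto
    then show "{q. q \<le> n \<and> beta B i < z q \<and> z q < beta B (i - 1)} \<subseteq> {q. q \<le> n \<and> c < z q \<and> z q < c'}"
      by auto
  qed simp
  finally show ?thesis .
qed

text \<open>2 R + 1 knot intervals centred at a given one, each at most max(1, rho)^R times as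
  long.\<close>

definition growth :: "nat \<Rightarrow> real \<Rightarrow> real" where
  "growth R q = real (2 * R + 1) * max 1 q ^ R"

lemma growth_nonneg: "0 \<le> growth R q"
  by (simp add: growth_def)

section \<open>Knot sequences and the mesh ratio\<close>

locale knots =
  fixes n :: nat and z :: "nat \<Rightarrow> real"
  assumes knots: "knot_seq n z"
begin

lemma z_less: "a < b \<Longrightarrow> b \<le> n \<Longrightarrow> z b < z a"
proof (induction b)
  case (Suc b)
  have "z (Suc b) < z b" using knots Suc by (simp add: knot_seq_def)
  then show ?case using Suc by (cases "a = b") auto
qed simp

lemma z_le: "a \<le> b \<Longrightarrow> b \<le> n \<Longrightarrow> z b \<le> z a"
  using z_less[of a b] by (cases "a = b") auto

lemma z_less_iff: "a \<le> n \<Longrightarrow> b \<le> n \<Longrightarrow> z b < z a \<longleftrightarrow> a < b"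
  using z_less z_le by (meson not_le)

lemma z_le_iff: "a \<le> n \<Longrightarrow> b \<le> n \<Longrightarrow> z b \<le> z a \<longleftrightarrow> a \<le> b"
  using z_less z_le by (meson not_le)

lemma z0: "z 0 = 1" and zn: "z n = -1"
  using knots by (simp_all add: knot_seq_def)

lemma z_bounds: "i \<le> n \<Longrightarrow> -1 \<le> z i \<and> z i \<le> 1"
  using z_le[of 0 i] z_le[of i n] z0 zn by simp

lemma n_pos: "1 \<le> n"
  using z0 zn by (cases n) auto

lemma zext_nat: "i \<le> n \<Longrightarrow> zext n z (int i) = z i"
  by (simp add: zext_def)

lemma zext_antitone: "i \<le> j \<Longrightarrow> zext n z j \<le> zext n z i"
  using z_le[of "nat i" "nat j"] z_bounds[of "nat i"] z_bounds[of "nat j"]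
  by (auto simp: zext_def nat_le_eq_zle)

lemma zext_bounds: "-1 \<le> zext n z i \<and> zext n z i \<le> 1"
  using z_bounds[of "nat i"] by (auto simp: zext_def)

lemma Jlen_nonneg: "0 \<le> Jlen n z i"
  using zext_antitone[of "i - 1" i] by (simp add: Jlen_def)

lemma Jlen_pos: "1 \<le> i \<Longrightarrow> i \<le> int n \<Longrightarrow> 0 < Jlen n z i"
  using z_less[of "nat (i - 1)" "nat i"] by (simp add: Jlen_def zext_def)

lemma Jlen_ratio:
  assumes "1 \<le> i" "i \<le> int n"
  shows "Jlen n z (i - 1) \<le> rho n z * Jlen n z i" "Jlen n z (i + 1) \<le> rho n z * Jlen n z i"
proof -
  let ?R = "{Jlen n z (i - 1) / Jlen n z i | i. 1 \<le> i \<and> i \<le> int n}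
     \<union> {Jlen n z (i + 1) / Jlen n z i | i. 1 \<le> i \<and> i \<le> int n}"
  have "?R = (\<lambda>i. Jlen n z (i - 1) / Jlen n z i) ` {1..int n} \<union> (\<lambda>i. Jlen n z (i + 1) / Jlen n z i) ` {1..int n}"
    by auto
  then have fin: "finite ?R" by simp
  have "Jlen n z (i - 1) / Jlen n z i \<in> ?R" "Jlen n z (i + 1) / Jlen n z i \<in> ?R" using assms by auto
  then have "Jlen n z (i - 1) / Jlen n z i \<le> rho n z" "Jlen n z (i + 1) / Jlen n z i \<le> rho n z"
    unfolding rho_def using fin by (auto intro: Max_ge)
  then show "Jlen n z (i - 1) \<le> rho n z * Jlen n z i" "Jlen n z (i + 1) \<le> rho n z * Jlen n z i"
    using Jlen_pos[OF assms] by (simp_all add: pos_divide_le_eq)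
qed

lemma Jlen_far:
  assumes i: "1 \<le> i" "i \<le> int n"
  shows "Jlen n z (i + int t) \<le> max 1 (rho n z) ^ t * Jlen n z i"
    "Jlen n z (i - int t) \<le> max 1 (rho n z) ^ t * Jlen n z i"
proof -
  let ?q = "max 1 (rho n z)"
  \<comment> \<open>The ratio bound stops at the first and last knot interval; beyond them the
    intervals are degenerate.\<close>
  have outside: "Jlen n z j = 0" if "j < 1 \<or> int n < j" for j
  proof -
    have "j < 1 \<or> j - 1 = int n \<or> int n < j - 1" using that by presburger
    then show ?thesis using z0 zn by (elim disjE) (auto simp: Jlen_def zext_def)
  qed
  have step: "Jlen n z (j + 1) \<le> ?q * Jlen n z j" "Jlen n z (j - 1) \<le> ?q * Jlen n z j" if "1 \<le> j \<and> j \<le> int n" for j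
    using Jlen_ratio[of j] Jlen_nonneg[of j] that
    by (meson max.cobounded2 mult_right_mono order_trans)+
  have rhs: "0 \<le> ?q ^ t * Jlen n z i" for t using Jlen_nonneg by simp
  show "Jlen n z (i + int t) \<le> ?q ^ t * Jlen n z i"
  proof (induction t)
    case (Suc t)
    show ?case
    proof (cases "i + int t \<le> int n")
      case True
      have "Jlen n z (i + int (Suc t)) \<le> ?q * Jlen n z (i + int t)"
        using step(1)[of "i + int t"] i True by (simp add: add.commute add.left_commute)
      also have "\<dots> \<le> ?q * (?q ^ t * Jlen n z i)" using Suc by (intro mult_left_mono) auto
      finally show ?thesis by simp
    next
      case False
      then show ?thesis using outside[of "i + int (Suc t)"] rhs[of "Suc t"] by simp
    qed
  qed simp
  show "Jlen n z (i - int t) \<le> ?q ^ t * Jlen n z i"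
  proof (induction t)
    case (Suc t)
    show ?case
    proof (cases "1 \<le> i - int t")
      case True
      have "Jlen n z (i - int (Suc t)) \<le> ?q * Jlen n z (i - int t)"
        using step(2)[of "i - int t"] i True by (simp add: algebra_simps)
      also have "\<dots> \<le> ?q * (?q ^ t * Jlen n z i)" using Suc by (intro mult_left_mono) auto
      finally show ?thesis by simp
    next
      case False
      then show ?thesis using outside[of "i - int (Suc t)"] rhs[of "Suc t"] by simp
    qed
  qed simp
qed

lemma hull_length:
  assumes i: "1 \<le> i" "i \<le> int n"
  shows "zext n z (i - int R) - zext n z (i + int R) \<le> growth R (rho n z) * Jlen n z i"
proof -
  let ?q = "max 1 (rho n z)"
  have q: "1 \<le> ?q" by simp
  show ?thesis
  proof (induction R)
    case 0
    then show ?case using Jlen_nonneg[of i] by (simp add: growth_def)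
  next
    case (Suc R)
    let ?J = "Jlen n z i"
    have J: "0 \<le> ?J" by (rule Jlen_nonneg)
    have "zext n z (i - int (Suc R)) - zext n z (i + int (Suc R))
        = (zext n z (i - int R) - zext n z (i + int R)) + Jlen n z (i - int R) + Jlen n z (i + int (Suc R))"
      by (simp add: Jlen_def algebra_simps)
    also have "\<dots> \<le> growth R (rho n z) * ?J + ?q ^ R * ?J + ?q ^ Suc R * ?J"
      using Suc Jlen_far[OF i, of R] Jlen_far[OF i, of "Suc R"] by (intro add_mono)
    also have "\<dots> \<le> real (2 * R + 1) * (?q ^ Suc R * ?J) + ?q ^ Suc R * ?J + ?q ^ Suc R * ?J"
    proof -
      have "?q ^ R * ?J \<le> ?q ^ Suc R * ?J" using q J by (intro mult_right_mono power_increasing) auto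
      moreover from this have "real (2 * R + 1) * (?q ^ R * ?J) \<le> real (2 * R + 1) * (?q ^ Suc R * ?J)"
        by (rule mult_left_mono) simp
      ultimately show ?thesis unfolding growth_def mult.assoc by linarith
    qed
    also have "\<dots> = growth (Suc R) (rho n z) * ?J" by (simp add: growth_def algebra_simps)
    finally show ?case .
  qed
qed

end

section \<open>Local pieces on pairs of blocks\<close>

locale copositive_problem = knots +
  fixes k r :: nat and m1 m2 m3 :: int and p s :: nat and y \<alpha> :: "nat \<Rightarrow> real"
    and f :: "real \<Rightarrow> real" and D :: "nat \<Rightarrow> real \<Rightarrow> real"
  assumes adm: "(r, k, m1, m2, m3) \<in> admissible"
    and y_bounds: "\<And>i. i \<in> {1..s} \<Longrightarrow> -1 < y i \<and> y i < 1"
    and y_step: "\<And>i. 1 \<le> i \<Longrightarrow> i < s \<Longrightarrow> y (Suc i) < y i"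
    and \<alpha>_bounds: "\<And>i. i \<in> {1..p} \<Longrightarrow> -1 \<le> \<alpha> i \<and> \<alpha> i \<le> 1"
    and \<alpha>_step: "\<And>i. 1 \<le> i \<Longrightarrow> i < p \<Longrightarrow> \<alpha> (Suc i) < \<alpha> i"
    and disjoint: "y ` {1..s} \<inter> \<alpha> ` {1..p} = {}"
    and f_smooth: "Cr_on r {-1..1} f D"
    and f_sign: "Delta0 s y f"
    and many_knots: "\<And>j. j \<in> {1..s + p + 1} \<Longrightarrow>
      beta (y ` {1..s} \<union> \<alpha> ` {1..p}) j < beta (y ` {1..s} \<union> \<alpha> ` {1..p}) (j - 1) \<Longrightarrow>
      4 * (k + r - 1)^2 \<le> card {i. i \<le> n \<and> beta (y ` {1..s} \<union> \<alpha> ` {1..p}) j < z i \<and>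
                     z i < beta (y ` {1..s} \<union> \<alpha> ` {1..p}) (j - 1)}"
begin

definition m :: nat where "m = k + r - 1"
definition d :: nat where "d = 2 * m^2"
definition special :: "real set" where
  "special = insert (-1) (insert 1 (y ` {1..s} \<union> \<alpha> ` {1..p}))"

lemma k_pos: "1 \<le> k" and m_pos: "1 \<le> m"
  using admissible_pos[OF adm] by (auto simp: m_def)

lemma d_ge: "2 \<le> d"
proof -
  have "1 \<le> m^2" using m_pos by simp
  then show ?thesis by (simp add: d_def)
qed

lemma y_less: "1 \<le> i \<Longrightarrow> i < j \<Longrightarrow> j \<le> s \<Longrightarrow> y j < y i"
proof (induction j)
  case (Suc j)
  have "y (Suc j) < y j" if "i \<noteq> j \<or> i = j" using Suc y_step[of j] by simp
  then show ?case using Suc by (cases "i = j") auto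
qed simp

lemma \<alpha>_less: "1 \<le> i \<Longrightarrow> i < j \<Longrightarrow> j \<le> p \<Longrightarrow> \<alpha> j < \<alpha> i"
proof (induction j)
  case (Suc j)
  have "\<alpha> (Suc j) < \<alpha> j" using Suc \<alpha>_step[of j] by simp
  then show ?case using Suc by (cases "i = j") auto
qed simp

lemma card_points: "card (y ` {1..s} \<union> \<alpha> ` {1..p}) = s + p"
proof -
  have "inj_on y {1..s}"
  proof (rule linorder_inj_onI)
    fix i j assume "i < j" "i \<in> {1..s}" "j \<in> {1..s}"
    then show "y i \<noteq> y j" using y_less[of i j] by simp
  qed auto
  moreover have "inj_on \<alpha> {1..p}"
  proof (rule linorder_inj_onI)
    fix i j assume "i < j" "i \<in> {1..p}" "j \<in> {1..p}"
    then show "\<alpha> i \<noteq> \<alpha> j" using \<alpha>_less[of i j] by simp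
  qed auto
  ultimately show ?thesis using disjoint by (simp add: card_Un_disjoint card_image)
qed

lemma special_gap:
  assumes "c \<in> special" "c' \<in> special" "c < c'"
  shows "2 * d \<le> card {i. i \<le> n \<and> c < z i \<and> z i < c'}"
proof -
  let ?B = "y ` {1..s} \<union> \<alpha> ` {1..p}"
  have "4 * (k + r - 1)^2 \<le> card {i. i \<le> n \<and> c < z i \<and> z i < c'}"
  proof (rule beta_gap)
    show "?B \<subseteq> {-1..1}"
      using y_bounds \<alpha>_bounds by (auto simp: less_imp_le)
    show "c \<in> insert (-1) (insert 1 ?B)" "c' \<in> insert (-1) (insert 1 ?B)"
      using assms by (simp_all only: special_def)
    show "4 * (k + r - 1)^2 \<le> card {i. i \<le> n \<and> beta ?B j < z i \<and> z i < beta ?B (j - 1)}"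
      if "j \<in> {1..card ?B + 1}" "beta ?B j < beta ?B (j - 1)" for j
      using many_knots[OF _ that(2)] that(1) unfolding card_points by blast
  qed (use assms in auto)
  then show ?thesis by (simp add: d_def m_def)
qed

lemma special_bounds: "c \<in> special \<Longrightarrow> -1 \<le> c \<and> c \<le> 1"
  using y_bounds \<alpha>_bounds by (fastforce simp: special_def)

text \<open>At least 2 d knots lie strictly between two special points, whereas a closed pair of
  blocks has at most 2 d - 1 knots in its interior. This is where the number 4 (k + r - 1)^2 of
  knots comes from.\<close>

lemma special_unique:
  assumes "c \<in> special" "c' \<in> special" "c \<in> {z v..z u}" "c' \<in> {z v..z u}" "u \<le> v" "v \<le> n" "v - u \<le> 2 * d"
  shows "c = c'"
proof -
  have *: False if c: "c \<in> special" "c' \<in> special" "c \<in> {z v..z u}" "c' \<in> {z v..z u}" "c < c'" for c c'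
  proof -
    have "{i. i \<le> n \<and> c < z i \<and> z i < c'} \<subseteq> {u<..<v}"
    proof
      fix i assume i: "i \<in> {i. i \<le> n \<and> c < z i \<and> z i < c'}"
      then have "z i < z u" "z v < z i" using c by auto
      then show "i \<in> {u<..<v}" using z_less_iff[of u i] z_less_iff[of i v] i assms(5,6) by auto
    qed
    then have "card {i. i \<le> n \<and> c < z i \<and> z i < c'} \<le> card {u<..<v}" by (intro card_mono) auto
    then have "2 * d \<le> v - u - 1" using special_gap[OF c(1,2,5)] by simp
    then show False using assms(7) d_ge by linarith
  qed
  show ?thesis using *[of c c'] *[of c' c] assms(1-4) by (meson linorder_cases)
qed

lemma yext_interval_unique:
  assumes x: "x \<notin> y ` {1..s}" and i: "i \<le> s" "x \<in> {yext s y (Suc i)..yext s y i}"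
    and j: "j \<le> s" "x \<in> {yext s y (Suc j)..yext s y j}"
  shows "i = j"
proof -
  have *: "x \<in> y ` {1..s}" if "i < j" "j \<le> s" "x \<in> {yext s y (Suc i)..yext s y i}" "x \<in> {yext s y (Suc j)..yext s y j}" for i j
  proof -
    have "yext s y j \<le> yext s y (Suc i)"
      using that y_less[of "Suc i" j] by (cases "Suc i = j") (auto simp: yext_def)
    moreover have "yext s y (Suc i) \<le> x" "x \<le> yext s y j" using that by auto
    ultimately have "x = yext s y (Suc i)" by linarith
    moreover have "yext s y (Suc i) = y (Suc i)" using that by (simp add: yext_def)
    ultimately show ?thesis using that by auto
  qed
  show ?thesis using *[of i j] *[of j i] assms by (meson linorder_neqE_nat)
qed

lemma yext_interval_exists:
  assumes ab: "a < b" "-1 \<le> a" "b \<le> 1" and no: "y ` {1..s} \<inter> {a<..<b} = {}"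
  shows "\<exists>i\<le>s. {a..b} \<subseteq> {yext s y (Suc i)..yext s y i}"
proof -
  define Q where "Q = {q. q \<le> s \<and> b \<le> yext s y q}"
  have Q: "finite Q" "0 \<in> Q" using ab by (auto simp: Q_def yext_def)
  define i where "i = Max Q"
  have i: "i \<in> Q" unfolding i_def using Q by (intro Max_in) auto
  have "yext s y (Suc i) \<le> a"
  proof (cases "i = s")
    case True
    then show ?thesis using ab by (simp add: yext_def)
  next
    case False
    then have si: "Suc i \<in> {1..s}" using i by (auto simp: Q_def)
    have "Suc i \<notin> Q"
    proof
      assume "Suc i \<in> Q"
      then have "Suc i \<le> i" unfolding i_def by (rule Max_ge[OF Q(1)])
      then show False by simp
    qed
    then have "yext s y (Suc i) < b" using si by (auto simp: Q_def)
    moreover have "yext s y (Suc i) = y (Suc i)" using si by (simp add: yext_def)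
    ultimately show ?thesis using no si by fastforce
  qed
  then show ?thesis using i by (intro exI[of _ i]) (auto simp: Q_def)
qed

text \<open>At a sign change two intervals meet, and the two conditions together force q to vanish
  there.\<close>

definition sign_ok :: "real poly \<Rightarrow> real \<Rightarrow> bool" where
  "sign_ok q x \<longleftrightarrow> (\<forall>i\<le>s. x \<in> {yext s y (Suc i)..yext s y i} \<longrightarrow> 0 \<le> (-1) ^ i * poly q x)"

text \<open>An end takes m3 even if it belongs to \<alpha>; \<open>admissible_orders\<close>
  provides m1 <= m3.\<close>

definition contact_order :: "real \<Rightarrow> int" where
  "contact_order c = (if c \<in> {-1, 1} then m3 else if c \<in> y ` {1..s} then m2 else m1)"

text \<open>A window reaches from index v + 2 to u - 1 with v - u <= 2 d, so 2 d + 3 index steps in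
  both directions from the interval i or i + 2 near c cover it.\<close>

definition ratio_bound :: real where "ratio_bound = growth (2 * d + 3) (rho n z)"

definition window_bound :: real where "window_bound = local_const k ratio_bound"

text \<open>\<open>q\<close> serves the pair of blocks between the knots \<open>z v\<close> and \<open>z u\<close>. The interval \<open>[a, b]\<close> may reach slightly beyond
it, so that a special point is never close to the boundary of the interval on which \<open>f\<close> is approximated.\<close>

definition good_piece :: "nat \<Rightarrow> nat \<Rightarrow> real poly \<Rightarrow> bool" where
  "good_piece u v q \<longleftrightarrow> degree q \<le> m \<and> (\<forall>x\<in>{z v..z u}. sign_ok q x) \<and>
     (\<forall>c\<in>special \<inter> {z v..z u}. \<forall>M. int M = contact_order c \<longrightarrow> contact f (poly q) c M {z v..z u}) \<and>
     (\<exists>a b. a < b \<and> {z v..z u} \<subseteq> {a..b} \<and>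
        {a..b} \<subseteq> {zext n z (int v + 2)..zext n z (int u - 1)} \<and>
        (\<forall>x\<in>{a..b}. \<bar>f x - poly q x\<bar> \<le> window_bound * ((b - a) ^ r * modsm k (D r) (b - a) {a..b})))"

lemma f_D: "x \<in> {-1..1} \<Longrightarrow> D 0 x = f x"
  using f_smooth by (simp add: Cr_on_def)

lemma smooth_sub: "{a..b} \<subseteq> {-1..1} \<Longrightarrow> Cr_on r {a..b} (D 0) D"
  using Cr_on_subset[OF f_smooth] .

lemma smooth_sub_scaled: "{a..b} \<subseteq> {-1..1} \<Longrightarrow> Cr_on r {a..b} (\<lambda>x. \<sigma> * D 0 x) (\<lambda>i x. \<sigma> * D i x)"
  using Cr_on_cmult[OF smooth_sub] .

lemma contact_f:
  assumes "contact (D 0) g c M {a..b}" "{a'..b'} \<subseteq> {a..b}" "{a..b} \<subseteq> {-1..1}"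
  shows "contact f g c M {a'..b'}"
  using assms f_D unfolding contact_def by (metis subsetD)

lemma f_sign_on: "i \<le> s \<Longrightarrow> x \<in> {yext s y (Suc i)..yext s y i} \<Longrightarrow> 0 \<le> (-1) ^ i * f x"
  using f_sign by (simp add: Delta0_def)

lemma good_pieceI:
  assumes uv: "u < v" "v \<le> n" and ab: "{z v..z u} \<subseteq> {a..b}" "zext n z (int v + 2) \<le> a" "b \<le> zext n z (int u - 1)"
    and app: "approximates k r window_bound D a b q"
    and sgn: "\<And>x. x \<in> {z v..z u} \<Longrightarrow> sign_ok q x"
    and con: "\<And>c M. c \<in> special \<Longrightarrow> c \<in> {z v..z u} \<Longrightarrow> int M = contact_order c \<Longrightarrow> contact (D 0) (poly q) c M {a..b}"
  shows "good_piece u v q"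
proof -
  have "z v < z u" using uv by (intro z_less)
  then have "a < b" using ab(1) by auto
  have "{a..b} \<subseteq> {-1..1}" using ab(2,3) zext_bounds by (auto intro: order_trans)
  then have "\<bar>f x - poly q x\<bar> \<le> window_bound * ((b - a) ^ r * modsm k (D r) (b - a) {a..b})" if "x \<in> {a..b}" for x
    using app f_D that unfolding approximates_def by (metis subsetD)
  moreover have "contact f (poly q) c M {z v..z u}"
    if "c \<in> special" "c \<in> {z v..z u}" "int M = contact_order c" for c M
    using contact_f[OF con[OF that] ab(1)] \<open>{a..b} \<subseteq> {-1..1}\<close> .
  ultimately show ?thesis using app sgn ab \<open>a < b\<close> unfolding good_piece_def approximates_def m_def
    by (intro conjI ballI exI[of _ a] exI[of _ b]) auto
qed

lemma sign_on_interval: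
  assumes ab: "a < b" "-1 \<le> a" "b \<le> 1" and no: "y ` {1..s} \<inter> {a<..<b} = {}"
  obtains \<sigma> where "\<bar>\<sigma>\<bar> = 1" "\<And>x. x \<in> {a..b} \<Longrightarrow> 0 \<le> \<sigma> * D 0 x"
    "\<And>x q. x \<in> {a..b} \<Longrightarrow> x \<notin> y ` {1..s} \<Longrightarrow> 0 \<le> \<sigma> * poly q x \<Longrightarrow> sign_ok q x"
proof -
  obtain i where i: "i \<le> s" "{a..b} \<subseteq> {yext s y (Suc i)..yext s y i}"
    using yext_interval_exists[OF assms] by blast
  show ?thesis
  proof (rule that[of "(-1) ^ i"])
    show "\<bar>(- 1) ^ i\<bar> = (1::real)" by (simp add: power_abs)
    show "0 \<le> (- 1) ^ i * D 0 x" if "x \<in> {a..b}" for x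
    proof -
      have "x \<in> {-1..1}" using that ab by auto
      then show ?thesis using f_sign_on[OF i(1), of x] i(2) that f_D by auto
    qed
    show "sign_ok q x" if x: "x \<in> {a..b}" "x \<notin> y ` {1..s}" "0 \<le> (- 1) ^ i * poly q x" for x q
      unfolding sign_ok_def
    proof (intro allI impI)
      fix j assume j: "j \<le> s" "x \<in> {yext s y (Suc j)..yext s y j}"
      have "j = i" using yext_interval_unique[OF x(2) j i(1)] i(2) x(1) by blast
      then show "0 \<le> (- 1) ^ j * poly q x" using x(3) by simp
    qed
  qed
qed

text \<open>\<open>loc\<close> speaks of an arbitrary nonnegative G because it is applied to f
  multiplied by its constant sign on the window.\<close>

lemma piece_one_sign:
  assumes uv: "u < v" "v \<le> n"
    and ab: "{z v..z u} \<subseteq> {a..b}" "zext n z (int v + 2) \<le> a" "b \<le> zext n z (int u - 1)"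
    and no: "y ` {1..s} \<inter> {a<..<b} = {}" "y ` {1..s} \<inter> {z v..z u} = {}"
    and loc: "\<And>G. Cr_on r {a..b} (G 0) G \<Longrightarrow> (\<And>x. x \<in> {a..b} \<Longrightarrow> 0 \<le> G 0 x) \<Longrightarrow>
      \<exists>q. approximates k r window_bound G a b q \<and> (\<forall>x\<in>{a..b}. 0 \<le> poly q x) \<and>
        (\<forall>c\<in>special \<inter> {z v..z u}. \<forall>M. int M = contact_order c \<longrightarrow> contact (G 0) (poly q) c M {a..b})"
  shows "\<exists>q. good_piece u v q"
proof -
  have "z v < z u" using uv by (intro z_less)
  then have bounds: "a < b" "-1 \<le> a" "b \<le> 1" using ab zext_bounds by (auto intro: order_trans)
  then have sub: "{a..b} \<subseteq> {-1..1}" by auto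
  obtain \<sigma> where \<sigma>: "\<bar>\<sigma>\<bar> = 1" "\<And>x. x \<in> {a..b} \<Longrightarrow> 0 \<le> \<sigma> * D 0 x"
    "\<And>x q. x \<in> {a..b} \<Longrightarrow> x \<notin> y ` {1..s} \<Longrightarrow> 0 \<le> \<sigma> * poly q x \<Longrightarrow> sign_ok q x"
    using sign_on_interval[OF bounds no(1)] by blast
  obtain q where q: "approximates k r window_bound (\<lambda>i x. \<sigma> * D i x) a b q" "\<And>x. x \<in> {a..b} \<Longrightarrow> 0 \<le> poly q x"
    "\<And>c M. c \<in> special \<Longrightarrow> c \<in> {z v..z u} \<Longrightarrow> int M = contact_order c \<Longrightarrow> contact (\<lambda>x. \<sigma> * D 0 x) (poly q) c M {a..b}"
    using loc[OF smooth_sub_scaled[OF sub] \<sigma>(2)] by blast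
  have "good_piece u v (smult \<sigma> q)"
  proof (rule good_pieceI[OF uv ab approximates_sign[OF q(1) \<sigma>(1)]])
    show "sign_ok (smult \<sigma> q) x" if x: "x \<in> {z v..z u}" for x
    proof (rule \<sigma>(3))
      show xab: "x \<in> {a..b}" and "x \<notin> y ` {1..s}" using x ab(1) no(2) by blast+
      show "0 \<le> \<sigma> * poly (smult \<sigma> q) x" using q(2)[OF xab] by (simp add: sign_cancel[OF \<sigma>(1)])
    qed
  qed (use contact_sign[OF q(3) \<sigma>(1)] in blast)
  then show ?thesis by blast
qed

lemma piece_unextended:
  assumes uv: "u < v" "v \<le> n" and no: "y ` {1..s} \<inter> {z v..z u} = {}"
    and loc: "\<And>G. Cr_on r {z v..z u} (G 0) G \<Longrightarrow> (\<And>x. x \<in> {z v..z u} \<Longrightarrow> 0 \<le> G 0 x) \<Longrightarrow>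
      \<exists>q. approximates k r window_bound G (z v) (z u) q \<and> (\<forall>x\<in>{z v..z u}. 0 \<le> poly q x) \<and>
        (\<forall>c\<in>special \<inter> {z v..z u}. \<forall>M. int M = contact_order c \<longrightarrow> contact (G 0) (poly q) c M {z v..z u})"
  shows "\<exists>q. good_piece u v q"
proof (rule piece_one_sign[OF uv subset_refl _ _ _ no loc])
  show "zext n z (int v + 2) \<le> z v" using zext_antitone[of "int v" "int v + 2"] zext_nat[of v] uv by simp
  show "z u \<le> zext n z (int u - 1)" using zext_antitone[of "int u - 1" "int u"] zext_nat[of u] uv by simp
  show "y ` {1..s} \<inter> {z v<..<z u} = {}"
    using no greaterThanLessThan_subseteq_atLeastAtMost_iff[of "z v" "z u" "z v" "z u"] by blast
qed

lemma ratio_bound_nonneg: "0 \<le> ratio_bound"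
  unfolding ratio_bound_def by (rule growth_nonneg)

lemma piece_free:
  assumes uv: "u < v" "v \<le> n" and none: "special \<inter> {z v..z u} = {}"
  shows "\<exists>q. good_piece u v q"
proof (rule piece_unextended[OF uv])
  show "y ` {1..s} \<inter> {z v..z u} = {}" using none by (auto simp: special_def)
  show "\<exists>q. approximates k r window_bound G (z v) (z u) q \<and> (\<forall>x\<in>{z v..z u}. 0 \<le> poly q x) \<and>
      (\<forall>c\<in>special \<inter> {z v..z u}. \<forall>M. int M = contact_order c \<longrightarrow> contact (G 0) (poly q) c M {z v..z u})"
    if "Cr_on r {z v..z u} (G 0) G" "\<And>x. x \<in> {z v..z u} \<Longrightarrow> 0 \<le> G 0 x" for G
    using local_free[OF that(1) z_less[OF uv] k_pos ratio_bound_nonneg that(2)] none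
    unfolding window_bound_def by auto
qed

lemma piece_end:
  assumes uv: "u < v" "v \<le> n" "v - u \<le> 2 * d" and c: "c \<in> {-1, 1}" "c \<in> {z v..z u}"
  shows "\<exists>q. good_piece u v q"
proof (rule piece_unextended[OF uv(1,2)])
  have cs: "c \<in> special" using c by (auto simp: special_def)
  have uniq: "c' = c" if "c' \<in> special" "c' \<in> {z v..z u}" for c'
    using special_unique[OF that(1) cs that(2) c(2)] uv by simp
  have cc: "c = z v \<or> c = z u" using c z_bounds[of u] z_bounds[of v] uv by auto
  show "y ` {1..s} \<inter> {z v..z u} = {}"
  proof (rule equals0I)
    fix x assume x: "x \<in> y ` {1..s} \<inter> {z v..z u}"
    then have "x = c" using uniq[of x] by (auto simp: special_def)
    moreover have "-1 < x" "x < 1" using x y_bounds by auto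
    ultimately show False using c by auto
  qed
  show "\<exists>q. approximates k r window_bound G (z v) (z u) q \<and> (\<forall>x\<in>{z v..z u}. 0 \<le> poly q x) \<and>
      (\<forall>c\<in>special \<inter> {z v..z u}. \<forall>M. int M = contact_order c \<longrightarrow> contact (G 0) (poly q) c M {z v..z u})"
    if G: "Cr_on r {z v..z u} (G 0) G" "\<And>x. x \<in> {z v..z u} \<Longrightarrow> 0 \<le> G 0 x" for G
  proof -
    have "contact_order c' = m3" "c' = c" if "c' \<in> special \<inter> {z v..z u}" for c'
      using uniq[of c'] that c by (auto simp: contact_order_def)
    then show ?thesis
      using local_end[OF adm G(1) ratio_bound_nonneg z_less[OF uv(1,2)] G(2) cc]
      unfolding window_bound_def by metis
  qed
qed


text \<open>Between two special points there are at least two knots, so the knot intervals next to the one that contains \<open>c\<close>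
are free of further special points.\<close>

lemma knots_around:
  assumes c: "c \<in> special" "-1 < c" "c < 1"
  obtains i where "1 \<le> i" "i + 2 \<le> n" "z (i + 1) < c" "c \<le> z i"
    "special \<inter> {z (i + 2)<..<c} = {}" "special \<inter> {c<..<z (i - 1)} = {}"
proof -
  define Q where "Q = {q. q \<le> n \<and> c \<le> z q}"
  have Q: "finite Q" "0 \<in> Q" using c z0 by (auto simp: Q_def)
  define i where "i = Max Q"
  have "i \<in> Q" unfolding i_def using Q by (intro Max_in) auto
  then have i: "i \<le> n" "c \<le> z i" by (auto simp: Q_def)
  have "i \<noteq> n" using i(2) zn c by auto
  then have "Suc i \<le> n" using i by simp
  moreover have "Suc i \<notin> Q"
  proof
    assume "Suc i \<in> Q"
    then have "Suc i \<le> i" unfolding i_def by (rule Max_ge[OF Q(1)])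
    then show False by simp
  qed
  ultimately have i': "i + 1 \<le> n" "z (i + 1) < c" by (auto simp: Q_def)
  have "2 * d \<le> card {q. q \<le> n \<and> -1 < z q \<and> z q < c}"
    using c by (intro special_gap) (auto simp: special_def)
  also have "\<dots> \<le> card {i<..<n}"
  proof (rule card_mono)
    show "{q. q \<le> n \<and> -1 < z q \<and> z q < c} \<subseteq> {i<..<n}"
    proof
      fix q assume q: "q \<in> {q. q \<le> n \<and> -1 < z q \<and> z q < c}"
      then have "z q < z i" "z n < z q" using i zn by auto
      then show "q \<in> {i<..<n}" using z_less_iff[of i q] z_less_iff[of q n] q i by auto
    qed
  qed simp
  finally have n2: "i + 2 \<le> n" using d_ge i' by simp
  have "2 * d \<le> card {q. q \<le> n \<and> c < z q \<and> z q < 1}"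
    using c by (intro special_gap) (auto simp: special_def)
  also have "\<dots> \<le> card {0<..<i+1}"
  proof (rule card_mono)
    show "{q. q \<le> n \<and> c < z q \<and> z q < 1} \<subseteq> {0<..<i+1}"
    proof
      fix q assume q: "q \<in> {q. q \<le> n \<and> c < z q \<and> z q < 1}"
      then have "z q < z 0" "z (i + 1) < z q" using i' z0 by auto
      then show "q \<in> {0<..<i+1}" using z_less_iff[of 0 q] z_less_iff[of q "i + 1"] q i' by auto
    qed
  qed simp
  finally have i1: "1 \<le> i" using d_ge by simp
  \<comment> \<open>A special point this close to c would leave room for a single knot in between,
    fewer than 2 d. The right side is symmetric.\<close>
  have left: "c' \<notin> {z (i + 2)<..<c}" if "c' \<in> special" for c'
  proof
    assume c': "c' \<in> {z (i + 2)<..<c}"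
    have "2 * d \<le> card {q. q \<le> n \<and> c' < z q \<and> z q < c}"
      using c c' that by (intro special_gap) auto
    also have "\<dots> \<le> card {i + 1}"
    proof (rule card_mono)
      show "{q. q \<le> n \<and> c' < z q \<and> z q < c} \<subseteq> {i + 1}"
      proof
        fix q assume q: "q \<in> {q. q \<le> n \<and> c' < z q \<and> z q < c}"
        then have "z q < z i" "z (i + 2) < z q" using i c' by auto
        then have "i < q" "q < i + 2" using z_less_iff[of i q] z_less_iff[of q "i + 2"] q i n2 by auto
        then show "q \<in> {i + 1}" by auto
      qed
    qed simp
    finally show False using d_ge by simp
  qed
  have right: "c' \<notin> {c<..<z (i - 1)}" if "c' \<in> special" for c'
  proof
    assume c': "c' \<in> {c<..<z (i - 1)}"
    have "2 * d \<le> card {q. q \<le> n \<and> c < z q \<and> z q < c'}"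
      using c c' that by (intro special_gap) auto
    also have "\<dots> \<le> card {i}"
    proof (rule card_mono)
      show "{q. q \<le> n \<and> c < z q \<and> z q < c'} \<subseteq> {i}"
      proof
        fix q assume q: "q \<in> {q. q \<le> n \<and> c < z q \<and> z q < c'}"
        then have "z q < z (i - 1)" "z (i + 1) < z q" using i' c' by auto
        then have "i - 1 < q" "q < i + 1" using z_less_iff[of "i - 1" q] z_less_iff[of q "i + 1"] q i' by auto
        then show "q \<in> {i}" by auto
      qed
    qed simp
    finally show False using d_ge by simp
  qed
  show ?thesis using that[of i] i1 n2 i i' left right by blast
qed

text \<open>For z_(i+1) < c <= z_i the window is extended, if necessary, to contain the whole of
  J_(i+2) on the left and J_i on the right. Then c - a and b - c are at least the lengths of these
  two intervals, which the mesh ratio compares with b - a.\<close>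

lemma window_around:
  assumes uv: "u < v" "v \<le> n" "v - u \<le> 2 * d"
    and c: "c \<in> special" "-1 < c" "c < 1" "c \<in> {z v..z u}"
  obtains a b where "a < c" "c < b" "{z v..z u} \<subseteq> {a..b}" "zext n z (int v + 2) \<le> a" "b \<le> zext n z (int u - 1)"
    "special \<inter> {a<..<b} \<subseteq> {c}" "b - a \<le> ratio_bound * (c - a)" "b - a \<le> ratio_bound * (b - c)"
proof -
  obtain i where i: "1 \<le> i" "i + 2 \<le> n" "z (i + 1) < c" "c \<le> z i"
    "special \<inter> {z (i + 2)<..<c} = {}" "special \<inter> {c<..<z (i - 1)} = {}"
    using knots_around[OF c(1-3)] by blast
  have "z (i + 1) < z u" "z v \<le> z i" using i c(4) by auto
  then have ui: "u \<le> i" "i \<le> v" using z_less_iff[of u "i + 1"] z_le_iff[of i v] i uv by auto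
  define a where "a = min (z v) (z (i + 2))"
  define b where "b = max (z u) (z (i - 1))"
  have uniq: "c' = c" if "c' \<in> special" "c' \<in> {z v..z u}" for c'
    using special_unique[OF that(1) c(1) that(2) c(4)] uv by simp
  have step: "z (i + 2) < z (i + 1)" "z i < z (i - 1)" using i by (auto intro: z_less)
  have ac: "a \<le> z (i + 2)" "a < c" and cb: "z (i - 1) \<le> b" "c < b" using i step by (auto simp: a_def b_def)
  have za: "zext n z (int v + 2) \<le> a"
  proof -
    have "zext n z (int v + 2) \<le> z v" using zext_antitone[of "int v" "int v + 2"] zext_nat[of v] uv by simp
    moreover have "zext n z (int v + 2) \<le> z (i + 2)"
      using zext_antitone[of "int (i + 2)" "int v + 2"] zext_nat[of "i + 2"] i ui by simp
    ultimately show ?thesis by (simp add: a_def)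
  qed
  have zb: "b \<le> zext n z (int u - 1)"
  proof -
    have "z u \<le> zext n z (int u - 1)" using zext_antitone[of "int u - 1" "int u"] zext_nat[of u] uv by simp
    moreover have "z (i - 1) \<le> zext n z (int u - 1)"
      using zext_antitone[of "int u - 1" "int (i - 1)"] zext_nat[of "i - 1"] i ui by (simp add: of_nat_diff)
    ultimately show ?thesis by (simp add: b_def)
  qed
  have len: "b - a \<le> ratio_bound * Jlen n z (int q)" if q: "q = i \<or> q = i + 2" for q
  proof -
    have "b - a \<le> zext n z (int q - int (2 * d + 3)) - zext n z (int q + int (2 * d + 3))"
    proof -
      have "int q - int (2 * d + 3) \<le> int u - 1" "int v + 2 \<le> int q + int (2 * d + 3)"
        using q ui uv by auto
      then show ?thesis using za zb zext_antitone by (meson diff_mono order_trans)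
    qed
    also have "\<dots> \<le> ratio_bound * Jlen n z (int q)"
      unfolding ratio_bound_def using q i by (intro hull_length) auto
    finally show ?thesis .
  qed
  note L = ratio_bound_nonneg
  have J: "Jlen n z (int (i + 2)) = z (i + 1) - z (i + 2)" "Jlen n z (int i) = z (i - 1) - z i"
    using i by (auto simp: Jlen_def zext_def nat_diff_distrib nat_add_distrib)
  have "b - a \<le> ratio_bound * (c - a)"
  proof -
    have "ratio_bound * Jlen n z (int (i + 2)) \<le> ratio_bound * (c - a)"
      using L J ac i by (intro mult_left_mono) auto
    then show ?thesis using len[of "i + 2"] by simp
  qed
  moreover have "b - a \<le> ratio_bound * (b - c)"
  proof -
    have "ratio_bound * Jlen n z (int i) \<le> ratio_bound * (b - c)"
      using L J cb i by (intro mult_left_mono) auto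
    then show ?thesis using len[of i] by simp
  qed
  moreover have "special \<inter> {a<..<b} \<subseteq> {c}"
  proof
    fix x assume x: "x \<in> special \<inter> {a<..<b}"
    show "x \<in> {c}"
    proof (cases "x \<in> {z v..z u}")
      case True
      then show ?thesis using uniq x by blast
    next
      case False
      then have "x < z v \<or> z u < x" by auto
      then have "x \<in> {z (i + 2)<..<c} \<or> x \<in> {c<..<z (i - 1)}"
        using x c(4) by (auto simp: a_def b_def)
      then show ?thesis using i x by blast
    qed
  qed
  moreover have "{z v..z u} \<subseteq> {a..b}" by (auto simp: a_def b_def)
  ultimately show ?thesis using that ac cb za zb by blast
qed

lemma piece_alpha:
  assumes uv: "u < v" "v \<le> n" "v - u \<le> 2 * d"
    and c: "c \<in> \<alpha> ` {1..p}" "-1 < c" "c < 1" "c \<in> {z v..z u}"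
  shows "\<exists>q. good_piece u v q"
proof -
  have cs: "c \<in> special" using c by (auto simp: special_def)
  obtain a b where ab: "a < c" "c < b" "{z v..z u} \<subseteq> {a..b}" "zext n z (int v + 2) \<le> a" "b \<le> zext n z (int u - 1)"
    "special \<inter> {a<..<b} \<subseteq> {c}" "b - a \<le> ratio_bound * (c - a)" "b - a \<le> ratio_bound * (b - c)"
    using window_around[OF uv cs c(2-4)] by blast
  have cy: "c \<notin> y ` {1..s}" using c(1) disjoint by blast
  have uniq: "c' = c" if "c' \<in> special" "c' \<in> {z v..z u}" for c'
    using special_unique[OF that(1) cs that(2) c(4)] uv by simp
  show ?thesis
  proof (rule piece_one_sign[OF uv(1,2) ab(3-5)])
    show "y ` {1..s} \<inter> {a<..<b} = {}" using ab(6) cy by (auto simp: special_def)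
    show "y ` {1..s} \<inter> {z v..z u} = {}"
    proof (rule equals0I)
      fix x assume x: "x \<in> y ` {1..s} \<inter> {z v..z u}"
      then have "x = c" using uniq[of x] by (auto simp: special_def)
      then show False using x cy by blast
    qed
    show "\<exists>q. approximates k r window_bound G a b q \<and> (\<forall>x\<in>{a..b}. 0 \<le> poly q x) \<and>
        (\<forall>c\<in>special \<inter> {z v..z u}. \<forall>M. int M = contact_order c \<longrightarrow> contact (G 0) (poly q) c M {a..b})"
      if G: "Cr_on r {a..b} (G 0) G" "\<And>x. x \<in> {a..b} \<Longrightarrow> 0 \<le> G 0 x" for G
    proof -
      have "contact_order c' = m1" "c' = c" if "c' \<in> special \<inter> {z v..z u}" for c'
        using uniq[of c'] that c cy by (auto simp: contact_order_def)
      then show ?thesis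
        using local_alpha[OF adm G(1) ratio_bound_nonneg G(2) ab(1,2,7,8)]
        unfolding window_bound_def by metis
    qed
  qed
qed

lemma piece_sign:
  assumes uv: "u < v" "v \<le> n" "v - u \<le> 2 * d"
    and j: "j \<in> {1..s}" "y j \<in> {z v..z u}"
  shows "\<exists>q. good_piece u v q"
proof -
  define c where "c = y j"
  have c: "-1 < c" "c < 1" "c \<in> {z v..z u}" "c \<in> y ` {1..s}" using j y_bounds by (auto simp: c_def)
  have cs: "c \<in> special" using c by (auto simp: special_def)
  obtain a b where ab: "a < c" "c < b" "{z v..z u} \<subseteq> {a..b}" "zext n z (int v + 2) \<le> a" "b \<le> zext n z (int u - 1)"
    "special \<inter> {a<..<b} \<subseteq> {c}" "b - a \<le> ratio_bound * (c - a)" "b - a \<le> ratio_bound * (b - c)"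
    using window_around[OF uv cs c(1-3)] by blast
  have sub: "{a..b} \<subseteq> {-1..1}" using ab(4,5) zext_bounds by (auto intro: order_trans)
  have bounds: "a < b" "-1 \<le> a" "b \<le> 1" using ab(1,2) sub by auto
  have uniq: "c' = c" if "c' \<in> special" "c' \<in> {z v..z u}" for c'
    using special_unique[OF that(1) cs that(2) c(3)] uv by simp
  have yj: "yext s y j = c" using j by (simp add: yext_def c_def)
  have right: "b \<le> yext s y (j - 1)"
  proof (cases "j = 1")
    case True
    then show ?thesis using bounds by (simp add: yext_def)
  next
    case False
    then have q: "j - 1 \<in> {1..s}" "y j < y (j - 1)" using j y_less[of "j - 1" j] by auto
    then have "y (j - 1) \<in> special" "y (j - 1) \<noteq> c" by (auto simp: special_def c_def)
    then have "\<not> y (j - 1) < b" using ab(1,6) q(2) by (auto simp: c_def)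
    then show ?thesis using q bounds by (simp add: yext_def)
  qed
  have left: "yext s y (Suc j) \<le> a"
  proof (cases "j = s")
    case True
    then show ?thesis using bounds by (simp add: yext_def)
  next
    case False
    then have q: "Suc j \<in> {1..s}" "y (Suc j) < y j" using j y_less[of j "Suc j"] by auto
    then have "y (Suc j) \<in> special" "y (Suc j) \<noteq> c" by (auto simp: special_def c_def)
    then have "\<not> a < y (Suc j)" using ab(2,6) q(2) by (auto simp: c_def)
    then show ?thesis using q by (simp add: yext_def)
  qed
  \<comment> \<open>The sign of f just right of y_j; hence \<sigma> f has the sign of x - c on the
    window.\<close>
  define \<sigma> where "\<sigma> = (-1 :: real) ^ (j - 1)"
  have \<sigma>: "\<bar>\<sigma>\<bar> = 1" by (simp add: \<sigma>_def power_abs)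
  have \<sigma>j: "(-1) ^ j = - \<sigma>" using j by (cases j) (auto simp: \<sigma>_def)
  have fs: "0 \<le> (x - c) * (\<sigma> * D 0 x)" if x: "x \<in> {a..b}" for x
  proof (cases "c \<le> x")
    case True
    then have "x \<in> {yext s y (Suc (j - 1))..yext s y (j - 1)}" using x right yj j by auto
    then have "0 \<le> \<sigma> * f x" unfolding \<sigma>_def using j by (intro f_sign_on) auto
    then show ?thesis using True f_D[of x] x sub by auto
  next
    case False
    then have "x \<in> {yext s y (Suc j)..yext s y j}" using x left yj by auto
    then have "0 \<le> - \<sigma> * f x" unfolding \<sigma>j[symmetric] using j by (intro f_sign_on) auto
    moreover have "f x = D 0 x" using f_D[of x] x sub by auto
    ultimately show ?thesis using False by (simp add: mult_nonpos_nonpos)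
  qed
  obtain q where q: "approximates k r window_bound (\<lambda>i x. \<sigma> * D i x) a b q" "\<And>x. x \<in> {a..b} \<Longrightarrow> 0 \<le> (x - c) * poly q x"
    "\<And>M. int M = m2 \<Longrightarrow> contact (\<lambda>x. \<sigma> * D 0 x) (poly q) c M {a..b}"
    using local_sign[OF adm smooth_sub_scaled[OF sub] ratio_bound_nonneg fs ab(1,2,7,8)]
    unfolding window_bound_def by auto
  have "continuous_on {a..b} (poly q)" by (intro continuous_intros)
  \<comment> \<open>At c the sign conditions of both adjacent intervals apply, so the polynomial
    must vanish there.\<close>
  then have qc: "poly q c = 0" using sign_change_zero[OF _ ab(1,2) q(2)] by blast
  have "good_piece u v (smult \<sigma> q)"
  proof (rule good_pieceI[OF uv(1,2) ab(3-5)])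
    show "approximates k r window_bound D a b (smult \<sigma> q)" using approximates_sign[OF q(1) \<sigma>] .
    show "sign_ok (smult \<sigma> q) x" if x: "x \<in> {z v..z u}" for x
      unfolding sign_ok_def
    proof (intro allI impI)
      fix i assume i: "i \<le> s" "x \<in> {yext s y (Suc i)..yext s y i}"
      have xab: "x \<in> {a..b}" using x ab(3) by blast
      have ny: "x \<notin> y ` {1..s}" if "x \<noteq> c"
        using uniq[of x] x that by (auto simp: special_def)
      consider "x = c" | "c < x" | "x < c" by linarith
      then show "0 \<le> (- 1) ^ i * poly (smult \<sigma> q) x"
      proof cases
        case 1
        then show ?thesis using qc by simp
      next
        case 2
        have "x \<in> {yext s y (Suc (j - 1))..yext s y (j - 1)}" using 2 xab right yj j by auto
        moreover have "j - 1 \<le> s" using j by auto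
        ultimately have ij: "i = j - 1" using yext_interval_unique[OF ny i] 2 by blast
        have "(- 1) ^ i * poly (smult \<sigma> q) x = \<sigma> * (\<sigma> * poly q x)" by (simp add: ij \<sigma>_def)
        also have "\<dots> = poly q x" by (rule sign_cancel(1)[OF \<sigma>])
        finally show ?thesis using q(2)[OF xab] 2 by (simp only: zero_le_mult_iff) auto
      next
        case 3
        have "x \<in> {yext s y (Suc j)..yext s y j}" using 3 xab left yj by auto
        moreover have "j \<le> s" using j by auto
        ultimately have ij: "i = j" using yext_interval_unique[OF ny i] 3 by blast
        have "(- 1) ^ i * poly (smult \<sigma> q) x = - (\<sigma> * (\<sigma> * poly q x))" by (simp add: ij \<sigma>j)
        also have "\<dots> = - poly q x" by (simp only: sign_cancel(1)[OF \<sigma>])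
        finally show ?thesis using q(2)[OF xab] 3 by (simp only: zero_le_mult_iff) auto
      qed
    qed
    show "contact (D 0) (poly (smult \<sigma> q)) c' M {a..b}"
      if c': "c' \<in> special" "c' \<in> {z v..z u}" and M: "int M = contact_order c'" for c' M
    proof -
      have "c' = c" using uniq c' by blast
      moreover have "contact_order c = m2" using c by (auto simp: contact_order_def)
      ultimately show ?thesis using contact_sign[OF q(3) \<sigma>] M by simp
    qed
  qed
  then show ?thesis by blast
qed

lemma piece_exists:
  assumes uv: "u < v" "v \<le> n" "v - u \<le> 2 * d"
  shows "\<exists>q. good_piece u v q"
proof (cases "special \<inter> {z v..z u} = {}")
  case True
  then show ?thesis using piece_free uv by blast
next
  case False
  then obtain c where c: "c \<in> special" "c \<in> {z v..z u}" by blast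
  then consider "c \<in> {-1, 1}" | "c \<in> y ` {1..s}" | "c \<in> \<alpha> ` {1..p}" "c \<notin> {-1, 1}"
    by (auto simp: special_def)
  then show ?thesis
  proof cases
    case 1 then show ?thesis using piece_end uv c by blast
  next
    case 2 then show ?thesis using piece_sign[OF uv] c by blast
  next
    case 3
    then have "-1 < c" "c < 1" using special_bounds[OF c(1)] by auto
    then show ?thesis using piece_alpha[OF uv 3(1)] c by blast
  qed
qed


section \<open>Assembly of the spline\<close>

definition error_const :: real where
  "error_const = window_bound * growth (3 * d) (rho n z) ^ r"

lemma error_const_nonneg: "0 \<le> error_const"
  unfolding error_const_def window_bound_def local_const_def ratio_bound_def
  by (intro mult_nonneg_nonneg zero_le_power growth_nonneg whitney_const_nonneg add_nonneg_nonneg) auto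

lemma copositive_spline_exists:
  "\<exists>S E. Sigma (k + r) n z S \<and> Cr_on (k + r - 2) {-1..1} S E \<and> Delta0 s y S \<and>
     (\<forall>a\<in>\<alpha> ` {1..p}. \<forall>i::nat. int i \<le> m1 \<longrightarrow> E i a = D i a) \<and>
     (\<forall>b\<in>y ` {1..s}. \<forall>i::nat. int i \<le> m2 \<longrightarrow> E i b = D i b) \<and>
     (\<forall>i::nat. int i \<le> m3 \<longrightarrow> E i 1 = D i 1 \<and> E i (-1) = D i (-1)) \<and>
     (\<forall>i::nat. i \<le> n \<longrightarrow>
        (\<exists>a b. a \<le> b \<and> Jint n z (int i) \<subseteq> {a..b} \<and>
           {a..b} \<subseteq> {zext n z (int i + int (3 * d)) .. zext n z (int i - int (3 * d))} \<and>
           (\<forall>x\<in>Jint n z (int i).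
              \<bar>f x - S x\<bar> \<le> error_const * (Jlen n z (int i)) ^ r * modsm k (D r) (b - a) {a..b})))"
proof -
  \<comment> \<open>The n knot intervals are N + 1 whole blocks and a remainder of between 1 and d
    intervals, which completes the last pair; n - 1 in place of n keeps the remainder
    nonempty.\<close>
  define N where "N = (n - 1) div d - 1"
  have "2 * d \<le> card {i. i \<le> n \<and> -1 < z i \<and> z i < 1}"
    by (intro special_gap) (auto simp: special_def)
  also have "\<dots> \<le> card {0<..<n}"
  proof (rule card_mono)
    show "{i. i \<le> n \<and> -1 < z i \<and> z i < 1} \<subseteq> {0<..<n}"
    proof
      fix i assume i: "i \<in> {i. i \<le> n \<and> -1 < z i \<and> z i < 1}"
      then have "z i \<noteq> z 0" "z i \<noteq> z n" "i \<le> n" using z0 zn by auto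
      then have "i \<noteq> 0 \<and> i \<noteq> n \<and> i \<le> n" by metis
      then show "i \<in> {0<..<n}" by auto
    qed
  qed simp
  finally have nd: "2 * d \<le> n - 1" by simp
  then have q2: "2 \<le> (n - 1) div d" using d_ge by (simp add: less_eq_div_iff_mult_less_eq)
  have N1: "(N + 1) * d < n"
  proof -
    have "(N + 1) * d = (n - 1) div d * d" using q2 by (simp add: N_def)
    also have "\<dots> \<le> n - 1" by (rule div_times_less_eq_dividend)
    finally show ?thesis using n_pos by simp
  qed
  have N2: "n \<le> (N + 2) * d"
  proof -
    have "n - 1 < ((n - 1) div d + 1) * d" 
      using dividend_less_div_times[of d "n - 1"] d_ge by (simp add: algebra_simps)
    also have "(n - 1) div d + 1 = N + 2" using q2 by (simp add: N_def)
    finally show ?thesis by simp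
  qed
  define u where "u j = j * d" for j
  define v where "v j = min ((j + 2) * d) n" for j
  have uv: "u j < v j" "v j \<le> n" "v j - u j \<le> 2 * d" if "j \<le> N" for j
  proof -
    have "N * d + d < n" using N1 by simp
    then have "j * d < n" using mult_le_mono1[OF that, of d] by linarith
    then show "u j < v j" using d_ge by (auto simp: u_def v_def)
    show "v j \<le> n" "v j - u j \<le> 2 * d" by (auto simp: u_def v_def add_mult_distrib)
  qed
  define reg where "reg j = {z (v j)..z (u j)}" for j
  have "\<forall>j\<in>{..N}. \<exists>q. good_piece (u j) (v j) q" using piece_exists[OF uv] by auto
  then obtain q where q: "\<And>j. j \<le> N \<Longrightarrow> good_piece (u j) (v j) (q j)" unfolding bchoice_iff by auto
  have deg: "degree (q j) \<le> m" if "j \<le> N" for j using q[OF that] by (simp add: good_piece_def)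
  have z_step: "z (Suc j) < z j" if "j < n" for j using knots that by (simp add: knot_seq_def)
  obtain P c where Pc: "degree P \<le> m"
    "\<forall>x \<le> z ((N + 1) * d). knot_spline m z n P c x = poly (q N) x"
    "\<forall>x lo hi. z ((N + 1) * d) \<le> x \<longrightarrow> x \<le> z 0 \<longrightarrow>
      (\<forall>j\<le>N. x \<le> z (j * d) \<longrightarrow> z (min ((j + 2) * d) n) \<le> x \<longrightarrow> lo \<le> poly (q j) x \<and> poly (q j) x \<le> hi) \<longrightarrow>
      lo \<le> knot_spline m z n P c x \<and> knot_spline m z n P c x \<le> hi"
    using spline_chain[where p = q and z = z and n = n and N = N, OF m_pos d_def z_step deg less_imp_le[OF N1]] by blast
  define S where "S = knot_spline m z n P c"
  \<comment> \<open>Sign, contact and error of S are all derived from this statement, by a choice of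
    lo and hi that works for every piece around x.\<close>
  have hull: "lo \<le> S x \<and> S x \<le> hi"
    if x: "x \<in> {-1..1}" and H: "\<And>j. j \<le> N \<Longrightarrow> x \<in> reg j \<Longrightarrow> lo \<le> poly (q j) x \<and> poly (q j) x \<le> hi" for x lo hi
  proof (cases "z ((N + 1) * d) \<le> x")
    case True
    then show ?thesis unfolding S_def using x z0 H
      by (intro Pc(3)[THEN spec, THEN spec, THEN spec, THEN mp, THEN mp, THEN mp]) (auto simp: reg_def u_def v_def)
  next
    case False
    have "z ((N + 1) * d) \<le> z (N * d)" using N1 by (intro z_le) auto
    moreover have "v N = n" using N2 by (simp add: v_def)
    ultimately have "x \<in> reg N" using False x zn by (auto simp: reg_def u_def)
    then show ?thesis using H[of N] Pc(2) False by (simp add: S_def)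
  qed
  have mkr: "k + r = Suc m" "k + r - 2 = m - 1" using admissible_pos[OF adm] by (auto simp: m_def)
  have Sig: "Sigma (k + r) n z S"
    unfolding mkr S_def by (rule Sigma_knot_spline[OF m_pos Pc(1) knots])
  obtain E where E: "Cr_on (k + r - 2) {-1..1} S E"
    using Cr_on_knot_spline[OF m_pos, of "{-1..1}" z n P c] unfolding mkr(2) S_def by blast
  have sign: "Delta0 s y S"
    unfolding Delta0_def
  proof (intro allI impI ballI)
    fix i x assume i: "i \<le> s" and x: "x \<in> {yext s y (Suc i)..yext s y i}"
    have "yext s y i \<le> 1" "-1 \<le> yext s y (Suc i)"
      using i y_bounds[of i] y_bounds[of "Suc i"] by (auto simp: yext_def less_imp_le)
    then have x1: "x \<in> {-1..1}" using x by auto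
    have ok: "0 \<le> (-1) ^ i * poly (q j) x" if "j \<le> N" "x \<in> reg j" for j
      using q[OF that(1)] that(2) i x by (auto simp: good_piece_def sign_ok_def reg_def)
    \<comment> \<open>\<open>hull\<close> needs two finite bounds; B supplies the side on which the
      sign condition says nothing.\<close>
    define B where "B = (\<Sum>j\<le>N. \<bar>poly (q j) x\<bar>)"
    have B: "\<bar>poly (q j) x\<bar> \<le> B" if "j \<le> N" for j
      unfolding B_def using that by (intro member_le_sum) auto
    show "0 \<le> (-1) ^ i * S x"
    proof (cases "even i")
      case True
      have "0 \<le> poly (q j) x \<and> poly (q j) x \<le> B" if "j \<le> N" "x \<in> reg j" for j
        using ok[OF that] B[OF that(1)] True by auto
      then have "0 \<le> S x" using hull[OF x1, of 0 B] by blast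
      then show ?thesis using True by simp
    next
      case False
      have "- B \<le> poly (q j) x \<and> poly (q j) x \<le> 0" if "j \<le> N" "x \<in> reg j" for j
        using ok[OF that] B[OF that(1)] False by auto
      then have "S x \<le> 0" using hull[OF x1, of "- B" 0] by blast
      then show ?thesis using False by simp
    qed
  qed
  \<comment> \<open>A piece whose closed pair of blocks misses c stays at a positive distance from
    it, and finitely many pieces admit a common radius.\<close>
  have con: "contact f S c M {-1..1}"
    if H: "\<And>j. j \<le> N \<Longrightarrow> c \<in> reg j \<Longrightarrow> contact f (poly (q j)) c M (reg j)" for c M
    unfolding contact_def
  proof (intro allI impI)
    fix \<epsilon> :: real assume \<epsilon>: "0 < \<epsilon>"
    have "\<exists>\<eta>>0. \<forall>x\<in>reg j. \<bar>x - c\<bar> < \<eta> \<longrightarrow> \<bar>f x - poly (q j) x\<bar> \<le> \<epsilon> * \<bar>x - c\<bar> ^ M" if j: "j \<le> N" for j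
    proof (cases "c \<in> reg j")
      case True
      then show ?thesis using H[OF j True] \<epsilon> unfolding contact_def by blast
    next
      case False
      define \<eta> where "\<eta> = (if c < z (v j) then z (v j) - c else c - z (u j))"
      have "0 < \<eta>" "\<And>x. x \<in> reg j \<Longrightarrow> \<not> \<bar>x - c\<bar> < \<eta>" using False by (auto simp: reg_def \<eta>_def)
      then show ?thesis by blast
    qed
    then have "\<forall>j\<in>{..N}. \<exists>\<eta>>0. \<forall>x\<in>reg j. \<bar>x - c\<bar> < \<eta> \<longrightarrow> \<bar>f x - poly (q j) x\<bar> \<le> \<epsilon> * \<bar>x - c\<bar> ^ M" by auto
    then obtain \<eta> where \<eta>: "\<And>j. j \<le> N \<Longrightarrow> 0 < \<eta> j"
      "\<And>j x. j \<le> N \<Longrightarrow> x \<in> reg j \<Longrightarrow> \<bar>x - c\<bar> < \<eta> j \<Longrightarrow> \<bar>f x - poly (q j) x\<bar> \<le> \<epsilon> * \<bar>x - c\<bar> ^ M"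
      unfolding bchoice_iff by auto
    have "\<bar>f x - S x\<bar> \<le> \<epsilon> * \<bar>x - c\<bar> ^ M" if x: "x \<in> {-1..1}" "\<bar>x - c\<bar> < Min (\<eta> ` {..N})" for x
    proof -
      let ?e = "\<epsilon> * \<bar>x - c\<bar> ^ M"
      have "f x - ?e \<le> poly (q j) x \<and> poly (q j) x \<le> f x + ?e" if j: "j \<le> N" "x \<in> reg j" for j
      proof -
        have "\<bar>x - c\<bar> < \<eta> j" using x(2) j(1) by simp
        then show ?thesis using \<eta>(2)[OF j] by (simp add: abs_le_iff)
      qed
      then have "f x - ?e \<le> S x \<and> S x \<le> f x + ?e" using hull[OF x(1)] by blast
      then show ?thesis by (simp add: abs_le_iff)
    qed
    moreover have "0 < Min (\<eta> ` {..N})" using \<eta>(1) by simp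
    ultimately show "\<exists>\<eta>>0. \<forall>x\<in>{-1..1}. \<bar>x - c\<bar> < \<eta> \<longrightarrow> \<bar>f x - S x\<bar> \<le> \<epsilon> * \<bar>x - c\<bar> ^ M" by blast
  qed
  note orders = admissible_orders[OF adm]
  have derivs: "E i c = D i c" if c: "c \<in> special" and i: "int i \<le> contact_order c" for c i
  proof -
    have "contact_order c \<le> int r" "contact_order c \<le> int (k + r - 2)"
      using orders by (auto simp: contact_order_def)
    \<comment> \<open>The order may be -1, but then no natural number i satisfies the bound; so
      \<open>nat\<close> loses nothing here.\<close>
    then have M: "int (nat (contact_order c)) = contact_order c" "nat (contact_order c) \<le> r"
      "nat (contact_order c) \<le> k + r - 2" "i \<le> nat (contact_order c)"
      using i by auto
    have "contact f S c (nat (contact_order c)) {-1..1}"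
    proof (rule con)
      show "contact f (poly (q j)) c (nat (contact_order c)) (reg j)" if "j \<le> N" "c \<in> reg j" for j
        using q[OF that(1)] that(2) c M(1) unfolding good_piece_def reg_def by blast
    qed
    then show ?thesis
      using contact_derivatives[OF f_smooth M(2) E M(3) _ _ M(4)] special_bounds[OF c] by auto
  qed
  have ends: "E i c = D i c" if "c \<in> {-1, 1}" "int i \<le> m3" for c i
    using derivs[of c i] that by (auto simp: special_def contact_order_def)
  have at_\<alpha>: "E i c = D i c" if c: "c \<in> \<alpha> ` {1..p}" and i: "int i \<le> m1" for c i
  proof -
    have "c \<notin> y ` {1..s}" using c disjoint by blast
    then have "m1 \<le> contact_order c" using orders by (auto simp: contact_order_def)
    then show ?thesis using derivs[of c i] c i by (auto simp: special_def)
  qed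
  have at_y: "E i c = D i c" if c: "c \<in> y ` {1..s}" and i: "int i \<le> m2" for c i
  proof -
    have "c \<notin> {-1, 1}" using c y_bounds by fastforce
    then show ?thesis using derivs[of c i] c i by (auto simp: special_def contact_order_def)
  qed
  have f1: "S 1 = f 1"
  proof -
    have "E 0 1 = D 0 1" using ends[of 1 0] orders by simp
    then show ?thesis using E f_smooth by (simp add: Cr_on_def)
  qed
  have cont: "continuous_on {-1..1} (D r)" using f_smooth by (simp add: Cr_on_def)
  have err: "\<bar>f x - S x\<bar> \<le> error_const * (Jlen n z (int i)) ^ r *
      modsm k (D r) (zext n z (int i - int (3 * d)) - zext n z (int i + int (3 * d)))
        {zext n z (int i + int (3 * d))..zext n z (int i - int (3 * d))}"
    if i: "i \<le> n" and x: "x \<in> Jint n z (int i)" for i x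
  proof -
    define a where "a = zext n z (int i + int (3 * d))"
    define b where "b = zext n z (int i - int (3 * d))"
    have ab: "a \<le> b" unfolding a_def b_def by (intro zext_antitone) simp
    have sub: "-1 \<le> a" "b \<le> 1" using zext_bounds by (auto simp: a_def b_def)
    have cab: "continuous_on {a..b} (D r)" using sub by (intro continuous_on_subset[OF cont]) auto
    have mod0: "0 \<le> modsm k (D r) (b - a) {a..b}" using ab by (intro modsm_nonneg cab) auto
    show ?thesis unfolding a_def[symmetric] b_def[symmetric]
    proof (cases "i = 0")
      \<comment> \<open>J_0 is the single point 1. For r >= 1 the right-hand side is zero, so
        interpolation at 1 is essential.\<close>
      case True
      then have "x = 1" using x z0 by (auto simp: Jint_def zext_def)
      then show "\<bar>f x - S x\<bar> \<le> error_const * (Jlen n z (int i)) ^ r * modsm k (D r) (b - a) {a..b}"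
        using f1 mod0 error_const_nonneg Jlen_nonneg by simp
    next
      case False
      then have i1: "1 \<le> i" by simp
      have xi: "z i \<le> x" "x \<le> z (i - 1)" using x i i1 by (auto simp: Jint_def zext_def nat_diff_distrib)
      have im: "i - 1 \<le> n" using i by simp
      have x1: "x \<in> {-1..1}" using xi z_bounds[OF i] z_bounds[OF im] by auto
      let ?J = "Jlen n z (int i)"
      let ?e = "error_const * ?J ^ r * modsm k (D r) (b - a) {a..b}"
      have "f x - ?e \<le> poly (q j) x \<and> poly (q j) x \<le> f x + ?e" if j: "j \<le> N" "x \<in> reg j" for j
      proof -
        have "z i \<le> z (u j)" "z (v j) \<le> z (i - 1)" using j(2) xi by (auto simp: reg_def)
        then have ij: "u j \<le> i" "i - 1 \<le> v j"
          using z_le_iff[OF _ i, of "u j"] z_le_iff[OF im uv(2)[OF j(1)]] uv[OF j(1)] by auto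
        obtain a' b' where w: "a' < b'" "reg j \<subseteq> {a'..b'}"
          "{a'..b'} \<subseteq> {zext n z (int (v j) + 2)..zext n z (int (u j) - 1)}"
          "\<And>x. x \<in> {a'..b'} \<Longrightarrow> \<bar>f x - poly (q j) x\<bar> \<le> window_bound * ((b' - a') ^ r * modsm k (D r) (b' - a') {a'..b'})"
          using q[OF j(1)] unfolding good_piece_def reg_def by blast
        \<comment> \<open>From i - 1 <= v, u <= i and v - u <= 2 d the window lies within 2 d + 2
          indices of i, and 2 d + 2 <= 3 d because d >= 2.\<close>
        have "int (v j) + 2 \<le> int i + int (3 * d)" using ij uv[OF j(1)] d_ge by auto
        then have a': "a \<le> a'" using zext_antitone[of "int (v j) + 2" "int i + int (3 * d)"] w(1,3) by (auto simp: a_def)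
        have "int i - int (3 * d) \<le> int (u j) - 1" using ij uv[OF j(1)] d_ge i1 by auto
        then have b': "b' \<le> b" using zext_antitone[of "int i - int (3 * d)" "int (u j) - 1"] w(1,3) by (auto simp: b_def)
        have "b' - a' \<le> growth (3 * d) (rho n z) * ?J"
          using hull_length[of "int i" "3 * d"] i i1 a' b' unfolding a_def b_def by auto
        then have "(b' - a') ^ r \<le> (growth (3 * d) (rho n z) * ?J) ^ r" using w(1) by (intro power_mono) auto
        moreover have "modsm k (D r) (b' - a') {a'..b'} \<le> modsm k (D r) (b - a) {a..b}"
          using w(1) a' b' by (intro modsm_mono cab) auto
        moreover have "0 \<le> modsm k (D r) (b' - a') {a'..b'}"
          using w(1) a' b' by (intro modsm_nonneg continuous_on_subset[OF cab]) auto
        moreover have wb: "0 \<le> window_bound"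
          unfolding window_bound_def local_const_def ratio_bound_def
          by (intro mult_nonneg_nonneg growth_nonneg whitney_const_nonneg add_nonneg_nonneg) auto
        ultimately have "window_bound * ((b' - a') ^ r * modsm k (D r) (b' - a') {a'..b'})
            \<le> window_bound * ((growth (3 * d) (rho n z) * ?J) ^ r * modsm k (D r) (b - a) {a..b})"
          using w(1) growth_nonneg Jlen_nonneg by (intro mult_left_mono mult_mono) auto
        also have "\<dots> = ?e" by (simp add: error_const_def power_mult_distrib)
        finally have "\<bar>f x - poly (q j) x\<bar> \<le> ?e" using w(4)[of x] w(2) j(2) by fastforce
        then show ?thesis by (simp add: abs_le_iff)
      qed
      then have "f x - ?e \<le> S x \<and> S x \<le> f x + ?e" using hull[OF x1] by blast
      then show "\<bar>f x - S x\<bar> \<le> ?e" by (simp add: abs_le_iff)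
    qed
  qed
  have J_sub: "Jint n z (int i) \<subseteq> {zext n z (int i + int (3 * d))..zext n z (int i - int (3 * d))}" for i
    using zext_antitone[of "int i" "int i + int (3 * d)"] zext_antitone[of "int i - int (3 * d)" "int i - 1"] d_ge
    by (auto simp: Jint_def)
  have le: "zext n z (int i + int (3 * d)) \<le> zext n z (int i - int (3 * d))" for i
    by (intro zext_antitone) simp
  show ?thesis
  proof (intro exI[of _ S] exI[of _ E] conjI allI impI)
    fix i assume "i \<le> n"
    then show "\<exists>a b. a \<le> b \<and> Jint n z (int i) \<subseteq> {a..b} \<and>
           {a..b} \<subseteq> {zext n z (int i + int (3 * d)) .. zext n z (int i - int (3 * d))} \<and>
           (\<forall>x\<in>Jint n z (int i).
              \<bar>f x - S x\<bar> \<le> error_const * (Jlen n z (int i)) ^ r * modsm k (D r) (b - a) {a..b})"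
      using le[of i] J_sub[of i] err by blast
  qed (use Sig E sign at_\<alpha> at_y ends in auto)
qed

end

theorem theorem4p11:
  fixes k r :: nat
  shows "\<exists>C :: real \<Rightarrow> real.
    \<forall>(m1::int) (m2::int) (m3::int) (p::nat) (s::nat) (y::nat \<Rightarrow> real) (\<alpha>::nat \<Rightarrow> real)
      (f::real \<Rightarrow> real) (D::nat \<Rightarrow> real \<Rightarrow> real) (n::nat) (z::nat \<Rightarrow> real).
      ( (r, k, m1, m2, m3) \<in> admissible \<and>
        p \<ge> 1 \<and>
        (\<forall>i\<in>{1..s}. -1 < y i \<and> y i < 1) \<and>
        (\<forall>i. 1 \<le> i \<and> i < s \<longrightarrow> y (Suc i) < y i) \<and>
        (\<forall>i\<in>{1..p}. -1 \<le> \<alpha> i \<and> \<alpha> i \<le> 1) \<and>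
        (\<forall>i. 1 \<le> i \<and> i < p \<longrightarrow> \<alpha> (Suc i) < \<alpha> i) \<and>
        y ` {1..s} \<inter> \<alpha> ` {1..p} = {} \<and>
        Cr_on r {-1..1} f D \<and> Delta0 s y f \<and>
        knot_seq n z \<and>
        (\<forall>j\<in>{1..s+p+1}.
           beta (y ` {1..s} \<union> \<alpha> ` {1..p}) j < beta (y ` {1..s} \<union> \<alpha> ` {1..p}) (j - 1) \<longrightarrow>
           card {i. i \<le> n \<and> beta (y ` {1..s} \<union> \<alpha> ` {1..p}) j < z i \<and>
                     z i < beta (y ` {1..s} \<union> \<alpha> ` {1..p}) (j - 1)}
             \<ge> 4 * (k + r - 1)^2) )
      \<longrightarrow>
      (\<exists>S DS. Sigma (k + r) n z S \<and> Cr_on (k + r - 2) {-1..1} S DS \<and> Delta0 s y S \<and>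
         (\<forall>a\<in>\<alpha> ` {1..p}. \<forall>i::nat. int i \<le> m1 \<longrightarrow> DS i a = D i a) \<and>
         (\<forall>b\<in>y ` {1..s}. \<forall>i::nat. int i \<le> m2 \<longrightarrow> DS i b = D i b) \<and>
         (\<forall>i::nat. int i \<le> m3 \<longrightarrow> DS i 1 = D i 1 \<and> DS i (-1) = D i (-1)) \<and>
         (\<forall>i::nat. i \<le> n \<longrightarrow>
            (\<exists>a b. a \<le> b \<and> Jint n z (int i) \<subseteq> {a..b} \<and>
               {a..b} \<subseteq> {zext n z (int i + 6 * (int k + int r - 1)^2) ..
                          zext n z (int i - 6 * (int k + int r - 1)^2)} \<and>
               (\<forall>x\<in>Jint n z (int i).
                  \<bar>f x - S x\<bar> \<le> C (rho n z) * (Jlen n z (int i)) ^ r *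
                                  modsm k (D r) (b - a) {a..b}))))"
proof -
  define e where "e = 2 * (k + r - 1)^2"
  \<comment> \<open>C has to be chosen before the knots and the remaining data, so the constants are
    restated as functions of q, the value of rho.\<close>
  define C where "C q = local_const k (growth (2 * e + 3) q) * growth (3 * e) q ^ r" for q
  show ?thesis
  proof (rule exI[of _ C], intro allI impI, elim conjE, goal_cases)
    case (1 m1 m2 m3 p s y \<alpha> f D n z)
    interpret copositive_problem n z k r m1 m2 m3 p s y \<alpha> f D
      by unfold_locales (use 1 in auto)
    have de: "d = e" by (simp add: d_def e_def m_def)
    have "int (3 * d) = 6 * (int k + int r - 1)^2"
      using k_pos by (simp add: d_def m_def of_nat_diff)
    moreover have "error_const = C (rho n z)"
      by (simp add: error_const_def window_bound_def ratio_bound_def C_def de)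
    ultimately show ?case
      using copositive_spline_exists by simp
  qed
qed

end
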